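(* Let $1 \le p, q < \infty$ and $s\in\mathbf{R}$, and suppose that either $s > n/q'$, or $q=1$ and $s \ge 0$. Then for every $f \in M^{p,q}_s(\mathbf{R}^n)$ and every $\varepsilon > 0$ there exists $\phi \in C_c^\infty(\mathbf{R}^n)$ such that $$\| f - \phi f \|_{M^{p,q}_s} < \varepsilon .$$
   Context: $q'$ denotes the conjugate exponent, $\frac1q+\frac1{q'}=1$ (so $n/q'=0$ if $q=1$). $\langle \xi\rangle=(1+|\xi|^2)^{1/2}$. $\mathcal{S}(\mathbf{R}^n)$ is the Schwartz space, $\mathcal{S}'(\mathbf{R}^n)$ the tempered distributions. For $f\in\mathcal{S}'(\mathbf{R}^n)$ and a window $\phi_0\in\mathcal{S}(\mathbf{R}^n)\setminus\{0\}$, the short-time Fourier transform is $V_{\phi_0}f(x,\xi)=\langle f, M_\xi T_x\phi_0\rangle=\int_{\mathbf{R}^n} f(t)\overline{\phi_0(t-x)}e^{-it\xi}\,dt$ (interpreted by duality), with $(T_xh)(t)=h(t-x)$, $(M_\xi h)(t)=e^{it\xi}h(t)$. The modulation space $M^{p,q}_s(\mathbf{R}^n)$ consists of all $f\in\mathcal{S}'(\mathbf{R}^n)$ with $$\|f\|_{M^{p,q}_s}=\Big(\int_{\mathbf{R}^n}\langle\xi\rangle^{sq}\Big(\int_{\mathbf{R}^n}|V_{\phi_0}f(x,\xi)|^p\,dx\Big)^{q/p}d\xi\Big)^{1/q}<\infty .$$ Different windows give equivalent norms; one window is fixed. $C_c^\infty(\mathbf{R}^n)$ is the set of complex-valued compactly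 supported smooth functions. *)

theory Defs
  imports "HOL-Analysis.Analysis"
begin

fun iter_pderiv :: "'a::euclidean_space list \<Rightarrow> ('a \<Rightarrow> complex) \<Rightarrow> 'a \<Rightarrow> complex" where
  "iter_pderiv [] h = h"
| "iter_pderiv (b # bs) h = (\<lambda>x. frechet_derivative (iter_pderiv bs h) (at x) b)"

text \<open>
  Lists of basis vectors play the role of multi-indices. A function is \<open>C\<^sup>\<infinity>\<close> iff all
  its iterated partial derivatives exist and are (Frechet) differentiable everywhere.
\<close>

definition smooth :: "('a::euclidean_space \<Rightarrow> complex) \<Rightarrow> bool" where
  "smooth h \<longleftrightarrow> (\<forall>bs x. set bs \<subseteq> Basis \<longrightarrow> iter_pderiv bs h differentiable (at x))"

definition Cc_infinity :: "('a::euclidean_space \<Rightarrow> complex) set" where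
  "Cc_infinity = {h. smooth h \<and> compact (closure {x. h x \<noteq> 0})}"

definition japanese_bracket :: "'a::euclidean_space \<Rightarrow> real" where
  "japanese_bracket \<xi> = sqrt (1 + (norm \<xi>)\<^sup>2)"

definition schwartz_space :: "('a::euclidean_space \<Rightarrow> complex) set" where
  "schwartz_space = {h. smooth h \<and> (\<forall>k bs. set bs \<subseteq> Basis \<longrightarrow>
     bounded (range (\<lambda>x. japanese_bracket x ^ k * norm (iter_pderiv bs h x))))}"

definition schwartz_seminorm :: "nat \<Rightarrow> 'a::euclidean_space list \<Rightarrow> ('a \<Rightarrow> complex) \<Rightarrow> real" where
  "schwartz_seminorm k bs h = (SUP x. japanese_bracket x ^ k * norm (iter_pderiv bs h x))"

definition schwartz_topology :: "('a::euclidean_space \<Rightarrow> complex) topology" where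
  "schwartz_topology = topology_generated_by
     {{h \<in> schwartz_space. schwartz_seminorm k bs (h - h0) < r} | h0 k bs r.
        h0 \<in> schwartz_space \<and> set bs \<subseteq> Basis \<and> 0 < r}"

lemma iter_pderiv_zero: "iter_pderiv bs (\<lambda>_. 0) = (\<lambda>_. 0)"
  by (induction bs) simp_all

lemma topspace_schwartz_topology: "topspace schwartz_topology = schwartz_space"
proof -
  have "\<exists>U. (\<exists>h0 k bs r. U = {h \<in> schwartz_space. schwartz_seminorm k bs (h - h0) < r} \<and>
      h0 \<in> schwartz_space \<and> set bs \<subseteq> Basis \<and> (0::real) < r) \<and> h \<in> U"
    if "h \<in> schwartz_space" for h :: "'a \<Rightarrow> complex"
  proof -
    have "h - h = (\<lambda>_. 0)"
      by auto
    then have "h \<in> {h' \<in> schwartz_space. schwartz_seminorm 0 [] (h' - h) < 1}"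
      using that by (simp add: schwartz_seminorm_def)
    moreover have "set [] \<subseteq> (Basis :: 'a set)" "(0::real) < 1"
      by simp_all
    ultimately show ?thesis
      using that by blast
  qed
  then show ?thesis
    unfolding schwartz_topology_def topology_generated_by_topspace by auto
qed

text \<open>
  A tempered distribution is represented by a functional on all functions, of which only the
  restriction to the Schwartz space matters. The pairing is bilinear: a locally integrable function
  \<open>u\<close> of polynomial growth corresponds to \<open>\<psi> \<mapsto> \<integral> u(t) \<psi>(t) dt\<close>.
\<close>

definition tempered_distributions :: "(('a::euclidean_space \<Rightarrow> complex) \<Rightarrow> complex) set" where
  "tempered_distributions = {f.
     (\<forall>h1\<in>schwartz_space. \<forall>h2\<in>schwartz_space. f (\<lambda>t. h1 t + h2 t) = f h1 + f h2) \<and>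
     (\<forall>c. \<forall>h\<in>schwartz_space. f (\<lambda>t. c * h t) = c * f h) \<and>
     continuous_map schwartz_topology euclidean f}"

definition distr_mult ::
  "('a::euclidean_space \<Rightarrow> complex) \<Rightarrow> (('a \<Rightarrow> complex) \<Rightarrow> complex) \<Rightarrow> (('a \<Rightarrow> complex) \<Rightarrow> complex)" where
  "distr_mult \<phi> f = (\<lambda>\<psi>. f (\<lambda>t. \<phi> t * \<psi> t))"

definition translation :: "'a::euclidean_space \<Rightarrow> ('a \<Rightarrow> complex) \<Rightarrow> 'a \<Rightarrow> complex" where
  "translation x h = (\<lambda>t. h (t - x))"

definition modulation :: "'a::euclidean_space \<Rightarrow> ('a \<Rightarrow> complex) \<Rightarrow> 'a \<Rightarrow> complex" where
  "modulation \<xi> h = (\<lambda>t. exp (\<i> * complex_of_real (t \<bullet> \<xi>)) * h t)"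

text \<open>
  The short-time Fourier transform pairs \<open>f\<close> with \<open>M\<^sub>\<xi> T\<^sub>x \<phi>\<^sub>0\<close> sesquilinearly, hence the
  conjugate under the bilinear pairing.
\<close>

definition stft ::
  "('a::euclidean_space \<Rightarrow> complex) \<Rightarrow> (('a \<Rightarrow> complex) \<Rightarrow> complex) \<Rightarrow> 'a \<Rightarrow> 'a \<Rightarrow> complex" where
  "stft \<phi>0 f x \<xi> = f (\<lambda>t. cnj (modulation \<xi> (translation x \<phi>0) t))"

text \<open>Used only for \<open>r > 0\<close>, where \<open>\<infinity>\<^sup>r = \<infinity>\<close>.\<close>

definition ennreal_powr :: "ennreal \<Rightarrow> real \<Rightarrow> ennreal" where
  "ennreal_powr y r = (if y = \<infinity> then \<infinity> else ennreal (enn2real y powr r))"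

definition modulation_norm ::
  "('a::euclidean_space \<Rightarrow> complex) \<Rightarrow> real \<Rightarrow> real \<Rightarrow> real \<Rightarrow> (('a \<Rightarrow> complex) \<Rightarrow> complex) \<Rightarrow> ennreal" where
  "modulation_norm \<phi>0 p q s f =
     ennreal_powr
       (\<integral>\<^sup>+ \<xi>. ennreal (japanese_bracket \<xi> powr (s * q)) *
          ennreal_powr (\<integral>\<^sup>+ x. ennreal (norm (stft \<phi>0 f x \<xi>) powr p) \<partial>lborel) (q / p) \<partial>lborel)
       (1 / q)"

definition modulation_space ::
  "('a::euclidean_space \<Rightarrow> complex) \<Rightarrow> real \<Rightarrow> real \<Rightarrow> real \<Rightarrow> (('a \<Rightarrow> complex) \<Rightarrow> complex) set" where
  "modulation_space \<phi>0 p q s = {f \<in> tempered_distributions. modulation_norm \<phi>0 p q s f < \<infinity>}"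

end

theory Submission
  imports Defs "HOL-Probability.Probability"
begin

text \<open>
  Write \<open>F = V\<^sub>\<phi>\<^sub>0 f\<close> for the short-time Fourier transform of \<open>f\<close>. The idea is to take cut-offs of the
  form \<open>\<phi>(t) = \<integral> e\<^sup>i\<^sup>t\<^sup>\<eta> d\<mu>(\<eta>)\<close>, where \<open>\<mu>\<close> is a probability measure with finite moments of all orders.
  Multiplication of \<open>f\<close> by such a \<open>\<phi>\<close> acts on \<open>F\<close> in the frequency variable alone, by convolution:
  \<open>V\<^sub>\<phi>\<^sub>0(\<phi>f)(x, \<xi>) = \<integral> F(x, \<xi> - \<eta>) d\<mu>(\<eta>)\<close>. This is the exchange of a tempered distribution
  with an integral (\<open>tempered_integral_wave\<close>). Hence \<open>V\<^sub>\<phi>\<^sub>0(f - \<phi>f)\<close> is the \<open>\<mu>\<close>-average over \<open>\<eta>\<close> of the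
  differences \<open>F(x, \<xi>) - F(x, \<xi> - \<eta>)\<close>, and Minkowski's inequality in \<open>x\<close> followed by Jensen's
  inequality in \<open>\<xi>\<close> (\<open>mixed_norm_powr_integral_le\<close>) bounds the \<open>q\<close>-th power of the modulation norm of
  \<open>f - \<phi>f\<close> by \<open>\<integral> \<omega>(\<eta>) d\<mu>(\<eta>)\<close>, where \<open>\<omega>(\<eta>)\<close> is the \<open>q\<close>-th power of the weighted mixed norm of
  \<open>F - F(\<cdot>, \<cdot> - \<eta>)\<close>.

  Translation is continuous in a weighted mixed Lebesgue space with finite exponents, and the weight
  \<open>\<langle>\<xi>\<rangle>\<^sup>s\<close> changes under translation by at most a power of \<open>\<langle>\<eta>\<rangle>\<close>. So \<open>\<omega>(\<eta>)\<close> tends to \<open>0\<close> with \<open>\<eta>\<close>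
  (\<open>freq_modulus_tendsto_0\<close>) and has polynomial growth (\<open>freq_modulus_le\<close>). Replacing \<open>\<mu>\<close> by its image
  under \<open>\<eta> \<mapsto> \<eta>/n\<close>, which replaces \<open>\<phi>\<close> by \<open>\<phi>(t/n)\<close>, therefore makes the average small, by
  dominated convergence (\<open>freq_modulus_average_small\<close>).

  It remains to find one \<open>\<mu>\<close> for which \<open>\<phi>\<close> is smooth with compact support
  (\<open>exists_band_limited_probability\<close>). Its density is, up to normalisation, the product over the
  coordinates of \<open>\<kappa>(x) = \<Prod>\<^sub>k sinc(x/2\<^sup>k)\<^sup>2\<close>. This decays faster than any power, since there are
  infinitely many factors, and that makes \<open>\<phi>\<close> smooth. Each factor \<open>sinc(a x)\<close> averages the Fourier
  transform over an interval of radius \<open>a\<close> (\<open>mult_sinc_widens_support\<close>); the radii are summable, so the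
  transform of \<open>\<kappa>\<close> has compact support as soon as that of \<open>sinc\<^sup>2\<close> has, which is a
  direct computation. Starting from the density, rather than
  from a bump function, makes both the moments and the support explicit.
\<close>

section \<open>A rapidly decreasing kernel with compactly supported Fourier transform\<close>

lemma cos_mult_sinc_as_average:
  fixes a t x :: real
  assumes "a > 0"
  shows "(\<integral>y. cos ((t + y) * x) * indicator {-a..a} y \<partial>lborel) = 2 * a * (sinc (a * x) * cos (t * x))"
proof (cases "x = 0")
  case True
  then show ?thesis using assms by simp
next
  case False
  have "(\<integral>y. cos ((t + y) * x) * indicator {-a..a} y \<partial>lborel)
      = sin ((t + a) * x) / x - sin ((t + - a) * x) / x"
  proof (rule integral_FTC_Icc_real)
    show "- a \<le> a" using assms by simp
    show "((\<lambda>y. sin ((t + y) * x) / x) has_real_derivative cos ((t + y) * x)) (at y)" for y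
      using False by (auto intro!: derivative_eq_intros)
  qed (auto intro!: continuous_intros)
  also have "\<dots> = 2 * a * (sinc (a * x) * cos (t * x))"
  proof -
    have "sin ((t + a) * x) = sin (t * x) * cos (a * x) + cos (t * x) * sin (a * x)"
      by (simp add: sin_add distrib_right)
    moreover have "sin ((t + - a) * x) = sin (t * x) * cos (a * x) - cos (t * x) * sin (a * x)"
      by (simp add: sin_diff left_diff_distrib)
    ultimately show ?thesis
      using False assms by (simp add: add_divide_distrib diff_divide_distrib)
  qed
  finally show ?thesis .
qed

lemma abs_sinc_le_1: "\<bar>sinc x\<bar> \<le> 1"
  using abs_sin_x_le_abs_x[of x] by (simp add: abs_divide divide_le_eq)

text \<open>
  By the preceding identity and Fubini, the cosine transform of \<open>\<kappa>(x) sinc(a x)\<close> at \<open>t\<close> is the mean of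
  the transform of \<open>\<kappa>\<close> over the interval of radius \<open>a\<close> around \<open>t\<close>; for these \<open>t\<close> the interval
  misses the support.
\<close>

lemma mult_sinc_widens_support:
  fixes \<kappa> :: "real \<Rightarrow> real"
  assumes \<kappa>: "integrable lborel \<kappa>" and a: "a > 0"
    and supp: "\<And>t. \<bar>t\<bar> \<ge> B \<Longrightarrow> (\<integral>x. \<kappa> x * cos (t * x) \<partial>lborel) = 0"
    and t: "\<bar>t\<bar> \<ge> B + a"
  shows "(\<integral>x. (\<kappa> x * sinc (a * x)) * cos (t * x) \<partial>lborel) = 0"
proof -
  have [measurable]: "\<kappa> \<in> borel_measurable borel"
    using borel_measurable_integrable[OF \<kappa>] by simp
  let ?g = "\<lambda>x y. \<kappa> x * (cos ((t + y) * x) * indicator {-a..a} y)"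
  have meas: "case_prod ?g \<in> borel_measurable (lborel \<Otimes>\<^sub>M lborel)"
    by measurable
  have int_ind: "integrable lborel (\<lambda>y. \<bar>c\<bar> * indicator {-a..a} y :: real)" for c
    by (intro integrable_mult_right integrable_real_indicator) (auto simp: emeasure_lborel_Icc_eq)
  have bound: "norm (?g x y) \<le> \<bar>\<kappa> x\<bar> * indicator {-a..a} y" for x y
  proof -
    have "\<bar>\<kappa> x\<bar> * \<bar>cos ((t + y) * x)\<bar> \<le> \<bar>\<kappa> x\<bar> * 1"
      by (intro mult_left_mono) auto
    then show ?thesis
      by (auto simp: abs_mult split: split_indicator)
  qed
  have int_y: "integrable lborel (?g x)" for x
    by (rule Bochner_Integration.integrable_bound[OF int_ind[of "\<kappa> x"]])
       (use bound in \<open>auto simp: abs_mult\<close>)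
  have int_norm: "integrable lborel (\<lambda>x. \<integral>y. norm (?g x y) \<partial>lborel)"
  proof (rule Bochner_Integration.integrable_bound[of _ "\<lambda>x. \<bar>\<kappa> x\<bar> * (2 * a)"])
    show "integrable lborel (\<lambda>x. \<bar>\<kappa> x\<bar> * (2 * a))"
      using \<kappa> by simp
    show "AE x in lborel. norm (\<integral>y. norm (?g x y) \<partial>lborel) \<le> norm (\<bar>\<kappa> x\<bar> * (2 * a))"
    proof (rule AE_I2)
      fix x
      have "(\<integral>y. norm (?g x y) \<partial>lborel) \<le> (\<integral>y. \<bar>\<kappa> x\<bar> * indicator {-a..a} y \<partial>lborel)"
        using int_y[of x] int_ind[of "\<kappa> x"] bound by (intro integral_mono) auto
      also have "\<dots> = \<bar>\<kappa> x\<bar> * (2 * a)" using a by simp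
      finally show "norm (\<integral>y. norm (?g x y) \<partial>lborel) \<le> norm (\<bar>\<kappa> x\<bar> * (2 * a))"
        using a by simp
    qed
  qed measurable
  have int_pair: "integrable (lborel \<Otimes>\<^sub>M lborel) (case_prod ?g)"
    by (rule lborel_pair.Fubini_integrable) (use meas int_norm int_y in auto)
  have "2 * a * (\<integral>x. (\<kappa> x * sinc (a * x)) * cos (t * x) \<partial>lborel)
      = (\<integral>x. \<kappa> x * (2 * a * (sinc (a * x) * cos (t * x))) \<partial>lborel)"
    by (simp only: ac_simps flip: integral_mult_right_zero)
  also have "\<dots> = (\<integral>x. \<integral>y. ?g x y \<partial>lborel \<partial>lborel)"
    by (subst cos_mult_sinc_as_average[OF a, symmetric]) simp
  also have "\<dots> = (\<integral>y. \<integral>x. ?g x y \<partial>lborel \<partial>lborel)"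
    using lborel_pair.Fubini_integral[OF int_pair] by simp
  also have "\<dots> = (\<integral>y. indicator {-a..a} y * (\<integral>x. \<kappa> x * cos ((t + y) * x) \<partial>lborel) \<partial>lborel)"
    by (simp only: ac_simps flip: integral_mult_right_zero)
  also have "\<dots> = (\<integral>y. 0 \<partial>(lborel :: real measure))"
    by (rule Bochner_Integration.integral_cong)
       (use t in \<open>auto split: split_indicator intro!: supp\<close>)
  finally show ?thesis using a by simp
qed

lemma integrable_inverse_1_plus_square_lborel:
  "integrable lborel (\<lambda>x::real. inverse (1 + x\<^sup>2))"
  using integrable_inverse_1_plus_square by (simp add: set_integrable_def)

lemma sinc_sq_bounds: "(sinc x)\<^sup>2 \<le> 1" "x\<^sup>2 * (sinc x)\<^sup>2 \<le> 1"
proof -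
  show "(sinc x)\<^sup>2 \<le> 1"
    using abs_sinc_le_1[of x] by (simp only: abs_square_le_1)
  show "x\<^sup>2 * (sinc x)\<^sup>2 \<le> 1"
    using abs_square_le_1[of "sin x"] by (simp add: power_divide)
qed

lemma integrable_by_decay:
  fixes h :: "real \<Rightarrow> real"
  assumes [measurable]: "h \<in> borel_measurable borel"
    and bd: "\<And>x. \<bar>h x\<bar> \<le> C" "\<And>x. x\<^sup>2 * \<bar>h x\<bar> \<le> D"
  shows "integrable lborel h"
proof (rule Bochner_Integration.integrable_bound)
  show "integrable lborel (\<lambda>x::real. (C + D) * inverse (1 + x\<^sup>2))"
    using integrable_inverse_1_plus_square_lborel by simp
  show "AE x in lborel. norm (h x) \<le> norm ((C + D) * inverse (1 + x\<^sup>2))"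
  proof (rule AE_I2)
    fix x :: real
    have pos: "1 + x\<^sup>2 > 0" by (rule add_pos_nonneg) simp_all
    have "(1 + x\<^sup>2) * \<bar>h x\<bar> \<le> C + D"
      using bd[of x] by (simp add: algebra_simps)
    then have "\<bar>h x\<bar> \<le> (C + D) * inverse (1 + x\<^sup>2)"
      using pos by (simp add: field_simps)
    then show "norm (h x) \<le> norm ((C + D) * inverse (1 + x\<^sup>2))" by simp
  qed
qed simp

lemma integrable_sinc_sq: "integrable lborel (\<lambda>x. (sinc x)\<^sup>2)"
  by (rule integrable_by_decay[of _ 1 1]) (use sinc_sq_bounds in auto)

lemma integrable_one_minus_cos:
  "integrable lborel (\<lambda>x::real. (1 - cos (c * x)) / x\<^sup>2)"
proof (rule integrable_by_decay[of _ "c\<^sup>2 / 2" 2])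
  fix x :: real
  have eq: "1 - cos (c * x) = 2 * (sin (c * x / 2))\<^sup>2"
    using cos_double_sin[of "c * x / 2"] by simp
  have "(sin (c * x / 2))\<^sup>2 \<le> (c * x / 2)\<^sup>2"
    using abs_sin_x_le_abs_x[of "c * x / 2"] by (simp only: abs_le_square_iff)
  then show "\<bar>(1 - cos (c * x)) / x\<^sup>2\<bar> \<le> c\<^sup>2 / 2"
    unfolding eq by (cases "x = 0") (simp_all add: abs_mult pos_divide_le_eq power_mult_distrib power_divide)
  have "\<bar>1 - cos (c * x)\<bar> \<le> 2"
    using cos_le_one[of "c * x"] cos_ge_minus_one[of "c * x"] by linarith
  then show "x\<^sup>2 * \<bar>(1 - cos (c * x)) / x\<^sup>2\<bar> \<le> 2"
    by (cases "x = 0") auto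
qed measurable

text \<open>
  The substitution \<open>x \<mapsto> c x\<close>; for \<open>c = 0\<close> both sides vanish.
\<close>

lemma integral_one_minus_cos:
  fixes c :: real
  shows "(\<integral>x. (1 - cos (c * x)) / x\<^sup>2 \<partial>lborel) = \<bar>c\<bar> * (\<integral>x. (1 - cos x) / x\<^sup>2 \<partial>lborel)"
proof (cases "c = 0")
  case False
  have "(\<integral>x. (1 - cos x) / x\<^sup>2 \<partial>lborel) = \<bar>c\<bar> *\<^sub>R (\<integral>x. (1 - cos (0 + c * x)) / (0 + c * x)\<^sup>2 \<partial>lborel)"
    by (rule lborel_integral_real_affine[OF False])
  also have "\<dots> = \<bar>c\<bar> * (\<integral>x. (1 / c\<^sup>2) * ((1 - cos (c * x)) / x\<^sup>2) \<partial>lborel)"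
    by (simp add: power_mult_distrib)
  also have "\<dots> = \<bar>c\<bar> * (1 / c\<^sup>2) * (\<integral>x. (1 - cos (c * x)) / x\<^sup>2 \<partial>lborel)"
    by (subst integral_mult_right_zero) simp
  finally show ?thesis
    using False by (simp add: power2_eq_square mult.assoc[symmetric] abs_mult_self_eq)
qed simp

text \<open>
  By product-to-sum formulas \<open>sin\<^sup>2 x cos(t x) / x\<^sup>2\<close> is a combination of three functions
  \<open>(1 - cos(c x)) / x\<^sup>2\<close> with \<open>c = t + 2, t - 2, t\<close>. So the transform is a multiple of
  \<open>\<bar>t + 2\<bar> / 4 + \<bar>t - 2\<bar> / 4 - \<bar>t\<bar> / 2\<close>, which is zero for \<open>\<bar>t\<bar> \<ge> 2\<close>.
\<close>

lemma sinc_sq_transform_supp: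
  assumes "\<bar>t\<bar> \<ge> 2"
  shows "(\<integral>x. (sinc x)\<^sup>2 * cos (t * x) \<partial>lborel) = 0"
proof -
  let ?I = "\<lambda>c x. (1 - cos (c * x)) / x\<^sup>2 :: real"
  have eq: "(sin x)\<^sup>2 * cos (t * x)
      = (1 - cos ((t + 2) * x)) / 4 + (1 - cos ((t - 2) * x)) / 4 - (1 - cos (t * x)) / 2" for x
  proof -
    have "cos ((t + 2) * x) + cos ((t - 2) * x) = 2 * (cos (t * x) * cos (2 * x))"
      by (simp add: distrib_right left_diff_distrib cos_add cos_diff)
    moreover have sq: "(sin x)\<^sup>2 = (1 - cos (2 * x)) / 2"
      using cos_double_sin[of x] by simp
    have "(sin x)\<^sup>2 * cos (t * x) = (cos (t * x) - cos (t * x) * cos (2 * x)) / 2"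
      unfolding sq by (simp add: algebra_simps)
    moreover have "S = (1 - C1) / 4 + (1 - C2) / 4 - (1 - C) / 2"
      if "C1 + C2 = 2 * P" "S = (C - P) / 2" for C C1 C2 P S :: real
      using that by (simp add: field_simps)
    ultimately show ?thesis by blast
  qed
  have "(\<integral>x. (sinc x)\<^sup>2 * cos (t * x) \<partial>lborel)
      = (\<integral>x. ?I (t + 2) x / 4 + ?I (t - 2) x / 4 - ?I t x / 2 \<partial>lborel)"
  proof (rule integral_cong_AE)
    show "AE x in lborel. (sinc x)\<^sup>2 * cos (t * x) = ?I (t + 2) x / 4 + ?I (t - 2) x / 4 - ?I t x / 2"
    proof (rule AE_mp[OF AE_lborel_singleton[of 0]], rule AE_I2, rule impI)
      fix x :: real assume "x \<noteq> 0"
      then have "(sinc x)\<^sup>2 * cos (t * x) = ((sin x)\<^sup>2 * cos (t * x)) / x\<^sup>2"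
        by (simp add: power_divide)
      then show "(sinc x)\<^sup>2 * cos (t * x) = ?I (t + 2) x / 4 + ?I (t - 2) x / 4 - ?I t x / 2"
        unfolding eq by (simp add: add_divide_distrib diff_divide_distrib)
    qed
  qed measurable
  also have "\<dots> = (\<integral>x. ?I (t + 2) x / 4 \<partial>lborel) + (\<integral>x. ?I (t - 2) x / 4 \<partial>lborel)
      - (\<integral>x. ?I t x / 2 \<partial>lborel)"
  proof -
    have i: "integrable lborel (\<lambda>x. ?I c x / d)" for c d
      using integrable_one_minus_cos[of c] by (intro integrable_divide_zero)
    show ?thesis
      by (simp only: Bochner_Integration.integral_diff[OF Bochner_Integration.integrable_add[OF i i] i]
        Bochner_Integration.integral_add[OF i i])
  qed
  also have "\<dots> = (\<integral>x. ?I (t + 2) x \<partial>lborel) / 4 + (\<integral>x. ?I (t - 2) x \<partial>lborel) / 4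
      - (\<integral>x. ?I t x \<partial>lborel) / 2"
    by (simp only: integral_divide_zero)
  also have "\<dots> = (\<bar>t + 2\<bar> / 4 + \<bar>t - 2\<bar> / 4 - \<bar>t\<bar> / 2) * (\<integral>x. (1 - cos x) / x\<^sup>2 \<partial>lborel)"
    unfolding integral_one_minus_cos by (simp add: algebra_simps)
  also have "\<bar>t + 2\<bar> / 4 + \<bar>t - 2\<bar> / 4 - \<bar>t\<bar> / 2 = 0"
  proof -
    have "t \<le> -2 \<or> t \<ge> 2" using assms by linarith
    then show ?thesis by (auto simp: abs_real_def field_simps)
  qed
  finally show ?thesis by simp
qed

definition sinc_prod :: "nat \<Rightarrow> real \<Rightarrow> real" where
  "sinc_prod n x = (\<Prod>k\<le>n. (sinc (x / 2 ^ k))\<^sup>2)"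

definition sinc_kernel :: "real \<Rightarrow> real" where
  "sinc_kernel x = lim (\<lambda>n. sinc_prod n x)"

lemma sinc_prod_measurable [measurable]: "sinc_prod n \<in> borel_measurable borel"
  unfolding sinc_prod_def by measurable

lemma sinc_prod_nonneg: "sinc_prod n x \<ge> 0"
  unfolding sinc_prod_def by (intro prod_nonneg) auto

lemma sinc_prod_Suc: "sinc_prod (Suc n) x = sinc_prod n x * (sinc (x / 2 ^ Suc n))\<^sup>2"
  by (simp only: sinc_prod_def prod.atMost_Suc)

lemma sinc_prod_decseq: "decseq (\<lambda>n. sinc_prod n x)"
proof (rule decseq_SucI)
  show "sinc_prod (Suc n) x \<le> sinc_prod n x" for n
    unfolding sinc_prod_Suc
    using sinc_prod_nonneg sinc_sq_bounds(1) by (intro mult_left_le)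
qed

lemma sinc_prod_tendsto: "(\<lambda>n. sinc_prod n x) \<longlonglongrightarrow> sinc_kernel x"
proof -
  obtain L where "(\<lambda>n. sinc_prod n x) \<longlonglongrightarrow> L"
    using decseq_convergent[OF sinc_prod_decseq, of 0 x] sinc_prod_nonneg by metis
  then show ?thesis
    unfolding sinc_kernel_def by (simp add: limI)
qed

lemma sinc_kernel_measurable [measurable]: "sinc_kernel \<in> borel_measurable borel"
  by (rule borel_measurable_LIMSEQ_real[OF sinc_prod_tendsto]) measurable

lemma sinc_kernel_nonneg: "sinc_kernel x \<ge> 0"
  by (rule LIMSEQ_le_const[OF sinc_prod_tendsto]) (use sinc_prod_nonneg in auto)

lemma sinc_kernel_le: "sinc_kernel x \<le> sinc_prod n x"
  using sinc_prod_decseq sinc_prod_tendsto by (rule decseq_ge)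

lemma sinc_prod_0: "sinc_prod 0 x = (sinc x)\<^sup>2"
  by (simp add: sinc_prod_def)

lemma sinc_prod_le_sinc_sq: "sinc_prod n x \<le> (sinc x)\<^sup>2"
  using decseqD[OF sinc_prod_decseq, of 0 n x] by (simp only: sinc_prod_0)

lemma integrable_sinc_prod: "integrable lborel (sinc_prod n)"
  by (rule Bochner_Integration.integrable_bound[OF integrable_sinc_sq])
     (use sinc_prod_nonneg sinc_prod_le_sinc_sq in auto)

text \<open>
  The factor with index \<open>k\<close> contains \<open>sinc\<close> twice, so it widens the support by \<open>2 / 2\<^sup>k\<close>; starting from
  radius 2 the partial sums are \<open>4 - 2 / 2\<^sup>n\<close>.
\<close>

lemma sinc_prod_transform_supp:
  "\<bar>t\<bar> \<ge> 4 - 2 / 2 ^ n \<Longrightarrow> (\<integral>x. sinc_prod n x * cos (t * x) \<partial>lborel) = 0"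
proof (induction n arbitrary: t)
  case 0
  then show ?case using sinc_sq_transform_supp by (simp add: sinc_prod_0)
next
  case (Suc n)
  define a :: real where "a = 1 / 2 ^ Suc n"
  have a: "a > 0" by (simp add: a_def)
  have int1: "integrable lborel (\<lambda>x. sinc_prod n x * sinc (a * x))"
  proof (rule Bochner_Integration.integrable_bound[OF integrable_sinc_prod[of n]])
    show "AE x in lborel. norm (sinc_prod n x * sinc (a * x)) \<le> norm (sinc_prod n x)"
    proof (rule AE_I2)
      fix x
      show "norm (sinc_prod n x * sinc (a * x)) \<le> norm (sinc_prod n x)"
        unfolding real_norm_def abs_mult using abs_sinc_le_1[of "a * x"] by (rule mult_left_le) simp
    qed
  qed measurable
  have supp1: "(\<integral>x. (sinc_prod n x * sinc (a * x)) * cos (t * x) \<partial>lborel) = 0"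
    if "\<bar>t\<bar> \<ge> (4 - 2 / 2 ^ n) + a" for t
    using mult_sinc_widens_support[OF integrable_sinc_prod a Suc.IH that] .
  have "(\<integral>x. (sinc_prod n x * sinc (a * x) * sinc (a * x)) * cos (t * x) \<partial>lborel) = 0"
  proof (rule mult_sinc_widens_support[OF int1 a supp1])
    show "\<bar>t\<bar> \<ge> (4 - 2 / 2 ^ n) + a + a"
      using Suc.prems by (simp add: a_def)
  qed
  moreover have "sinc_prod n x * sinc (a * x) * sinc (a * x) = sinc_prod (Suc n) x" for x
    unfolding sinc_prod_Suc by (simp only: power2_eq_square a_def times_divide_eq_left mult_1 mult.assoc)
  ultimately show ?case by (simp only:)
qed

lemma sinc_kernel_transform_supp:
  assumes "\<bar>t\<bar> \<ge> 4"
  shows "(\<integral>x. sinc_kernel x * cos (t * x) \<partial>lborel) = 0"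
proof -
  have "(\<lambda>n. \<integral>x. sinc_prod n x * cos (t * x) \<partial>lborel) \<longlonglongrightarrow> (\<integral>x. sinc_kernel x * cos (t * x) \<partial>lborel)"
  proof (rule integral_dominated_convergence[OF _ _ integrable_sinc_sq])
    show "AE x in lborel. (\<lambda>n. sinc_prod n x * cos (t * x)) \<longlonglongrightarrow> sinc_kernel x * cos (t * x)"
      by (intro AE_I2 tendsto_intros sinc_prod_tendsto)
    show "AE x in lborel. norm (sinc_prod n x * cos (t * x)) \<le> (sinc x)\<^sup>2" for n
    proof (rule AE_I2)
      fix x
      have "norm (sinc_prod n x * cos (t * x)) \<le> sinc_prod n x * 1"
        unfolding norm_mult using sinc_prod_nonneg[of n x] by (intro mult_mono) auto
      then show "norm (sinc_prod n x * cos (t * x)) \<le> (sinc x)\<^sup>2"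
        using sinc_prod_le_sinc_sq[of n x] by linarith
    qed
  qed measurable
  moreover have "(\<integral>x. sinc_prod n x * cos (t * x) \<partial>lborel) = 0" for n
  proof (rule sinc_prod_transform_supp)
    have "0 \<le> 2 / (2::real) ^ n" by simp
    then show "4 - 2 / 2 ^ n \<le> \<bar>t\<bar>" using assms by linarith
  qed
  ultimately show ?thesis by (simp add: LIMSEQ_const_iff)
qed

text \<open>
  The first \<open>n + 1\<close> factors alone are bounded by a constant times \<open>x\<close> to the power \<open>- 2 (n + 1)\<close>, and
  the remaining ones by 1.
\<close>

lemma sinc_kernel_decay:
  "\<exists>C. \<forall>x. \<bar>x\<bar> ^ m * sinc_kernel x \<le> C"
proof -
  have bd: "x ^ (2 * Suc n) * sinc_prod n x \<le> (\<Prod>k\<le>n. (2 ^ k)\<^sup>2)" for n and x :: real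
  proof -
    have "x ^ (2 * Suc n) * sinc_prod n x = (\<Prod>k\<le>n. x\<^sup>2 * (sinc (x / 2 ^ k))\<^sup>2)"
      unfolding sinc_prod_def prod.distrib
      by (simp only: prod_constant card_atMost power_mult)
    also have "\<dots> \<le> (\<Prod>k\<le>n. (2 ^ k)\<^sup>2)"
    proof (intro prod_mono conjI)
      fix k
      have "x\<^sup>2 * (sinc (x / 2 ^ k))\<^sup>2 = (2 ^ k)\<^sup>2 * ((x / 2 ^ k)\<^sup>2 * (sinc (x / 2 ^ k))\<^sup>2)"
        by (simp only: power_divide) simp
      also have "\<dots> \<le> (2 ^ k)\<^sup>2 * 1"
        by (intro mult_left_mono sinc_sq_bounds(2)) simp
      finally show "x\<^sup>2 * (sinc (x / 2 ^ k))\<^sup>2 \<le> (2 ^ k)\<^sup>2" by simp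
    qed (intro mult_nonneg_nonneg, simp_all only: zero_le_power2)
    finally show ?thesis .
  qed
  show ?thesis
  proof (intro exI allI)
    fix x :: real
    have le1: "sinc_kernel x \<le> 1"
      using sinc_kernel_le[of x 0] sinc_sq_bounds(1)[of x] by (simp only: sinc_prod_0)
    have "\<bar>x\<bar> ^ m \<le> 1 + x ^ (2 * Suc m)"
    proof (cases "\<bar>x\<bar> \<le> 1")
      case True
      have "0 \<le> x ^ (2 * Suc m)" by (simp only: power_mult zero_le_power zero_le_power2)
      moreover have "\<bar>x\<bar> ^ m \<le> 1" using True by (intro power_le_one) auto
      ultimately show ?thesis by linarith
    next
      case False
      then have "\<bar>x\<bar> ^ m \<le> \<bar>x\<bar> ^ (2 * Suc m)" by (intro power_increasing) auto
      also have "\<dots> = x ^ (2 * Suc m)" by (simp only: power_mult power2_abs)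
      finally show ?thesis by linarith
    qed
    then have "\<bar>x\<bar> ^ m * sinc_kernel x \<le> (1 + x ^ (2 * Suc m)) * sinc_kernel x"
      using sinc_kernel_nonneg by (intro mult_right_mono)
    also have "\<dots> = sinc_kernel x + x ^ (2 * Suc m) * sinc_kernel x"
      by (simp only: distrib_right mult_1)
    also have "\<dots> \<le> 1 + x ^ (2 * Suc m) * sinc_prod m x"
      using le1 sinc_kernel_le[of x m] 
      by (intro add_mono mult_left_mono) (simp_all only: power_mult zero_le_power zero_le_power2)
    also have "\<dots> \<le> 1 + (\<Prod>k\<le>m. (2 ^ k)\<^sup>2)"
      using bd[of x m] by simp
    finally show "\<bar>x\<bar> ^ m * sinc_kernel x \<le> 1 + (\<Prod>k\<le>m. (2 ^ k)\<^sup>2)" .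
  qed
qed

lemma integrable_sinc_kernel_moment: "integrable lborel (\<lambda>x. \<bar>x\<bar> ^ m * sinc_kernel x)"
proof -
  obtain C where C: "\<And>x. \<bar>x\<bar> ^ m * sinc_kernel x \<le> C"
    using sinc_kernel_decay by blast
  obtain D where D: "\<And>x. \<bar>x\<bar> ^ (m + 2) * sinc_kernel x \<le> D"
    using sinc_kernel_decay by blast
  show ?thesis
  proof (rule integrable_by_decay[of _ C D])
    show "\<bar>\<bar>x\<bar> ^ m * sinc_kernel x\<bar> \<le> C" for x
      using C[of x] sinc_kernel_nonneg[of x] by (simp add: abs_mult)
    have "\<bar>x\<bar> ^ (m + 2) * sinc_kernel x = x\<^sup>2 * \<bar>\<bar>x\<bar> ^ m * sinc_kernel x\<bar>" for x
      using sinc_kernel_nonneg[of x] by (simp only: abs_mult power_add power2_abs power_abs abs_abs mult_ac abs_of_nonneg)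
    then show "x\<^sup>2 * \<bar>\<bar>x\<bar> ^ m * sinc_kernel x\<bar> \<le> D" for x
      using D[of x] by simp
  qed measurable
qed

text \<open>
  A lower bound for the factors, needed to see that the infinite product does not vanish identically:
  \<open>sin x / x \<ge> cos x\<close> near the origin, and \<open>cos\<^sup>2 x = 1 - sin\<^sup>2 x \<ge> 1 - x\<^sup>2\<close>.
\<close>

lemma one_minus_sq_le_sinc_sq: "1 - x\<^sup>2 \<le> (sinc x)\<^sup>2"
proof (cases "x = 0 \<or> \<bar>x\<bar> \<ge> 1")
  case True
  then show ?thesis
  proof
    assume "\<bar>x\<bar> \<ge> 1"
    then have "1 - x\<^sup>2 \<le> 0" using one_le_power[of "\<bar>x\<bar>" 2] by simp
    also have "0 \<le> (sinc x)\<^sup>2" by (simp only: zero_le_power2)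
    finally show ?thesis .
  qed simp
next
  case False
  have sin_ge: "y * cos y \<le> sin y" if "0 \<le> y" "y \<le> 1" for y :: real
  proof -
    have "sin 0 - 0 * cos 0 \<le> sin y - y * cos y"
    proof (rule DERIV_nonneg_imp_nondecreasing[OF that(1)])
      fix u :: real assume u: "0 \<le> u" "u \<le> y"
      have "((\<lambda>u. sin u - u * cos u) has_real_derivative u * sin u) (at u)"
        by (auto intro!: derivative_eq_intros)
      moreover have "u * sin u \<ge> 0"
        using u that pi_gt3 by (intro mult_nonneg_nonneg sin_ge_zero) auto
      ultimately show "\<exists>d. ((\<lambda>u. sin u - u * cos u) has_real_derivative d) (at u) \<and> 0 \<le> d"
        by blast
    qed
    then show ?thesis by simp
  qed
  let ?y = "\<bar>x\<bar>"
  have y: "0 < ?y" "?y \<le> 1" using False by auto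
  have "(?y * cos ?y)\<^sup>2 \<le> (sin ?y)\<^sup>2"
    using y pi_gt3 by (intro power_mono sin_ge mult_nonneg_nonneg cos_ge_zero) auto
  then have "(cos ?y)\<^sup>2 \<le> (sin ?y)\<^sup>2 / x\<^sup>2"
    using False by (simp add: power_mult_distrib field_simps)
  moreover have "(sin ?y)\<^sup>2 = (sin x)\<^sup>2" by (cases "0 \<le> x") auto
  moreover have "(sin x)\<^sup>2 \<le> x\<^sup>2"
    using abs_sin_x_le_abs_x[of x] by (simp only: abs_le_square_iff)
  moreover have "(cos ?y)\<^sup>2 = 1 - (sin ?y)\<^sup>2" by (rule cos_squared_eq)
  ultimately show ?thesis using False by (simp add: power_divide)
qed

text \<open>
  The Weierstrass inequality \<open>\<Prod> (1 - a\<^sub>k) \<ge> 1 - \<Sum> a\<^sub>k\<close>, applied to the preceding lower bounds.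
\<close>

lemma sinc_prod_lower:
  assumes "\<bar>x\<bar> \<le> 1/2"
  shows "sinc_prod n x \<ge> 1 - (\<Sum>k\<le>n. (x / 2 ^ k)\<^sup>2)"
proof (induction n)
  case 0
  then show ?case using one_minus_sq_le_sinc_sq[of x] by (simp only: sinc_prod_0) simp
next
  case (Suc n)
  let ?y = "x / 2 ^ Suc n"
  have "sinc_prod n x * (1 - ?y\<^sup>2) \<le> sinc_prod n x * (sinc ?y)\<^sup>2"
    by (intro mult_left_mono one_minus_sq_le_sinc_sq sinc_prod_nonneg)
  moreover have "sinc_prod n x * ?y\<^sup>2 \<le> 1 * ?y\<^sup>2"
    by (rule mult_right_mono[OF order_trans[OF sinc_prod_le_sinc_sq sinc_sq_bounds(1)] zero_le_power2])
  ultimately show ?case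
    using Suc unfolding sinc_prod_Suc sum.atMost_Suc right_diff_distrib mult_1 mult_1_right by linarith
qed

lemma integral_sinc_kernel_pos: "(\<integral>x. sinc_kernel x \<partial>lborel) > 0"
proof -
  have sum_le: "(\<Sum>k\<le>n. (x / 2 ^ k)\<^sup>2) \<le> 1 / 2" if "\<bar>x\<bar> \<le> 1/2" for x :: real and n
  proof -
    have "(\<Sum>k\<le>n. (x / 2 ^ k)\<^sup>2) = x\<^sup>2 * (\<Sum>k\<le>n. (1/4) ^ k)"
      by (simp add: sum_distrib_left power_divide power_mult[symmetric] mult.commute[of _ 2] power_mult)
    also have "\<dots> \<le> (1/2)\<^sup>2 * (4 / 3)"
    proof (intro mult_mono)
      show "x\<^sup>2 \<le> (1/2)\<^sup>2" using that by (simp only: abs_le_square_iff[symmetric])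
      have "(1 - 1/4) * (\<Sum>k\<le>n. (1/4::real) ^ k) = 1 - (1/4) ^ Suc n"
        by (rule sum_gp_basic)
      moreover have "(0::real) \<le> (1/4) ^ Suc n" by simp
      moreover have "S \<le> 4 / 3" if "(1 - 1/4) * S = 1 - q" "0 \<le> q" for S q :: real
        using that by simp
      ultimately show "(\<Sum>k\<le>n. (1/4::real) ^ k) \<le> 4 / 3" by blast
    qed (auto intro: sum_nonneg)
    finally show ?thesis by (simp add: power2_eq_square)
  qed
  have lower: "sinc_kernel x \<ge> 1 / 2" if "\<bar>x\<bar> \<le> 1/2" for x
  proof (rule LIMSEQ_le_const[OF sinc_prod_tendsto], intro exI allI impI)
    show "1 / 2 \<le> sinc_prod n x" for n
      using sinc_prod_lower[OF that, of n] sum_le[OF that, of n] by linarith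
  qed
  have "(\<integral>x. (1/2) * indicator {-1/2..1/2} x \<partial>(lborel :: real measure)) \<le> (\<integral>x. sinc_kernel x \<partial>lborel)"
  proof (rule integral_mono)
    show "integrable lborel (\<lambda>x::real. (1/2) * indicator {-1/2..1/2} x :: real)"
      by (intro integrable_mult_right integrable_real_indicator) auto
    show "integrable lborel sinc_kernel"
      using integrable_sinc_kernel_moment[of 0] by simp
    show "(1/2) * indicator {-1/2..1/2} x \<le> sinc_kernel x" for x
      using lower[of x] sinc_kernel_nonneg[of x] by (auto split: split_indicator)
  qed
  then show ?thesis by simp
qed

section \<open>A probability measure whose characteristic function has compact support\<close>

definition wave :: "'a::euclidean_space \<Rightarrow> 'a \<Rightarrow> complex" where
  "wave \<eta> t = exp (\<i> * complex_of_real (t \<bullet> \<eta>))"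

lemma norm_wave [simp]: "norm (wave \<eta> t) = 1"
  by (simp add: wave_def norm_exp_i_times)

lemma wave_measurable [measurable]:
  "f \<in> borel_measurable M \<Longrightarrow> g \<in> borel_measurable M \<Longrightarrow> (\<lambda>x. wave (f x) (g x)) \<in> borel_measurable M"
  unfolding wave_def by measurable

text \<open>
  The kernel is even, so its sine transform vanishes and the cosine transform is the whole
  characteristic function.
\<close>

lemma exists_band_limited_probability_real:
  "\<exists>\<nu> :: real measure. prob_space \<nu> \<and> sets \<nu> = sets borel \<and> (\<forall>m. integrable \<nu> (\<lambda>x. \<bar>x\<bar> ^ m)) \<and>
     (\<forall>t. \<bar>t\<bar> \<ge> 4 \<longrightarrow> (\<integral>x. wave x t \<partial>\<nu>) = 0)"
proof -
  define c where "c = (\<integral>x. sinc_kernel x \<partial>lborel)"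
  define \<nu> where "\<nu> = density lborel (\<lambda>x. ennreal (sinc_kernel x / c))"
  have c: "c > 0" unfolding c_def by (rule integral_sinc_kernel_pos)
  have int: "integrable lborel sinc_kernel"
    using integrable_sinc_kernel_moment[of 0] by simp
  have "prob_space \<nu>"
  proof (rule prob_spaceI)
    have "emeasure \<nu> (space \<nu>) = (\<integral>\<^sup>+x. ennreal (sinc_kernel x / c) \<partial>lborel)"
      unfolding \<nu>_def by (subst emeasure_density) (auto simp: space_density)
    also have "\<dots> = ennreal (\<integral>x. sinc_kernel x / c \<partial>lborel)"
      by (rule nn_integral_eq_integral) (use int c sinc_kernel_nonneg in auto)
    also have "\<dots> = 1" using c by (simp flip: c_def)
    finally show "emeasure \<nu> (space \<nu>) = 1" .
  qed
  moreover have "integrable \<nu> (\<lambda>x. \<bar>x\<bar> ^ m)" for m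
  proof -
    have "(\<lambda>x. (sinc_kernel x / c) *\<^sub>R \<bar>x\<bar> ^ m) = (\<lambda>x. \<bar>x\<bar> ^ m * sinc_kernel x / c)"
      by (simp add: fun_eq_iff)
    then show ?thesis
      unfolding \<nu>_def using c sinc_kernel_nonneg integrable_sinc_kernel_moment[of m]
      by (subst integrable_density) auto
  qed
  moreover have "(\<integral>x. wave x t \<partial>\<nu>) = 0" if t: "\<bar>t\<bar> \<ge> 4" for t
  proof -
    have "(\<integral>x. wave x t \<partial>\<nu>) = (\<integral>x. (sinc_kernel x / c) *\<^sub>R wave x t \<partial>lborel)"
      unfolding \<nu>_def using c sinc_kernel_nonneg by (subst integral_density) auto
    also have "\<dots> = 0"
    proof -
      have intw: "integrable lborel (\<lambda>x. (sinc_kernel x / c) *\<^sub>R wave x t)"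
        by (rule Bochner_Integration.integrable_bound[of _ "\<lambda>x. sinc_kernel x / c"]) (use int in auto)
      have "Re (\<integral>x. (sinc_kernel x / c) *\<^sub>R wave x t \<partial>lborel) = (\<integral>x. (sinc_kernel x * cos (t * x)) / c \<partial>lborel)"
        by (subst integral_Re[OF intw, symmetric]) (simp add: wave_def Re_exp)
      also have "\<dots> = 0"
        using sinc_kernel_transform_supp[OF t] by simp
      finally have Re: "Re (\<integral>x. (sinc_kernel x / c) *\<^sub>R wave x t \<partial>lborel) = 0" .
      let ?J = "\<integral>x. (sinc_kernel x / c) * sin (t * x) \<partial>lborel"
      have even: "sinc_kernel (- x) = sinc_kernel x" for x
        by (simp only: sinc_kernel_def sinc_prod_def minus_divide_left[symmetric] sinc_neg)
      have "?J = \<bar>-1\<bar> *\<^sub>R (\<integral>x. (sinc_kernel (0 + -1 * x) / c) * sin (t * (0 + -1 * x)) \<partial>lborel)"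
        by (rule lborel_integral_real_affine) simp
      also have "\<dots> = - ?J"
        by (simp add: even)
      finally have "?J = 0" by simp
      moreover have "Im (\<integral>x. (sinc_kernel x / c) *\<^sub>R wave x t \<partial>lborel) = ?J"
        by (subst integral_Im[OF intw, symmetric]) (simp add: wave_def Im_exp)
      ultimately show ?thesis using Re by (simp add: complex_eq_iff)
    qed
    finally show ?thesis .
  qed
  ultimately show ?thesis
    by (intro exI[of _ \<nu>]) (auto simp: \<nu>_def)
qed

lemma sum_le_prod_one_plus:
  fixes f :: "'i \<Rightarrow> real"
  assumes "finite I" "\<And>i. i \<in> I \<Longrightarrow> f i \<ge> 0"
  shows "1 + (\<Sum>i\<in>I. f i) \<le> (\<Prod>i\<in>I. 1 + f i)"
  using assms
proof (induction I rule: finite_induct)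
  case (insert a I)
  have "(\<Prod>i\<in>I. 1 + f i) \<ge> 1" using insert by (intro prod_ge_1) auto
  then have "f a * 1 \<le> f a * (\<Prod>i\<in>I. 1 + f i)" using insert by (intro mult_left_mono) auto
  then show ?case using insert by (simp add: distrib_right)
qed simp

text \<open>
  The product over an orthonormal basis of copies of the one-dimensional measure: its characteristic
  function is the product of the one-dimensional ones, so it vanishes outside a cube. The moments reduce to
  one dimension through \<open>1 + \<Sum> \<bar>\<eta>\<^sub>b\<bar> \<le> \<Prod> (1 + \<bar>\<eta>\<^sub>b\<bar>)\<close>.
\<close>

lemma exists_band_limited_probability:
  "\<exists>\<mu> :: 'a::euclidean_space measure. prob_space \<mu> \<and> sets \<mu> = sets borel \<and>
     (\<forall>m. integrable \<mu> (\<lambda>\<eta>. norm \<eta> ^ m)) \<and> bounded {t. (\<integral>\<eta>. wave \<eta> t \<partial>\<mu>) \<noteq> 0}"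
proof -
  obtain \<nu> :: "real measure" where \<nu>: "prob_space \<nu>" "sets \<nu> = sets borel"
    "\<And>m. integrable \<nu> (\<lambda>x. \<bar>x\<bar> ^ m)" "\<And>t. \<bar>t\<bar> \<ge> 4 \<Longrightarrow> (\<integral>x. wave x t \<partial>\<nu>) = 0"
    using exists_band_limited_probability_real by blast
  note [measurable_cong] = \<nu>(2)
  interpret \<nu>: prob_space \<nu> by fact
  interpret product_prob_space "\<lambda>_::'a. \<nu>" "Basis :: 'a set" ..
  let ?P = "\<Pi>\<^sub>M b\<in>(Basis :: 'a set). \<nu>"
  let ?e = "\<lambda>f. \<Sum>b\<in>Basis. f b *\<^sub>R b :: 'a"
  have e [measurable]: "?e \<in> ?P \<rightarrow>\<^sub>M borel" by measurable
  define \<mu> where "\<mu> = distr ?P borel ?e"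
  have "prob_space \<mu>" unfolding \<mu>_def by (rule P.prob_space_distr) measurable
  moreover have "integrable \<mu> (\<lambda>\<eta>. norm \<eta> ^ m)" for m
    unfolding \<mu>_def
  proof (subst integrable_distr_eq)
    have one: "integrable \<nu> (\<lambda>x. (1 + \<bar>x\<bar>) ^ m)"
      unfolding binomial_ring by (intro Bochner_Integration.integrable_sum integrable_mult_right \<nu>(3))
    have "integrable ?P (\<lambda>f. \<Prod>b\<in>Basis. (1 + \<bar>f b\<bar>) ^ m)"
      by (rule product_integrable_prod) (use one in auto)
    then show "integrable ?P (\<lambda>f. norm (?e f) ^ m)"
    proof (rule Bochner_Integration.integrable_bound)
      show "AE f in ?P. norm (norm (?e f) ^ m) \<le> norm (\<Prod>b\<in>Basis. (1 + \<bar>f b\<bar>) ^ m)"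
      proof (rule AE_I2)
        fix f
        have "norm (?e f) \<le> (\<Sum>b\<in>Basis. norm (f b *\<^sub>R b))" by (rule norm_sum)
        also have "\<dots> = (\<Sum>b\<in>Basis. \<bar>f b\<bar>)" by simp
        also have "\<dots> \<le> (\<Prod>b\<in>Basis. 1 + \<bar>f b\<bar>)"
          using sum_le_prod_one_plus[of Basis "\<lambda>b. \<bar>f b\<bar>"] by simp
        finally have "norm (?e f) ^ m \<le> (\<Prod>b\<in>Basis. 1 + \<bar>f b\<bar>) ^ m"
          by (intro power_mono) auto
        also have "\<dots> = (\<Prod>b\<in>Basis. (1 + \<bar>f b\<bar>) ^ m)" by (simp add: prod_power_distrib)
        finally show "norm (norm (?e f) ^ m) \<le> norm (\<Prod>b\<in>Basis. (1 + \<bar>f b\<bar>) ^ m)"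
          by (simp add: abs_prod)
      qed
    qed measurable
  qed measurable
  moreover have "bounded {t. (\<integral>\<eta>. wave \<eta> t \<partial>\<mu>) \<noteq> 0}"
  proof (rule boundedI)
    fix t :: 'a assume "t \<in> {t. (\<integral>\<eta>. wave \<eta> t \<partial>\<mu>) \<noteq> 0}"
    then have nz: "(\<integral>\<eta>. wave \<eta> t \<partial>\<mu>) \<noteq> 0" by simp
    have prod: "wave (?e f) t = (\<Prod>b\<in>Basis. wave (f b) (t \<bullet> b))" for f
      unfolding wave_def
      by (simp add: inner_sum_right sum_distrib_left exp_sum mult.commute)
    have "(\<integral>\<eta>. wave \<eta> t \<partial>\<mu>) = (\<integral>f. wave (?e f) t \<partial>?P)"
      unfolding \<mu>_def by (rule integral_distr) measurable
    also have "\<dots> = (\<Prod>b\<in>Basis. \<integral>x. wave x (t \<bullet> b) \<partial>\<nu>)"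
      unfolding prod
    proof (rule product_integral_prod)
      show "integrable \<nu> (\<lambda>x. wave x (t \<bullet> b))" for b
        by (rule \<nu>.integrable_const_bound[of _ 1]) auto
    qed simp
    finally have "(\<Prod>b\<in>Basis. \<integral>x. wave x (t \<bullet> b) \<partial>\<nu>) \<noteq> 0" using nz by simp
    then have "\<forall>b\<in>Basis. \<bar>t \<bullet> b\<bar> < 4"
      using \<nu>(4) by (auto simp: not_le[symmetric])
    then have "(\<Sum>b\<in>Basis. \<bar>t \<bullet> b\<bar>) \<le> (\<Sum>b\<in>(Basis::'a set). 4)"
      by (intro sum_mono) (auto intro: less_imp_le)
    then show "norm t \<le> 4 * DIM('a)"
      using norm_le_l1[of t] by simp
  qed
  ultimately show ?thesis
    by (intro exI[of _ \<mu>]) (auto simp: \<mu>_def)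
qed

section \<open>Calculus of iterated partial derivatives\<close>

lemma japanese_bracket_ge_1: "japanese_bracket x \<ge> 1"
  by (simp add: japanese_bracket_def)

lemma japanese_bracket_pos: "japanese_bracket x > 0"
  using japanese_bracket_ge_1[of x] by linarith

lemma japanese_bracket_nonneg [simp]: "japanese_bracket x \<ge> 0"
  using japanese_bracket_pos[of x] by linarith

lemma norm_le_japanese_bracket: "norm x \<le> japanese_bracket x"
  unfolding japanese_bracket_def by (rule real_le_rsqrt) simp

lemma japanese_bracket_le: "japanese_bracket x \<le> 1 + norm x"
  unfolding japanese_bracket_def by (rule real_le_lsqrt) (simp_all add: power2_eq_square algebra_simps)

lemma continuous_on_japanese_bracket [continuous_intros]:
  "continuous_on S f \<Longrightarrow> continuous_on S (\<lambda>x. japanese_bracket (f x))"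
  unfolding japanese_bracket_def by (intro continuous_intros)

lemma japanese_bracket_measurable [measurable]:
  "f \<in> borel_measurable M \<Longrightarrow> (\<lambda>x. japanese_bracket (f x)) \<in> borel_measurable M"
  unfolding japanese_bracket_def by measurable

lemma japanese_bracket_minus [simp]: "japanese_bracket (- x) = japanese_bracket x"
  by (simp add: japanese_bracket_def)

text \<open>
  Peetre's inequality; it expresses that all powers of the bracket are moderate weights.
\<close>

lemma japanese_bracket_add_le:
  "japanese_bracket (x + y) \<le> sqrt 2 * japanese_bracket x * japanese_bracket y"
proof -
  have "(norm (x + y))\<^sup>2 \<le> (norm x + norm y)\<^sup>2"
    by (intro power_mono norm_triangle_ineq) simp
  also have "\<dots> \<le> 2 * (norm x)\<^sup>2 + 2 * (norm y)\<^sup>2"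
    using sum_squares_bound[of "norm x" "norm y"] by (simp add: power2_sum)
  finally have "1 + (norm (x + y))\<^sup>2 \<le> 2 * (1 + (norm x)\<^sup>2) * (1 + (norm y)\<^sup>2)"
    by (simp add: algebra_simps) (smt (verit) mult_nonneg_nonneg zero_le_power2)
  then show ?thesis
    unfolding japanese_bracket_def by (simp flip: real_sqrt_mult)
qed

text \<open>
  All ways to distribute the derivations in a list over two factors, as in the Leibniz rule. Both parts
  keep the order of the list, in which the head is the outermost derivative.
\<close>

fun splits :: "'a list \<Rightarrow> ('a list \<times> 'a list) list" where
  "splits [] = [([], [])]"
| "splits (b # bs) = map (\<lambda>(as, cs). (b # as, cs)) (splits bs) @ map (\<lambda>(as, cs). (as, b # cs)) (splits bs)"

lemma set_splits: "(as, cs) \<in> set (splits bs) \<Longrightarrow> set as \<subseteq> set bs \<and> set cs \<subseteq> set bs \<and> length as \<le> length bs"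
  by (induction bs arbitrary: as cs) (auto, (blast | meson le_SucI)+)

lemma has_derivative_sum_list:
  "(\<And>i. i \<in> set xs \<Longrightarrow> (F i has_derivative F' i) (at t)) \<Longrightarrow>
   ((\<lambda>x. \<Sum>i\<leftarrow>xs. F i x) has_derivative (\<lambda>h. \<Sum>i\<leftarrow>xs. F' i h)) (at t)"
  by (induction xs) (auto intro!: derivative_eq_intros)

lemma continuous_on_sum_list:
  fixes F :: "'i \<Rightarrow> 'a::topological_space \<Rightarrow> 'b::real_normed_vector"
  shows "(\<And>i. i \<in> set xs \<Longrightarrow> continuous_on S (F i)) \<Longrightarrow> continuous_on S (\<lambda>x. \<Sum>i\<leftarrow>xs. F i x)"
  by (induction xs) (auto intro!: continuous_intros)

lemma norm_sum_list_le:
  fixes F :: "'i \<Rightarrow> 'b::real_normed_vector"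
  shows "norm (\<Sum>i\<leftarrow>xs. F i) \<le> (\<Sum>i\<leftarrow>xs. norm (F i))"
  by (induction xs) (auto intro: norm_triangle_le)

lemma smoothD: "smooth h \<Longrightarrow> set bs \<subseteq> Basis \<Longrightarrow>
    (iter_pderiv bs h has_derivative frechet_derivative (iter_pderiv bs h) (at x)) (at x)"
  unfolding smooth_def by (simp add: frechet_derivative_works)

lemma smooth_iter_continuous:
  assumes "smooth h" "set bs \<subseteq> Basis"
  shows "continuous_on UNIV (iter_pderiv bs h)"
  using smoothD[OF assms] by (intro continuous_at_imp_continuous_on) (auto dest: has_derivative_continuous)

text \<open>
  The common pattern of all computations below: a candidate family for the iterated derivatives
  is correct as soon as it is stable under one further differentiation.
\<close>

lemma iter_pderiv_eqI:
  assumes base: "G [] = h"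
    and step: "\<And>bs x. set bs \<subseteq> Basis \<Longrightarrow> (G bs has_derivative G' bs x) (at x)"
    and val: "\<And>b bs x. b \<in> Basis \<Longrightarrow> set bs \<subseteq> Basis \<Longrightarrow> G' bs x b = G (b # bs) x"
  shows "smooth h" and "set bs \<subseteq> Basis \<Longrightarrow> iter_pderiv bs h = G bs"
proof -
  have eq: "set bs \<subseteq> Basis \<Longrightarrow> iter_pderiv bs h = G bs" for bs
  proof (induction bs)
    case (Cons b bs)
    then have IH: "iter_pderiv bs h = G bs" by simp
    have "frechet_derivative (G bs) (at x) = G' bs x" for x
      using frechet_derivative_at[OF step[of bs x]] Cons.prems by simp
    then show ?case using val[of b bs] Cons.prems by (simp add: IH fun_eq_iff)
  qed (simp add: base)
  then show "set bs \<subseteq> Basis \<Longrightarrow> iter_pderiv bs h = G bs" .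
  show "smooth h"
    unfolding smooth_def using eq step by (auto simp: differentiable_def)
qed

lemma
  assumes g: "smooth g" and h: "smooth h"
  shows smooth_mult: "smooth (\<lambda>t. g t * h t)"
    and iter_pderiv_mult: "set bs \<subseteq> Basis \<Longrightarrow> iter_pderiv bs (\<lambda>t. g t * h t)
       = (\<lambda>t. \<Sum>(as, cs)\<leftarrow>splits bs. iter_pderiv as g t * iter_pderiv cs h t)"
proof -
  let ?G = "\<lambda>bs t. \<Sum>(as, cs)\<leftarrow>splits bs. iter_pderiv as g t * iter_pderiv cs h t"
  let ?d = "\<lambda>as g t v. frechet_derivative (iter_pderiv as g) (at t) v"
  let ?G' = "\<lambda>bs t v. \<Sum>(as, cs)\<leftarrow>splits bs. iter_pderiv as g t * ?d cs h t v + ?d as g t v * iter_pderiv cs h t"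
  have 1: "?G [] = (\<lambda>t. g t * h t)" by simp
  have 2: "(?G bs has_derivative ?G' bs t) (at t)" if bs: "set bs \<subseteq> Basis" for bs t
    unfolding case_prod_unfold
  proof (rule has_derivative_sum_list)
    fix i assume "i \<in> set (splits bs)"
    then have "set (fst i) \<subseteq> Basis" "set (snd i) \<subseteq> Basis"
      using set_splits[of "fst i" "snd i" bs] bs by auto
    then show "((\<lambda>t. iter_pderiv (fst i) g t * iter_pderiv (snd i) h t) has_derivative
       (\<lambda>v. iter_pderiv (fst i) g t * ?d (snd i) h t v + ?d (fst i) g t v * iter_pderiv (snd i) h t)) (at t)"
      using smoothD[OF g] smoothD[OF h] by (intro has_derivative_mult) auto
  qed
  have 3: "?G' bs t b = ?G (b # bs) t" for b bs t
    by (simp add: case_prod_unfold comp_def sum_list_addf add.commute)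
  show "smooth (\<lambda>t. g t * h t)" and "set bs \<subseteq> Basis \<Longrightarrow> iter_pderiv bs (\<lambda>t. g t * h t) = ?G bs"
    using iter_pderiv_eqI[of ?G, OF 1 2 3] by auto
qed

lemma
  assumes g: "smooth g" and h: "smooth h"
  shows smooth_add: "smooth (\<lambda>t. g t + h t)"
    and iter_pderiv_add: "set bs \<subseteq> Basis \<Longrightarrow>
       iter_pderiv bs (\<lambda>t. g t + h t) = (\<lambda>t. iter_pderiv bs g t + iter_pderiv bs h t)"
proof -
  let ?G = "\<lambda>bs t. iter_pderiv bs g t + iter_pderiv bs h t"
  have 2: "(?G bs has_derivative (\<lambda>v. frechet_derivative (iter_pderiv bs g) (at t) v
       + frechet_derivative (iter_pderiv bs h) (at t) v)) (at t)" if "set bs \<subseteq> Basis" for bs t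
    by (intro has_derivative_add smoothD g h that)
  show "smooth (\<lambda>t. g t + h t)" and "set bs \<subseteq> Basis \<Longrightarrow> iter_pderiv bs (\<lambda>t. g t + h t) = ?G bs"
    using iter_pderiv_eqI[of ?G "\<lambda>t. g t + h t", OF _ 2] by auto
qed

lemma
  assumes g: "smooth g" and L: "bounded_linear L"
  shows smooth_linear: "smooth (\<lambda>t. L (g t))"
    and iter_pderiv_linear: "set bs \<subseteq> Basis \<Longrightarrow> iter_pderiv bs (\<lambda>t. L (g t)) = (\<lambda>t. L (iter_pderiv bs g t))"
proof -
  let ?G = "\<lambda>bs t. L (iter_pderiv bs g t)"
  have 2: "(?G bs has_derivative (\<lambda>v. L (frechet_derivative (iter_pderiv bs g) (at t) v))) (at t)"
    if "set bs \<subseteq> Basis" for bs t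
    by (intro bounded_linear.has_derivative[OF L] smoothD g that)
  show "smooth (\<lambda>t. L (g t))" and "set bs \<subseteq> Basis \<Longrightarrow> iter_pderiv bs (\<lambda>t. L (g t)) = ?G bs"
    using iter_pderiv_eqI[of ?G "\<lambda>t. L (g t)", OF _ 2] by auto
qed

lemma
  assumes g: "smooth g"
  shows smooth_translate: "smooth (\<lambda>t. g (t - x))"
    and iter_pderiv_translate: "set bs \<subseteq> Basis \<Longrightarrow> iter_pderiv bs (\<lambda>t. g (t - x)) = (\<lambda>t. iter_pderiv bs g (t - x))"
proof -
  let ?G = "\<lambda>bs t. iter_pderiv bs g (t - x)"
  have 2: "(?G bs has_derivative (\<lambda>v. frechet_derivative (iter_pderiv bs g) (at (t - x)) v)) (at t)"
    if "set bs \<subseteq> Basis" for bs t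
  proof -
    have "((\<lambda>t. t - x) has_derivative (\<lambda>v. v)) (at t)"
      by (auto intro!: derivative_eq_intros)
    from has_derivative_compose[OF this smoothD[OF g that]] show ?thesis .
  qed
  show "smooth (\<lambda>t. g (t - x))" and "set bs \<subseteq> Basis \<Longrightarrow> iter_pderiv bs (\<lambda>t. g (t - x)) = ?G bs"
    using iter_pderiv_eqI[of ?G "\<lambda>t. g (t - x)", OF _ 2] by auto
qed

text \<open>
  The polynomial by which iterated differentiation acts on the plane wave of frequency \<open>\<eta>\<close>.
\<close>

definition wave_symbol :: "'a::euclidean_space list \<Rightarrow> 'a \<Rightarrow> complex" where
  "wave_symbol bs \<eta> = (\<Prod>b\<leftarrow>bs. \<i> * complex_of_real (b \<bullet> \<eta>))"

lemma wave_symbol_simps [simp]: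
  "wave_symbol [] \<eta> = 1" "wave_symbol (b # bs) \<eta> = \<i> * complex_of_real (b \<bullet> \<eta>) * wave_symbol bs \<eta>"
  by (simp_all add: wave_symbol_def)

lemma continuous_on_wave_symbol [continuous_intros]:
  "continuous_on S f \<Longrightarrow> continuous_on S (\<lambda>x. wave_symbol bs (f x))"
  by (induction bs) (auto intro!: continuous_intros)

lemma wave_symbol_measurable [measurable]: "wave_symbol bs \<in> borel_measurable borel"
  by (intro borel_measurable_continuous_onI continuous_intros)

lemma norm_wave_symbol_le: "set bs \<subseteq> Basis \<Longrightarrow> norm (wave_symbol bs \<eta>) \<le> norm \<eta> ^ length bs"
proof (induction bs)
  case (Cons b bs)
  have "\<bar>b \<bullet> \<eta>\<bar> \<le> norm \<eta>"
    using Cons.prems Cauchy_Schwarz_ineq2[of b \<eta>] by simp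
  then show ?case
    using Cons by (auto simp: norm_mult intro!: mult_mono)
qed simp

lemma
  shows smooth_wave: "smooth (wave \<eta>)"
    and iter_pderiv_wave: "set bs \<subseteq> Basis \<Longrightarrow> iter_pderiv bs (wave \<eta>) = (\<lambda>t. wave_symbol bs \<eta> * wave \<eta> t)"
proof -
  let ?G = "\<lambda>bs t. wave_symbol bs \<eta> * wave \<eta> t"
  have 2: "(?G bs has_derivative (\<lambda>v. wave_symbol bs \<eta> * (\<i> * complex_of_real (v \<bullet> \<eta>) * wave \<eta> t))) (at t)"
    for bs t
  proof -
    have "((\<lambda>t. \<i> * complex_of_real (t \<bullet> \<eta>)) has_derivative (\<lambda>v. \<i> * complex_of_real (v \<bullet> \<eta>))) (at t)"
      by (auto intro!: derivative_eq_intros)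
    from has_derivative_compose[OF this DERIV_exp[unfolded has_field_derivative_def]]
    show ?thesis
      unfolding wave_def by (auto intro!: has_derivative_mult_right simp: mult.commute)
  qed
  show "smooth (wave \<eta>)" and "set bs \<subseteq> Basis \<Longrightarrow> iter_pderiv bs (wave \<eta>) = ?G bs"
    using iter_pderiv_eqI[of ?G "wave \<eta>", OF _ 2] by auto
qed

text \<open>
  Differentiation under the integral sign. The Taylor estimate \<open>\<bar>e\<^sup>i\<^sup>a - 1 - i a\<bar> \<le> a\<^sup>2 / 2\<close> with
  \<open>a = h \<bullet> \<eta>\<close> bounds the remainder by \<open>\<bar>h\<bar>\<^sup>2\<close> times a moment of \<open>\<mu>\<close>, so the Frechet derivative is
  obtained at once.
\<close>

lemma integral_wave_has_derivative:
  fixes \<mu> :: "'a::euclidean_space measure" and m :: "'a \<Rightarrow> complex"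
  assumes sets: "sets \<mu> = sets borel"
    and mom: "\<And>k. integrable \<mu> (\<lambda>\<eta>. norm \<eta> ^ k)"
    and m [measurable]: "m \<in> borel_measurable borel" and bd: "\<And>\<eta>. norm (m \<eta>) \<le> norm \<eta> ^ k"
  shows "((\<lambda>t. \<integral>\<eta>. m \<eta> * wave \<eta> t \<partial>\<mu>) has_derivative
     (\<lambda>h. \<integral>\<eta>. \<i> * complex_of_real (h \<bullet> \<eta>) * m \<eta> * wave \<eta> t \<partial>\<mu>)) (at t)"
proof -
  note [measurable_cong] = sets
  have int0: "integrable \<mu> (\<lambda>\<eta>. m \<eta> * wave \<eta> t)" for t
    by (rule Bochner_Integration.integrable_bound[OF mom[of k]]) (use bd in \<open>auto simp: norm_mult\<close>)
  have nrm1: "norm (\<i> * complex_of_real (h \<bullet> \<eta>) * m \<eta> * wave \<eta> t) \<le> norm h * norm \<eta> ^ Suc k" for h \<eta>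
  proof -
    have "\<bar>h \<bullet> \<eta>\<bar> * norm (m \<eta>) \<le> (norm h * norm \<eta>) * norm \<eta> ^ k"
      by (intro mult_mono Cauchy_Schwarz_ineq2 bd) auto
    then show ?thesis by (simp add: norm_mult mult_ac)
  qed
  have int1: "integrable \<mu> (\<lambda>\<eta>. \<i> * complex_of_real (h \<bullet> \<eta>) * m \<eta> * wave \<eta> t)" for h
    by (rule Bochner_Integration.integrable_bound[of _ "\<lambda>\<eta>. norm h * norm \<eta> ^ Suc k"])
       (use mom[of "Suc k"] nrm1 in \<open>auto intro!: integrable_mult_right AE_I2\<close>)
  let ?D = "\<lambda>h. \<integral>\<eta>. \<i> * complex_of_real (h \<bullet> \<eta>) * m \<eta> * wave \<eta> t \<partial>\<mu>"
  have lin: "bounded_linear ?D"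
  proof (rule bounded_linear_intro[where K = "\<integral>\<eta>. norm \<eta> ^ Suc k \<partial>\<mu>"])
    fix x y show "?D (x + y) = ?D x + ?D y"
      by (subst Bochner_Integration.integral_add[symmetric, OF int1 int1])
         (simp add: algebra_simps)
  next
    fix r x show "?D (r *\<^sub>R x) = r *\<^sub>R ?D x"
      by (subst integral_scaleR_right[symmetric]) (simp add: scaleR_conv_of_real algebra_simps)
  next
    fix h
    have "norm (?D h) \<le> (\<integral>\<eta>. norm h * norm \<eta> ^ Suc k \<partial>\<mu>)"
      by (rule Bochner_Integration.integral_norm_bound_integral[OF int1]) (use mom[of "Suc k"] nrm1 in auto)
    then show "norm (?D h) \<le> norm h * (\<integral>\<eta>. norm \<eta> ^ Suc k \<partial>\<mu>)" by simp
  qed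
  define C where "C = (\<integral>\<eta>. norm \<eta> ^ (k + 2) / 2 \<partial>\<mu>)"
  have rem: "norm ((\<integral>\<eta>. m \<eta> * wave \<eta> (t + h) \<partial>\<mu>) - (\<integral>\<eta>. m \<eta> * wave \<eta> t \<partial>\<mu>) - ?D h) \<le> C * norm h ^ 2" for h
  proof -
    have "(\<integral>\<eta>. m \<eta> * wave \<eta> (t + h) \<partial>\<mu>) - (\<integral>\<eta>. m \<eta> * wave \<eta> t \<partial>\<mu>) - ?D h
       = (\<integral>\<eta>. m \<eta> * wave \<eta> (t + h) - m \<eta> * wave \<eta> t
             - \<i> * complex_of_real (h \<bullet> \<eta>) * m \<eta> * wave \<eta> t \<partial>\<mu>)"
      using int0 int1 by simp
    also have "norm \<dots> \<le> (\<integral>\<eta>. norm h ^ 2 * (norm \<eta> ^ (k + 2) / 2) \<partial>\<mu>)"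
    proof (rule Bochner_Integration.integral_norm_bound_integral)
      fix \<eta>
      have eq: "m \<eta> * wave \<eta> (t + h) - m \<eta> * wave \<eta> t - \<i> * complex_of_real (h \<bullet> \<eta>) * m \<eta> * wave \<eta> t
          = m \<eta> * wave \<eta> t * (iexp (h \<bullet> \<eta>) - 1 - \<i> * complex_of_real (h \<bullet> \<eta>))"
        by (simp add: wave_def inner_add_left exp_add algebra_simps)
      have "norm (iexp (h \<bullet> \<eta>) - 1 - \<i> * complex_of_real (h \<bullet> \<eta>)) \<le> \<bar>h \<bullet> \<eta>\<bar> ^ 2 / 2"
        using iexp_approx1[of "h \<bullet> \<eta>" 1] by (simp add: diff_diff_eq numeral_2_eq_2)
      also have "\<dots> \<le> (norm h * norm \<eta>) ^ 2 / 2"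
        by (intro divide_right_mono power_mono Cauchy_Schwarz_ineq2) auto
      finally have "norm (m \<eta>) * norm (iexp (h \<bullet> \<eta>) - 1 - \<i> * complex_of_real (h \<bullet> \<eta>))
          \<le> norm \<eta> ^ k * ((norm h * norm \<eta>) ^ 2 / 2)"
        by (intro mult_mono bd) auto
      also have "\<dots> = norm h ^ 2 * (norm \<eta> ^ (k + 2) / 2)"
        by (simp add: power_add power_mult_distrib power2_eq_square)
      finally show "norm (m \<eta> * wave \<eta> (t + h) - m \<eta> * wave \<eta> t - \<i> * complex_of_real (h \<bullet> \<eta>) * m \<eta> * wave \<eta> t)
          \<le> norm h ^ 2 * (norm \<eta> ^ (k + 2) / 2)"
        unfolding eq by (simp add: norm_mult)
    qed (use int0 int1 mom[of "k + 2"] in auto)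
    also have "\<dots> = C * norm h ^ 2" by (simp add: C_def mult.commute)
    finally show ?thesis .
  qed
  show ?thesis
    unfolding has_derivative_at
  proof (intro conjI lin)
    have "(\<lambda>h. norm h * C) \<midarrow>0\<rightarrow> 0"
      by (auto intro!: tendsto_eq_intros)
    then show "(\<lambda>h. norm ((\<integral>\<eta>. m \<eta> * wave \<eta> (t + h) \<partial>\<mu>) - (\<integral>\<eta>. m \<eta> * wave \<eta> t \<partial>\<mu>) - ?D h) / norm h) \<midarrow>0\<rightarrow> 0"
    proof (rule Lim_null_comparison[rotated])
      show "\<forall>\<^sub>F h in at 0. norm (norm ((\<integral>\<eta>. m \<eta> * wave \<eta> (t + h) \<partial>\<mu>) - (\<integral>\<eta>. m \<eta> * wave \<eta> t \<partial>\<mu>) - ?D h) / norm h)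
          \<le> norm h * C"
      proof (rule eventually_at_filter[THEN iffD2], rule always_eventually, intro allI impI)
        fix h :: 'a assume "h \<noteq> 0"
        then show "norm (norm ((\<integral>\<eta>. m \<eta> * wave \<eta> (t + h) \<partial>\<mu>) - (\<integral>\<eta>. m \<eta> * wave \<eta> t \<partial>\<mu>) - ?D h) / norm h)
          \<le> norm h * C"
          using rem[of h] by (simp add: divide_le_eq power2_eq_square mult_ac)
      qed
    qed
  qed
qed

lemma
  fixes \<mu> :: "'a::euclidean_space measure"
  assumes sets: "sets \<mu> = sets borel" and mom: "\<And>k. integrable \<mu> (\<lambda>\<eta>. norm \<eta> ^ k)"
  shows smooth_integral_wave: "smooth (\<lambda>t. \<integral>\<eta>. wave \<eta> t \<partial>\<mu>)"
    and iter_pderiv_integral_wave: "set bs \<subseteq> Basis \<Longrightarrow>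
      iter_pderiv bs (\<lambda>t. \<integral>\<eta>. wave \<eta> t \<partial>\<mu>) = (\<lambda>t. \<integral>\<eta>. wave_symbol bs \<eta> * wave \<eta> t \<partial>\<mu>)"
proof -
  let ?G = "\<lambda>bs t. \<integral>\<eta>. wave_symbol bs \<eta> * wave \<eta> t \<partial>\<mu>"
  have 2: "(?G bs has_derivative (\<lambda>h. \<integral>\<eta>. \<i> * complex_of_real (h \<bullet> \<eta>) * wave_symbol bs \<eta> * wave \<eta> t \<partial>\<mu>)) (at t)"
    if "set bs \<subseteq> Basis" for bs t
    by (rule integral_wave_has_derivative[OF sets mom _ norm_wave_symbol_le[OF that]]) measurable
  show "smooth (\<lambda>t. \<integral>\<eta>. wave \<eta> t \<partial>\<mu>)" and "set bs \<subseteq> Basis \<Longrightarrow> iter_pderiv bs (\<lambda>t. \<integral>\<eta>. wave \<eta> t \<partial>\<mu>) = ?G bs"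
    using iter_pderiv_eqI[of ?G "\<lambda>t. \<integral>\<eta>. wave \<eta> t \<partial>\<mu>", OF _ 2] by auto
qed

section \<open>Schwartz functions and tempered distributions\<close>

lemma schwartz_smooth: "h \<in> schwartz_space \<Longrightarrow> smooth h"
  by (simp add: schwartz_space_def)

lemma schwartzI:
  assumes "smooth h"
    and "\<And>k bs. set bs \<subseteq> Basis \<Longrightarrow> \<exists>C. \<forall>t. japanese_bracket t ^ k * norm (iter_pderiv bs h t) \<le> C"
  shows "h \<in> schwartz_space"
  unfolding schwartz_space_def
proof (intro CollectI conjI allI impI assms(1))
  fix k and bs :: "'a list" assume "set bs \<subseteq> Basis"
  then obtain C where "\<And>t. japanese_bracket t ^ k * norm (iter_pderiv bs h t) \<le> C"
    using assms(2) by blast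
  then show "bounded (range (\<lambda>x. japanese_bracket x ^ k * norm (iter_pderiv bs h x)))"
    by (intro boundedI[of _ C]) (auto simp: abs_mult)
qed

lemma schwartz_seminorm_upper:
  assumes "h \<in> schwartz_space" "set bs \<subseteq> Basis"
  shows "japanese_bracket t ^ k * norm (iter_pderiv bs h t) \<le> schwartz_seminorm k bs h"
  unfolding schwartz_seminorm_def
  by (rule cSUP_upper) (use assms in \<open>auto simp: schwartz_space_def intro: bounded_imp_bdd_above\<close>)

lemma schwartz_seminorm_leI:
  assumes "\<And>t. japanese_bracket t ^ k * norm (iter_pderiv bs h t) \<le> C"
  shows "schwartz_seminorm k bs h \<le> C"
  unfolding schwartz_seminorm_def by (rule cSUP_least) (use assms in auto)

lemma schwartz_seminorm_nonneg:
  assumes "h \<in> schwartz_space" "set bs \<subseteq> Basis"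
  shows "schwartz_seminorm k bs h \<ge> 0"
proof -
  have "0 \<le> japanese_bracket (0 :: 'a) ^ k * norm (iter_pderiv bs h 0)"
    by (intro mult_nonneg_nonneg zero_le_power) auto
  then show ?thesis
    using schwartz_seminorm_upper[OF assms, of 0 k] by linarith
qed

lemma
  assumes g: "g \<in> schwartz_space" and h: "h \<in> schwartz_space"
  shows schwartz_add: "(\<lambda>t. g t + h t) \<in> schwartz_space"
    and schwartz_seminorm_add: "set bs \<subseteq> Basis \<Longrightarrow>
      schwartz_seminorm k bs (\<lambda>t. g t + h t) \<le> schwartz_seminorm k bs g + schwartz_seminorm k bs h"
proof -
  note sm = schwartz_smooth[OF g] schwartz_smooth[OF h]
  have bd: "japanese_bracket t ^ k * norm (iter_pderiv bs (\<lambda>t. g t + h t) t)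
      \<le> schwartz_seminorm k bs g + schwartz_seminorm k bs h" if bs: "set bs \<subseteq> Basis" for k bs t
  proof -
    have "japanese_bracket t ^ k * norm (iter_pderiv bs g t + iter_pderiv bs h t)
        \<le> japanese_bracket t ^ k * norm (iter_pderiv bs g t) + japanese_bracket t ^ k * norm (iter_pderiv bs h t)"
      unfolding distrib_left[symmetric] using japanese_bracket_pos[of t]
      by (intro mult_left_mono norm_triangle_ineq) (simp add: less_imp_le)
    then show ?thesis
      using schwartz_seminorm_upper[OF g bs, of t k] schwartz_seminorm_upper[OF h bs, of t k]
      by (simp add: iter_pderiv_add[OF sm bs])
  qed
  show "(\<lambda>t. g t + h t) \<in> schwartz_space"
    using bd smooth_add[OF sm] by (intro schwartzI) blast+
  show "set bs \<subseteq> Basis \<Longrightarrow>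
      schwartz_seminorm k bs (\<lambda>t. g t + h t) \<le> schwartz_seminorm k bs g + schwartz_seminorm k bs h"
    using bd by (intro schwartz_seminorm_leI)
qed

lemma
  assumes g: "g \<in> schwartz_space"
  shows schwartz_cmult: "(\<lambda>t. c * g t) \<in> schwartz_space"
    and schwartz_seminorm_cmult: "set bs \<subseteq> Basis \<Longrightarrow>
      schwartz_seminorm k bs (\<lambda>t. c * g t) \<le> norm c * schwartz_seminorm k bs g"
proof -
  have bd: "japanese_bracket t ^ k * norm (iter_pderiv bs (\<lambda>t. c * g t) t)
      \<le> norm c * schwartz_seminorm k bs g" if bs: "set bs \<subseteq> Basis" for k bs t
    using mult_left_mono[OF schwartz_seminorm_upper[OF g bs, of t k] norm_ge_zero[of c]]
    by (simp add: iter_pderiv_linear[OF schwartz_smooth[OF g] bounded_linear_mult_right bs] norm_mult mult_ac)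
  show "(\<lambda>t. c * g t) \<in> schwartz_space"
    using bd smooth_linear[OF schwartz_smooth[OF g] bounded_linear_mult_right] by (intro schwartzI) blast+
  show "set bs \<subseteq> Basis \<Longrightarrow>
      schwartz_seminorm k bs (\<lambda>t. c * g t) \<le> norm c * schwartz_seminorm k bs g"
    using bd by (intro schwartz_seminorm_leI)
qed

lemma minus_as_lambda: "g - h = (\<lambda>t. g t + (-1) * h t)" for g h :: "'a \<Rightarrow> complex"
  by (simp add: fun_eq_iff)

lemma schwartz_diff:
  "g \<in> schwartz_space \<Longrightarrow> h \<in> schwartz_space \<Longrightarrow> g - h \<in> schwartz_space"
  unfolding minus_as_lambda by (intro schwartz_add schwartz_cmult)

lemma iter_pderiv_diff:
  assumes "smooth g" "smooth h" "set bs \<subseteq> Basis"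
  shows "iter_pderiv bs (g - h) t = iter_pderiv bs g t - iter_pderiv bs h t"
  unfolding minus_as_lambda
  by (subst iter_pderiv_add)
     (use assms in \<open>simp_all only: smooth_linear[OF _ bounded_linear_mult_right]
        iter_pderiv_linear[OF _ bounded_linear_mult_right], simp\<close>)

lemma schwartz_seminorm_triangle:
  assumes "g \<in> schwartz_space" "h \<in> schwartz_space" "u \<in> schwartz_space" "set bs \<subseteq> Basis"
  shows "schwartz_seminorm k bs (g - u) \<le> schwartz_seminorm k bs (g - h) + schwartz_seminorm k bs (h - u)"
proof -
  have "g - u = (\<lambda>t. (g - h) t + (h - u) t)" by (simp add: fun_eq_iff)
  then show ?thesis
    using schwartz_seminorm_add[OF schwartz_diff schwartz_diff, OF assms(1,2,2,3,4)] by simp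
qed

lemma schwartz_seminorm_minus_commute:
  "g \<in> schwartz_space \<Longrightarrow> h \<in> schwartz_space \<Longrightarrow> set bs \<subseteq> Basis \<Longrightarrow>
    schwartz_seminorm k bs (g - h) = schwartz_seminorm k bs (h - g)"
  unfolding schwartz_seminorm_def
  by (simp add: iter_pderiv_diff schwartz_smooth norm_minus_commute)

lemma schwartz_zero: "(\<lambda>_. 0) \<in> schwartz_space"
  by (rule schwartzI) (auto simp: smooth_def iter_pderiv_zero)

lemma schwartz_sum:
  "finite I \<Longrightarrow> (\<And>i. i \<in> I \<Longrightarrow> h i \<in> schwartz_space) \<Longrightarrow> (\<lambda>t. \<Sum>i\<in>I. h i t) \<in> schwartz_space"
  by (induction I rule: finite_induct) (auto intro: schwartz_add schwartz_zero)

lemma iter_pderiv_sum: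
  assumes "finite I" "\<And>i. i \<in> I \<Longrightarrow> h i \<in> schwartz_space" "set bs \<subseteq> Basis"
  shows "iter_pderiv bs (\<lambda>t. \<Sum>i\<in>I. h i t) = (\<lambda>t. \<Sum>i\<in>I. iter_pderiv bs (h i) t)"
  using assms(1,2)
proof (induction I rule: finite_induct)
  case (insert a I)
  have "iter_pderiv bs (\<lambda>t. h a t + (\<Sum>i\<in>I. h i t))
      = (\<lambda>t. iter_pderiv bs (h a) t + iter_pderiv bs (\<lambda>t. \<Sum>i\<in>I. h i t) t)"
    using insert.prems insert.hyps assms(3)
    by (intro iter_pderiv_add schwartz_smooth schwartz_sum) auto
  then show ?case using insert by simp
qed (simp add: iter_pderiv_zero)

text \<open>
  The given subbasis consists of seminorm balls around arbitrary centres. A ball that contains 0 also contains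
  a ball around 0, by the triangle inequality, and this passes to finite intersections and unions.
\<close>

lemma schwartz_neighbourhood_of_zero:
  assumes "openin schwartz_topology U" "(\<lambda>_. 0) \<in> U"
  shows "\<exists>A \<delta>. finite A \<and> (\<forall>(k, bs)\<in>A. set bs \<subseteq> Basis) \<and> \<delta> > 0 \<and>
    {h \<in> schwartz_space. \<forall>(k, bs)\<in>A. schwartz_seminorm k bs h < \<delta>} \<subseteq> U"
  using assms(1)[unfolded schwartz_topology_def, THEN openin_topology_generated_by] assms(2)
proof (induction rule: generate_topology_on.induct)
  case (Int a b)
  then obtain A \<delta> B \<epsilon> where A: "finite A" "\<forall>(k, bs)\<in>A. set bs \<subseteq> Basis" "\<delta> > 0"
     "{h \<in> schwartz_space. \<forall>(k, bs)\<in>A. schwartz_seminorm k bs h < \<delta>} \<subseteq> a"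
    and B: "finite B" "\<forall>(k, bs)\<in>B. set bs \<subseteq> Basis" "\<epsilon> > 0"
     "{h \<in> schwartz_space. \<forall>(k, bs)\<in>B. schwartz_seminorm k bs h < \<epsilon>} \<subseteq> b"
    by auto
  show ?case
  proof (intro exI[of _ "A \<union> B"] exI[of _ "min \<delta> \<epsilon>"] conjI)
    show "{h \<in> schwartz_space. \<forall>(k, bs)\<in>A \<union> B. schwartz_seminorm k bs h < min \<delta> \<epsilon>} \<subseteq> a \<inter> b"
      using A(4) B(4) by fastforce
  qed (use A B in auto)
next
  case (UN K)
  then obtain k where "k \<in> K" "(\<lambda>_. 0) \<in> k" by auto
  then show ?case using UN.IH by (meson Union_upper order_trans)
next
  case (Basis U)
  then obtain h0 k bs r where U: "U = {h \<in> schwartz_space. schwartz_seminorm k bs (h - h0) < r}"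
    and h0: "h0 \<in> schwartz_space" and bs: "set bs \<subseteq> Basis"
    by auto
  have less: "schwartz_seminorm k bs ((\<lambda>_. 0) - h0) < r" using Basis U by simp
  show ?case
  proof (intro exI[of _ "{(k, bs)}"] exI[of _ "r - schwartz_seminorm k bs ((\<lambda>_. 0) - h0)"] conjI)
    have "schwartz_seminorm k bs (h - h0) < r"
      if h: "h \<in> schwartz_space" "schwartz_seminorm k bs h < r - schwartz_seminorm k bs ((\<lambda>_. 0) - h0)" for h
    proof -
      have "h - (\<lambda>_. 0) = h" by (simp add: fun_eq_iff)
      then show ?thesis
        using schwartz_seminorm_triangle[OF h(1) schwartz_zero h0 bs, of k] h(2) by simp
    qed
    then show "{h \<in> schwartz_space. \<forall>(k', bs')\<in>{(k, bs)}.
       schwartz_seminorm k' bs' h < r - schwartz_seminorm k bs ((\<lambda>_. 0) - h0)} \<subseteq> U"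
      unfolding U by auto
  qed (use bs less in auto)
qed simp

lemma
  assumes "f \<in> tempered_distributions"
  shows tempered_add: "h1 \<in> schwartz_space \<Longrightarrow> h2 \<in> schwartz_space \<Longrightarrow> f (\<lambda>t. h1 t + h2 t) = f h1 + f h2"
    and tempered_cmult: "h1 \<in> schwartz_space \<Longrightarrow> f (\<lambda>t. c * h1 t) = c * f h1"
    and tempered_continuous: "continuous_map schwartz_topology euclidean f"
  using assms by (auto simp: tempered_distributions_def)

lemma tempered_zero: "f \<in> tempered_distributions \<Longrightarrow> f (\<lambda>_. 0) = 0"
  using tempered_cmult[of f "\<lambda>_. 0" 0] schwartz_zero by simp

lemma tempered_diff:
  assumes f: "f \<in> tempered_distributions" and h: "h1 \<in> schwartz_space" "h2 \<in> schwartz_space"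
  shows "f (h1 - h2) = f h1 - f h2"
  unfolding minus_as_lambda
  using tempered_add[OF f h(1) schwartz_cmult[OF h(2)], of "-1"] tempered_cmult[OF f h(2), of "-1"] by simp

lemma tempered_sum:
  assumes f: "f \<in> tempered_distributions"
  shows "finite I \<Longrightarrow> (\<And>i. i \<in> I \<Longrightarrow> h i \<in> schwartz_space) \<Longrightarrow> f (\<lambda>t. \<Sum>i\<in>I. h i t) = (\<Sum>i\<in>I. f (h i))"
  by (induction I rule: finite_induct) (simp_all add: tempered_zero[OF f] tempered_add[OF f] schwartz_sum)

text \<open>
  A continuous functional is bounded by 1 on some basic neighbourhood of 0; homogeneity
  turns this into an estimate by finitely many seminorms.
\<close>

lemma tempered_bound:
  assumes f: "f \<in> tempered_distributions"
  obtains A C where "finite A" "\<And>k bs. (k, bs) \<in> A \<Longrightarrow> set bs \<subseteq> Basis" "C \<ge> 0"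
    "\<And>h. h \<in> schwartz_space \<Longrightarrow> norm (f h) \<le> C * (\<Sum>(k, bs)\<in>A. schwartz_seminorm k bs h)"
proof -
  let ?U = "{h \<in> topspace schwartz_topology. f h \<in> ball 0 1}"
  have "openin schwartz_topology ?U"
    using openin_continuous_map_preimage[OF tempered_continuous[OF f], of "ball 0 1"] by simp
  moreover have "(\<lambda>_. 0) \<in> ?U"
    by (simp add: topspace_schwartz_topology schwartz_zero tempered_zero[OF f])
  ultimately obtain A \<delta> where A': "finite A" "\<forall>(k, bs)\<in>A. set bs \<subseteq> Basis" and \<delta>: "\<delta> > 0"
    and sub: "{h \<in> schwartz_space. \<forall>(k, bs)\<in>A. schwartz_seminorm k bs h < \<delta>} \<subseteq> ?U"
    using schwartz_neighbourhood_of_zero[of ?U] by meson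
  from A' have A: "finite A" "\<And>k bs. (k, bs) \<in> A \<Longrightarrow> set bs \<subseteq> Basis" by auto
  have "norm (f h) \<le> (1 / \<delta>) * (\<Sum>(k, bs)\<in>A. schwartz_seminorm k bs h)" if h: "h \<in> schwartz_space" for h
  proof (rule field_le_epsilon)
    fix \<tau> :: real assume \<tau>: "\<tau> > 0"
    let ?s = "\<Sum>(k, bs)\<in>A. schwartz_seminorm k bs h"
    have s0: "?s \<ge> 0"
    proof (intro sum_nonneg, clarify)
      show "0 \<le> schwartz_seminorm k bs h" if "(k, bs) \<in> A" for k bs
        by (rule schwartz_seminorm_nonneg[OF h A(2)[OF that]])
    qed
    define c where "c = \<delta> / (?s + \<delta> * \<tau>)"
    have pos: "?s + \<delta> * \<tau> > 0" using s0 \<delta> \<tau> by (simp add: add_nonneg_pos)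
    have c: "c > 0" using pos \<delta> by (simp add: c_def)
    have "(\<lambda>t. complex_of_real c * h t) \<in> ?U"
    proof (rule subsetD[OF sub], intro CollectI conjI ballI schwartz_cmult h, clarify)
      fix k bs assume kb: "(k, bs) \<in> A"
      have le: "schwartz_seminorm k bs h \<le> ?s"
        using member_le_sum[OF kb, of "\<lambda>(k, bs). schwartz_seminorm k bs h"] A h
        by (auto intro: schwartz_seminorm_nonneg)
      have "schwartz_seminorm k bs (\<lambda>t. complex_of_real c * h t) \<le> c * schwartz_seminorm k bs h"
        using schwartz_seminorm_cmult[OF h A(2)[OF kb], of k "complex_of_real c"] c by simp
      also have "c * schwartz_seminorm k bs h \<le> c * ?s" using c le by simp
      also have "c * ?s < c * (?s + \<delta> * \<tau>)" using c \<delta> \<tau> by simp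
      also have "\<dots> = \<delta>" using pos by (simp add: c_def)
      finally show "schwartz_seminorm k bs (\<lambda>t. complex_of_real c * h t) < \<delta>" by simp
    qed
    then have "norm (f (\<lambda>t. complex_of_real c * h t)) < 1" by simp
    then have "c * norm (f h) < 1"
      using c by (simp add: tempered_cmult[OF f h] norm_mult)
    then have "norm (f h) < (?s + \<delta> * \<tau>) / \<delta>"
    proof -
      have "norm (f h) < 1 / c"
        using \<open>c * norm (f h) < 1\<close> c by (simp only: pos_less_divide_eq mult.commute)
      then show ?thesis by (simp only: c_def divide_divide_eq_right mult_1)
    qed
    then show "norm (f h) \<le> (1 / \<delta>) * ?s + \<tau>"
      using \<delta> by (simp add: add_divide_distrib)
  qed
  then show ?thesis
    using A \<delta> that[of A "1 / \<delta>"] by simp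
qed

section \<open>Continuity of time-frequency shifts\<close>

text \<open>
  A bound on the seminorm of order \<open>k + 1\<close> makes the weighted function of order \<open>k\<close> uniformly small
  outside a ball; on the ball, uniform continuity on a compact set suffices.
\<close>

lemma uniform_decay_continuity:
  fixes H :: "'a::euclidean_space \<Rightarrow> 'p::euclidean_space \<Rightarrow> complex"
  assumes cont: "continuous_on UNIV (\<lambda>(t, y). H t y)"
    and bd: "\<And>t y. y \<in> cball y0 1 \<Longrightarrow> japanese_bracket t ^ Suc k * norm (H t y) \<le> C"
    and \<epsilon>: "\<epsilon> > 0"
  shows "\<exists>\<delta>>0. \<forall>y\<in>ball y0 \<delta>. \<forall>t. japanese_bracket t ^ k * norm (H t y - H t y0) \<le> \<epsilon>"
proof -
  define \<rho> where "\<rho> = max 1 (2 * C / \<epsilon>)"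
  let ?K = "cball (0::'a) \<rho> \<times> cball y0 1"
  have "continuous_on ?K (\<lambda>(t, y). complex_of_real (japanese_bracket t ^ k) * (H t y - H t y0))"
  proof -
    have "continuous_on ?K (\<lambda>z. H (fst z) (snd z))"
      using continuous_on_subset[OF cont] by (simp add: case_prod_unfold)
    moreover have "continuous_on ?K (\<lambda>z. H (fst z) y0)"
      using continuous_on_compose2[OF cont, of ?K "\<lambda>z. (fst z, y0)"]
      by (simp add: continuous_on_Pair continuous_on_fst continuous_on_id)
    ultimately show ?thesis
      unfolding case_prod_unfold by (intro continuous_intros)
  qed
  then have "uniformly_continuous_on ?K (\<lambda>(t, y). complex_of_real (japanese_bracket t ^ k) * (H t y - H t y0))"
    by (intro compact_uniformly_continuous compact_Times compact_cball)
  then obtain \<delta> where \<delta>: "\<delta> > 0" and uc: "\<And>z z'. z \<in> ?K \<Longrightarrow> z' \<in> ?K \<Longrightarrow> dist z' z < \<delta> \<Longrightarrow>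
     dist ((\<lambda>(t, y). complex_of_real (japanese_bracket t ^ k) * (H t y - H t y0)) z')
          ((\<lambda>(t, y). complex_of_real (japanese_bracket t ^ k) * (H t y - H t y0)) z) < \<epsilon>"
    using \<epsilon> unfolding uniformly_continuous_on_def by meson
  show ?thesis
  proof (intro exI[of _ "min \<delta> 1"] conjI ballI allI)
    fix y :: 'p and t :: 'a assume y: "y \<in> ball y0 (min \<delta> 1)"
    then have y1: "y \<in> cball y0 1" by simp
    have y01: "y0 \<in> cball y0 1" by simp
    have jb: "japanese_bracket t > 0" by (rule japanese_bracket_pos)
    show "japanese_bracket t ^ k * norm (H t y - H t y0) \<le> \<epsilon>"
    proof (cases "norm t \<le> \<rho>")
      case True
      have "dist (t, y) (t, y0) < \<delta>" using y by (simp add: dist_Pair_Pair dist_commute)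
      then show ?thesis
        using uc[of "(t, y0)" "(t, y)"] True y1 jb by (simp add: norm_mult norm_power)
    next
      case False
      have C0: "C \<ge> 0"
        using order_trans[OF _ bd[OF y01, of t]] jb by (simp add: less_imp_le)
      have "japanese_bracket t * (japanese_bracket t ^ k * norm (H t y - H t y0))
         \<le> japanese_bracket t ^ Suc k * (norm (H t y) + norm (H t y0))"
        using jb by (simp add: mult.assoc norm_triangle_ineq4 less_imp_le)
      also have "\<dots> \<le> 2 * C"
        using bd[OF y1, of t] bd[OF y01, of t] by (simp add: algebra_simps)
      also have "\<dots> \<le> \<rho> * \<epsilon>"
        using \<epsilon> by (simp add: \<rho>_def max_def field_simps)
      also have "\<rho> * \<epsilon> \<le> japanese_bracket t * \<epsilon>"
        using False norm_le_japanese_bracket[of t] \<epsilon> by (intro mult_right_mono) auto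
      finally show ?thesis using jb by simp
    qed
  qed (use \<delta> in simp)
qed

text \<open>
  The operator \<open>M\<^sub>\<xi> T\<^sub>x\<close>, with the plane wave in the form used for characteristic functions.
\<close>

definition tf_shift :: "('a::euclidean_space \<Rightarrow> complex) \<Rightarrow> 'a \<Rightarrow> 'a \<Rightarrow> 'a \<Rightarrow> complex" where
  "tf_shift g x \<xi> = (\<lambda>t. wave \<xi> t * g (t - x))"

lemma smooth_tf_shift: "smooth g \<Longrightarrow> smooth (tf_shift g x \<xi>)"
  unfolding tf_shift_def by (intro smooth_mult smooth_wave smooth_translate)

lemma iter_pderiv_tf_shift:
  assumes "smooth g" "set bs \<subseteq> Basis"
  shows "iter_pderiv bs (tf_shift g x \<xi>) t
    = (\<Sum>(as, cs)\<leftarrow>splits bs. wave_symbol as \<xi> * wave \<xi> t * iter_pderiv cs g (t - x))"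
proof -
  have "iter_pderiv bs (tf_shift g x \<xi>) t = (\<Sum>(as, cs)\<leftarrow>splits bs.
      iter_pderiv as (wave \<xi>) t * iter_pderiv cs (\<lambda>t. g (t - x)) t)"
    unfolding tf_shift_def by (subst iter_pderiv_mult) (use assms in \<open>auto intro: smooth_wave smooth_translate\<close>)
  also have "\<dots> = (\<Sum>(as, cs)\<leftarrow>splits bs. wave_symbol as \<xi> * wave \<xi> t * iter_pderiv cs g (t - x))"
  proof (rule arg_cong[where f = sum_list], rule map_cong[OF refl], clarify)
    fix as cs assume "(as, cs) \<in> set (splits bs)"
    then have "set as \<subseteq> Basis" "set cs \<subseteq> Basis"
      using set_splits assms(2) by blast+
    then show "iter_pderiv as (wave \<xi>) t * iter_pderiv cs (\<lambda>t. g (t - x)) t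
        = wave_symbol as \<xi> * wave \<xi> t * iter_pderiv cs g (t - x)"
      by (simp add: iter_pderiv_wave iter_pderiv_translate[OF assms(1)])
  qed
  finally show ?thesis .
qed

lemma continuous_on_iter_pderiv_tf_shift:
  assumes "smooth g" "set bs \<subseteq> Basis"
  shows "continuous_on UNIV (\<lambda>(t, y). iter_pderiv bs (tf_shift g (fst y) (snd y)) t)"
  unfolding case_prod_unfold iter_pderiv_tf_shift[OF assms]
proof (rule continuous_on_sum_list)
  fix i assume "i \<in> set (splits bs)"
  then have "set (snd i) \<subseteq> Basis"
    using set_splits[of "fst i" "snd i" bs] assms(2) by auto
  then have c: "continuous_on UNIV (iter_pderiv (snd i) g)"
    using smooth_iter_continuous assms(1) by blast
  show "continuous_on UNIV (\<lambda>z :: 'a \<times> 'a \<times> 'a. wave_symbol (fst i) (snd (snd z)) * wave (snd (snd z)) (fst z)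
      * iter_pderiv (snd i) g (fst z - fst (snd z)))"
    unfolding wave_def by (intro continuous_intros continuous_on_compose2[OF c]) auto
qed

text \<open>
  Moving the weight from \<open>t\<close> to \<open>t - x\<close> costs a power of \<open>\<langle>x\<rangle>\<close> by Peetre's inequality, and each
  derivative that falls on the wave costs a factor \<open>\<bar>\<xi>\<bar>\<close>.
\<close>

lemma iter_pderiv_tf_shift_growth:
  assumes g: "g \<in> schwartz_space" and bs: "set bs \<subseteq> Basis"
  shows "\<exists>C\<ge>0. \<forall>x \<xi> t. japanese_bracket t ^ k * norm (iter_pderiv bs (tf_shift g x \<xi>) t)
           \<le> C * (1 + norm \<xi>) ^ length bs * japanese_bracket x ^ k"
proof (intro exI conjI allI)
  define S where "S = (\<Sum>(as, cs)\<leftarrow>splits bs. schwartz_seminorm k cs g)"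
  have sub: "set as \<subseteq> Basis \<and> set cs \<subseteq> Basis \<and> length as \<le> length bs" if "(as, cs) \<in> set (splits bs)" for as cs
    using set_splits[OF that] bs by blast
  have S0: "S \<ge> 0"
    unfolding S_def by (intro sum_list_nonneg) (auto dest!: sub intro!: schwartz_seminorm_nonneg[OF g])
  then show "sqrt 2 ^ k * S \<ge> 0" by simp
  fix x \<xi> t :: 'a
  have jb: "0 \<le> japanese_bracket t" by simp
  have peetre: "japanese_bracket t ^ k \<le> sqrt 2 ^ k * japanese_bracket x ^ k * japanese_bracket (t - x) ^ k"
    using power_mono[OF japanese_bracket_add_le[of x "t - x"], of k] by (simp add: power_mult_distrib)
  have summand: "japanese_bracket t ^ k * norm (wave_symbol as \<xi> * wave \<xi> t * iter_pderiv cs g (t - x))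
      \<le> (sqrt 2 ^ k * (1 + norm \<xi>) ^ length bs * japanese_bracket x ^ k) * schwartz_seminorm k cs g"
    if i: "(as, cs) \<in> set (splits bs)" for as cs
  proof -
    have "norm (wave_symbol as \<xi>) \<le> norm \<xi> ^ length as"
      using norm_wave_symbol_le sub[OF i] by blast
    also have "\<dots> \<le> (1 + norm \<xi>) ^ length as" by (intro power_mono) auto
    also have "\<dots> \<le> (1 + norm \<xi>) ^ length bs" using sub[OF i] by (intro power_increasing) auto
    finally have 1: "norm (wave_symbol as \<xi>) \<le> (1 + norm \<xi>) ^ length bs" .
    have "japanese_bracket t ^ k * norm (iter_pderiv cs g (t - x))
      \<le> (sqrt 2 ^ k * japanese_bracket x ^ k * japanese_bracket (t - x) ^ k) * norm (iter_pderiv cs g (t - x))"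
      by (intro mult_right_mono peetre) auto
    also have "\<dots> = (sqrt 2 ^ k * japanese_bracket x ^ k) * (japanese_bracket (t - x) ^ k * norm (iter_pderiv cs g (t - x)))"
      by (simp add: mult_ac)
    also have "\<dots> \<le> (sqrt 2 ^ k * japanese_bracket x ^ k) * schwartz_seminorm k cs g"
      using sub[OF i] jb by (intro mult_left_mono schwartz_seminorm_upper g) auto
    finally have 2: "japanese_bracket t ^ k * norm (iter_pderiv cs g (t - x))
      \<le> (sqrt 2 ^ k * japanese_bracket x ^ k) * schwartz_seminorm k cs g" .
    have "norm (wave_symbol as \<xi>) * (japanese_bracket t ^ k * norm (iter_pderiv cs g (t - x)))
       \<le> (1 + norm \<xi>) ^ length bs * ((sqrt 2 ^ k * japanese_bracket x ^ k) * schwartz_seminorm k cs g)"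
      using jb by (intro mult_mono 1 2) auto
    then show ?thesis by (simp add: norm_mult mult_ac)
  qed
  have "japanese_bracket t ^ k * norm (iter_pderiv bs (tf_shift g x \<xi>) t)
     \<le> japanese_bracket t ^ k * (\<Sum>i\<leftarrow>splits bs. norm (case i of (as, cs) \<Rightarrow> wave_symbol as \<xi> * wave \<xi> t * iter_pderiv cs g (t - x)))"
    unfolding iter_pderiv_tf_shift[OF schwartz_smooth[OF g] bs]
    using jb by (intro mult_left_mono norm_sum_list_le) auto
  also have "\<dots> = (\<Sum>i\<leftarrow>splits bs. japanese_bracket t ^ k * norm (case i of (as, cs) \<Rightarrow> wave_symbol as \<xi> * wave \<xi> t * iter_pderiv cs g (t - x)))"
    by (rule sum_list_const_mult[symmetric])
  also have "\<dots> \<le> (\<Sum>(as, cs)\<leftarrow>splits bs. (sqrt 2 ^ k * (1 + norm \<xi>) ^ length bs * japanese_bracket x ^ k) * schwartz_seminorm k cs g)"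
    by (intro sum_list_mono) (use summand in auto)
  also have "\<dots> = (sqrt 2 ^ k * (1 + norm \<xi>) ^ length bs * japanese_bracket x ^ k) * S"
    unfolding S_def case_prod_unfold by (rule sum_list_const_mult)
  finally show "japanese_bracket t ^ k * norm (iter_pderiv bs (tf_shift g x \<xi>) t)
      \<le> (sqrt 2 ^ k * S) * (1 + norm \<xi>) ^ length bs * japanese_bracket x ^ k"
    by (simp add: mult_ac)
qed

lemma schwartz_tf_shift:
  assumes g: "g \<in> schwartz_space"
  shows "tf_shift g x \<xi> \<in> schwartz_space"
proof (rule schwartzI)
  show "smooth (tf_shift g x \<xi>)" by (rule smooth_tf_shift[OF schwartz_smooth[OF g]])
next
  fix k and bs :: "'a list" assume "set bs \<subseteq> Basis"
  from iter_pderiv_tf_shift_growth[OF g this, of k]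
  show "\<exists>C. \<forall>t. japanese_bracket t ^ k * norm (iter_pderiv bs (tf_shift g x \<xi>) t) \<le> C"
    by meson
qed

lemma schwartz_seminorm_tf_shift_growth:
  assumes g: "g \<in> schwartz_space" and bs: "set bs \<subseteq> Basis"
  obtains C where "C \<ge> 0"
    "\<And>x \<xi>. schwartz_seminorm k bs (tf_shift g x \<xi>) \<le> C * (1 + norm \<xi>) ^ length bs * japanese_bracket x ^ k"
  using iter_pderiv_tf_shift_growth[OF assms, of k] schwartz_seminorm_leI by metis

lemma schwartz_seminorm_tf_shift_continuous:
  fixes y0 :: "'a::euclidean_space \<times> 'a"
  assumes g: "g \<in> schwartz_space" and bs: "set bs \<subseteq> Basis"
  shows "((\<lambda>y. schwartz_seminorm k bs (tf_shift g (fst y) (snd y) - tf_shift g (fst y0) (snd y0))) \<longlongrightarrow> 0) (nhds y0)"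
proof (rule tendstoI)
  fix \<epsilon> :: real assume \<epsilon>: "\<epsilon> > 0"
  let ?H = "\<lambda>t y. iter_pderiv bs (tf_shift g (fst y) (snd y)) t"
  obtain C where C: "C \<ge> 0" "\<And>x \<xi> t. japanese_bracket t ^ Suc k * norm (iter_pderiv bs (tf_shift g x \<xi>) t)
           \<le> C * (1 + norm \<xi>) ^ length bs * japanese_bracket x ^ Suc k"
    using iter_pderiv_tf_shift_growth[OF g bs, of "Suc k"] by blast
  let ?R = "2 + norm y0"
  have "japanese_bracket t ^ Suc k * norm (?H t y) \<le> C * ?R ^ length bs * ?R ^ Suc k"
    if y: "y \<in> cball y0 1" for t and y :: "'a \<times> 'a"
  proof -
    have "norm y \<le> 1 + norm y0"
      using y norm_triangle_sub[of y y0] by (simp add: dist_norm norm_minus_commute)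
    then have "norm (fst y) \<le> 1 + norm y0" "norm (snd y) \<le> 1 + norm y0"
      using norm_fst_le[of "fst y" "snd y"] norm_snd_le[of "snd y" "fst y"] by auto
    then have "1 + norm (snd y) \<le> ?R" "japanese_bracket (fst y) \<le> ?R"
      using japanese_bracket_le[of "fst y"] by linarith+
    then have "C * (1 + norm (snd y)) ^ length bs * japanese_bracket (fst y) ^ Suc k \<le> C * ?R ^ length bs * ?R ^ Suc k"
      using C(1) japanese_bracket_pos[of "fst y"] by (intro mult_mono power_mono) auto
    then show ?thesis using C(2)[of t "fst y" "snd y"] by linarith
  qed
  from uniform_decay_continuity[OF continuous_on_iter_pderiv_tf_shift[OF schwartz_smooth[OF g] bs] this, of y0 "\<epsilon> / 2"]
  obtain \<delta> where \<delta>: "\<delta> > 0"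
    "\<forall>y\<in>ball y0 \<delta>. \<forall>t. japanese_bracket t ^ k * norm (?H t y - ?H t y0) \<le> \<epsilon> / 2"
    using \<epsilon> by (meson half_gt_zero)
  show "\<forall>\<^sub>F y in nhds y0. dist (schwartz_seminorm k bs (tf_shift g (fst y) (snd y) - tf_shift g (fst y0) (snd y0))) 0 < \<epsilon>"
    unfolding eventually_nhds_metric
  proof (intro exI[of _ \<delta>] conjI allI impI \<delta>(1))
    fix y assume "dist y y0 < \<delta>"
    then have "y \<in> ball y0 \<delta>" by (simp add: dist_commute)
    then have "schwartz_seminorm k bs (tf_shift g (fst y) (snd y) - tf_shift g (fst y0) (snd y0)) \<le> \<epsilon> / 2"
      using \<delta>(2) by (intro schwartz_seminorm_leI) (simp add: iter_pderiv_diff smooth_tf_shift schwartz_smooth[OF g] bs)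
    moreover have "schwartz_seminorm k bs (tf_shift g (fst y) (snd y) - tf_shift g (fst y0) (snd y0)) \<ge> 0"
      by (intro schwartz_seminorm_nonneg schwartz_diff schwartz_tf_shift g bs)
    ultimately show "dist (schwartz_seminorm k bs (tf_shift g (fst y) (snd y) - tf_shift g (fst y0) (snd y0))) 0 < \<epsilon>"
      using \<epsilon> by simp
  qed
qed

text \<open>
  Needed for measurability when the difference of two shifts is integrated over their parameters.
\<close>

lemma schwartz_seminorm_tf_shift_diff_continuous:
  assumes g: "g \<in> schwartz_space" and bs: "set bs \<subseteq> Basis"
  shows "continuous_on UNIV (\<lambda>(y, z). schwartz_seminorm k bs
     (tf_shift g (fst y) (snd y) - tf_shift g (fst z) (snd z)))"
proof (rule continuous_at_imp_continuous_on, intro ballI)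
  fix w0 :: "('a \<times> 'a) \<times> ('a \<times> 'a)"
  obtain y0 z0 where w0: "w0 = (y0, z0)" by (cases w0)
  let ?T = "\<lambda>y. tf_shift g (fst y) (snd y)"
  let ?N = "schwartz_seminorm k bs"
  note T = schwartz_tf_shift[OF g]
  have le: "\<bar>?N (?T y - ?T z) - ?N (?T y0 - ?T z0)\<bar> \<le> ?N (?T y - ?T y0) + ?N (?T z - ?T z0)" for y z
  proof -
    have "?N (?T y - ?T z) \<le> ?N (?T y - ?T y0) + ?N (?T y0 - ?T z)"
         "?N (?T y0 - ?T z) \<le> ?N (?T y0 - ?T z0) + ?N (?T z0 - ?T z)"
         "?N (?T y0 - ?T z0) \<le> ?N (?T y0 - ?T y) + ?N (?T y - ?T z0)"
         "?N (?T y - ?T z0) \<le> ?N (?T y - ?T z) + ?N (?T z - ?T z0)"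
      by (intro schwartz_seminorm_triangle T bs)+
    moreover have "?N (?T z0 - ?T z) = ?N (?T z - ?T z0)" "?N (?T y0 - ?T y) = ?N (?T y - ?T y0)"
      by (intro schwartz_seminorm_minus_commute T bs)+
    ultimately show ?thesis by linarith
  qed
  have y: "((\<lambda>w. ?N (?T (fst w) - ?T y0)) \<longlongrightarrow> 0) (at w0)"
    by (rule filterlim_compose[OF schwartz_seminorm_tf_shift_continuous[OF g bs]])
       (use tendsto_fst[OF tendsto_ident_at, of w0 UNIV] in \<open>simp add: w0\<close>)
  have z: "((\<lambda>w. ?N (?T (snd w) - ?T z0)) \<longlongrightarrow> 0) (at w0)"
    by (rule filterlim_compose[OF schwartz_seminorm_tf_shift_continuous[OF g bs]])
       (use tendsto_snd[OF tendsto_ident_at, of w0 UNIV] in \<open>simp add: w0\<close>)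
  have "((\<lambda>w. ?N (?T (fst w) - ?T (snd w)) - ?N (?T y0 - ?T z0)) \<longlongrightarrow> 0) (at w0)"
    by (rule Lim_null_comparison[OF _ tendsto_add_zero[OF y z]])
       (use le in \<open>auto intro: always_eventually\<close>)
  then have "((\<lambda>w. ?N (?T (fst w) - ?T (snd w))) \<longlongrightarrow> ?N (?T y0 - ?T z0)) (at w0)"
    by (simp add: LIM_zero_iff)
  then show "isCont (\<lambda>(y, z). ?N (?T y - ?T z)) w0"
    by (simp add: isCont_def case_prod_unfold w0)
qed

section \<open>Tempered distributions and superpositions of plane waves\<close>

lemma tempered_tf_shift_growth:
  fixes f :: "('a::euclidean_space \<Rightarrow> complex) \<Rightarrow> complex"
  assumes f: "f \<in> tempered_distributions" and g: "g \<in> schwartz_space"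
  obtains C m where "C \<ge> 0"
    "\<And>x \<xi>. norm (f (tf_shift g x \<xi>)) \<le> C * (1 + norm \<xi>) ^ m * japanese_bracket x ^ m"
proof -
  obtain A C where A: "finite A" "\<And>k bs. (k, bs) \<in> A \<Longrightarrow> set bs \<subseteq> Basis" and C: "C \<ge> 0"
    and bd: "\<And>h. h \<in> schwartz_space \<Longrightarrow> norm (f h) \<le> C * (\<Sum>(k, bs)\<in>A. schwartz_seminorm k bs h)"
    by (rule tempered_bound[OF f]) blast
  have "\<forall>kb\<in>A. \<exists>c\<ge>0. \<forall>x \<xi>. schwartz_seminorm (fst kb) (snd kb) (tf_shift g x \<xi>)
      \<le> c * (1 + norm \<xi>) ^ length (snd kb) * japanese_bracket x ^ fst kb"
  proof
    fix kb assume "kb \<in> A"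
    then have "set (snd kb) \<subseteq> Basis" using A(2)[of "fst kb" "snd kb"] by simp
    from schwartz_seminorm_tf_shift_growth[OF g this, of "fst kb"]
    show "\<exists>c\<ge>0. \<forall>x \<xi>. schwartz_seminorm (fst kb) (snd kb) (tf_shift g x \<xi>)
      \<le> c * (1 + norm \<xi>) ^ length (snd kb) * japanese_bracket x ^ fst kb" by metis
  qed
  then obtain c where c: "\<And>kb. kb \<in> A \<Longrightarrow> c kb \<ge> 0"
    "\<And>kb x \<xi>. kb \<in> A \<Longrightarrow> schwartz_seminorm (fst kb) (snd kb) (tf_shift g x \<xi>)
      \<le> c kb * (1 + norm \<xi>) ^ length (snd kb) * japanese_bracket x ^ fst kb"
    by metis
  define m where "m = (\<Sum>kb\<in>A. fst kb + length (snd kb))"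
  have m: "fst kb \<le> m" "length (snd kb) \<le> m" if "kb \<in> A" for kb
    using member_le_sum[OF that, of "\<lambda>kb. fst kb + length (snd kb)"] A(1) by (auto simp: m_def)
  have "norm (f (tf_shift g x \<xi>)) \<le> (C * (\<Sum>kb\<in>A. c kb)) * (1 + norm \<xi>) ^ m * japanese_bracket x ^ m" for x \<xi>
  proof -
    have "norm (f (tf_shift g x \<xi>)) \<le> C * (\<Sum>kb\<in>A. schwartz_seminorm (fst kb) (snd kb) (tf_shift g x \<xi>))"
      using bd[OF schwartz_tf_shift[OF g]] by (simp add: case_prod_unfold)
    also have "\<dots> \<le> C * (\<Sum>kb\<in>A. c kb * (1 + norm \<xi>) ^ m * japanese_bracket x ^ m)"
    proof (intro mult_left_mono sum_mono C)
      fix kb assume kb: "kb \<in> A"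
      have "schwartz_seminorm (fst kb) (snd kb) (tf_shift g x \<xi>)
          \<le> c kb * (1 + norm \<xi>) ^ length (snd kb) * japanese_bracket x ^ fst kb"
        by (rule c(2)[OF kb])
      also have "\<dots> \<le> c kb * (1 + norm \<xi>) ^ m * japanese_bracket x ^ m"
        using m[OF kb] c(1)[OF kb] japanese_bracket_ge_1[of x]
        by (intro mult_mono power_increasing mult_nonneg_nonneg zero_le_power) auto
      finally show "schwartz_seminorm (fst kb) (snd kb) (tf_shift g x \<xi>)
          \<le> c kb * (1 + norm \<xi>) ^ m * japanese_bracket x ^ m" .
    qed
    also have "\<dots> = (C * (\<Sum>kb\<in>A. c kb)) * (1 + norm \<xi>) ^ m * japanese_bracket x ^ m"
      by (simp only: sum_distrib_right sum_distrib_left mult.assoc)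
    finally show ?thesis .
  qed
  then show ?thesis
    using that[of "C * (\<Sum>kb\<in>A. c kb)" m] C c(1) by (simp add: sum_nonneg)
qed

lemma tempered_tf_shift_continuous:
  assumes f: "f \<in> tempered_distributions" and g: "g \<in> schwartz_space"
  shows "continuous_on UNIV (\<lambda>y. f (tf_shift g (fst y) (snd y)))"
proof (rule continuous_at_imp_continuous_on, intro ballI)
  fix y0 :: "'a \<times> 'a"
  obtain A C where A: "finite A" "\<And>k bs. (k, bs) \<in> A \<Longrightarrow> set bs \<subseteq> Basis"
    and bd: "\<And>h. h \<in> schwartz_space \<Longrightarrow> norm (f h) \<le> C * (\<Sum>(k, bs)\<in>A. schwartz_seminorm k bs h)"
    by (rule tempered_bound[OF f]) blast
  let ?T = "\<lambda>y. tf_shift g (fst y) (snd y)"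
  have "((\<lambda>y. \<Sum>kb\<in>A. schwartz_seminorm (fst kb) (snd kb) (?T y - ?T y0)) \<longlongrightarrow> (\<Sum>kb\<in>A. 0)) (at y0)"
  proof (intro tendsto_sum)
    fix kb assume "kb \<in> A"
    then have "set (snd kb) \<subseteq> Basis" using A(2)[of "fst kb" "snd kb"] by simp
    from schwartz_seminorm_tf_shift_continuous[OF g this]
    show "((\<lambda>y. schwartz_seminorm (fst kb) (snd kb) (?T y - ?T y0)) \<longlongrightarrow> 0) (at y0)"
      by (rule filterlim_mono[OF _ order_refl]) (simp add: at_within_def)
  qed
  then have lim: "((\<lambda>y. C * (\<Sum>kb\<in>A. schwartz_seminorm (fst kb) (snd kb) (?T y - ?T y0))) \<longlongrightarrow> 0) (at y0)"
    by (auto intro: tendsto_mult_right_zero)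
  have "((\<lambda>y. f (?T y) - f (?T y0)) \<longlongrightarrow> 0) (at y0)"
  proof (rule Lim_null_comparison[OF always_eventually lim], rule allI)
    fix y
    show "norm (f (?T y) - f (?T y0)) \<le> C * (\<Sum>kb\<in>A. schwartz_seminorm (fst kb) (snd kb) (?T y - ?T y0))"
      unfolding tempered_diff[OF f schwartz_tf_shift[OF g] schwartz_tf_shift[OF g], symmetric]
      using bd[OF schwartz_diff[OF schwartz_tf_shift[OF g] schwartz_tf_shift[OF g]],
          of "fst y" "snd y" "fst y0" "snd y0"]
      by (simp only: case_prod_unfold)
  qed
  then show "isCont (\<lambda>y. f (?T y)) y0"
    by (simp add: isCont_def LIM_zero_iff)
qed

lemma integral_simple_function_compose:
  fixes G :: "'b \<Rightarrow> complex"
  assumes "finite_measure M" and s: "simple_function M s"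
  shows "integrable M (\<lambda>x. G (s x))"
    and "(\<integral>x. G (s x) \<partial>M) = (\<Sum>v\<in>s ` space M. complex_of_real (measure M (s -` {v} \<inter> space M)) * G v)"
proof -
  interpret finite_measure M by fact
  have sets [measurable]: "s -` {v} \<inter> space M \<in> sets M" for v
    using simple_functionD(2)[OF s] by blast
  have fin: "finite (s ` space M)"
    using simple_functionD(1)[OF s] .
  have eq: "G (s x) = (\<Sum>v\<in>s ` space M. indicator (s -` {v} \<inter> space M) x *\<^sub>R G v)" if "x \<in> space M" for x
  proof -
    have "(\<Sum>v\<in>s ` space M. indicator (s -` {v} \<inter> space M) x *\<^sub>R G v)
        = (\<Sum>v\<in>s ` space M. if v = s x then G v else 0)"
      using that by (intro sum.cong) (auto split: split_indicator)
    then show ?thesis using fin that by simp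
  qed
  have int: "integrable M (\<lambda>x. indicator (s -` {v} \<inter> space M) x *\<^sub>R G v)" for v
    by (intro integrable_scaleR_left integrable_real_indicator) (auto simp: emeasure_finite less_top[symmetric])
  show "integrable M (\<lambda>x. G (s x))"
    by (subst Bochner_Integration.integrable_cong[OF refl eq]) (auto intro: int)
  have "(\<integral>x. G (s x) \<partial>M) = (\<integral>x. (\<Sum>v\<in>s ` space M. indicator (s -` {v} \<inter> space M) x *\<^sub>R G v) \<partial>M)"
    by (rule Bochner_Integration.integral_cong[OF refl eq])
  also have "\<dots> = (\<Sum>v\<in>s ` space M. measure M (s -` {v} \<inter> space M) *\<^sub>R G v)"
  proof (subst Bochner_Integration.integral_sum[OF int], rule sum.cong[OF refl])
    have "integrable M (indicator (s -` {v} \<inter> space M) :: _ \<Rightarrow> real)" for v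
      by (intro integrable_real_indicator) (auto simp: emeasure_finite less_top[symmetric])
    then show "(\<integral>x. indicator (s -` {v} \<inter> space M) x *\<^sub>R G v \<partial>M) = measure M (s -` {v} \<inter> space M) *\<^sub>R G v" for v
      by (subst integral_scaleR_left) auto
  qed
  finally show "(\<integral>x. G (s x) \<partial>M) = (\<Sum>v\<in>s ` space M. complex_of_real (measure M (s -` {v} \<inter> space M)) * G v)"
    by (simp add: scaleR_conv_of_real)
qed

text \<open>
  A tempered distribution commutes with the superposition \<open>\<integral> e\<^sup>i\<^sup>t\<^sup>\<eta> \<psi>(t) d\<mu>(\<eta>)\<close>. For a measure with finitely many
  atoms this is linearity. In general, simple functions \<open>s\<^sub>i(\<eta>) \<rightarrow> \<eta>\<close> replace \<open>\<mu>\<close> by such measures: the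
  superpositions \<open>h\<^sub>i\<close> converge in every Schwartz seminorm, because \<open>\<eta> \<mapsto> e\<^sup>i\<^sup>t\<^sup>\<eta> \<psi>(t)\<close> is continuous
  with polynomial growth in each of them, and the values of \<open>f\<close> converge by dominated convergence. The
  bound \<open>\<bar>s\<^sub>i(\<eta>)\<bar> \<le> 2 \<bar>\<eta>\<bar>\<close> keeps the growth under control.
\<close>

lemma tempered_integral_wave:
  fixes \<mu> :: "'a::euclidean_space measure"
  assumes f: "f \<in> tempered_distributions" and \<psi>: "\<psi> \<in> schwartz_space"
    and \<mu>: "finite_measure \<mu>" and sets: "sets \<mu> = sets borel"
    and mom: "\<And>k. integrable \<mu> (\<lambda>\<eta>. norm \<eta> ^ k)"
  shows "integrable \<mu> (\<lambda>\<eta>. f (\<lambda>t. wave \<eta> t * \<psi> t))"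
    and "f (\<lambda>t. (\<integral>\<eta>. wave \<eta> t \<partial>\<mu>) * \<psi> t) = (\<integral>\<eta>. f (\<lambda>t. wave \<eta> t * \<psi> t) \<partial>\<mu>)"
proof -
  interpret finite_measure \<mu> by fact
  note [measurable_cong] = sets
  have space: "space \<mu> = UNIV" using sets_eq_imp_space_eq[OF sets] by simp
  define e where "e = tf_shift \<psi> 0"
  have e: "e \<eta> = (\<lambda>t. wave \<eta> t * \<psi> t)" for \<eta>
    by (simp add: e_def tf_shift_def)
  have eS: "e \<eta> \<in> schwartz_space" for \<eta>
    unfolding e_def by (rule schwartz_tf_shift[OF \<psi>])
  have poly_int: "integrable \<mu> (\<lambda>\<eta>. C * (1 + a * norm \<eta>) ^ m)" for C a :: real and m
    unfolding binomial_ring power_one power_mult_distrib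
    by (intro integrable_mult_right Bochner_Integration.integrable_sum)
       (use mom in \<open>auto intro!: integrable_mult_right simp: mult.assoc\<close>)
  obtain C m where Cm: "C \<ge> 0" "\<And>\<eta>. norm (f (e \<eta>)) \<le> C * (1 + norm \<eta>) ^ m"
  proof -
    obtain C m where "C \<ge> 0"
      "\<And>x \<xi>. norm (f (tf_shift \<psi> x \<xi>)) \<le> C * (1 + norm \<xi>) ^ m * japanese_bracket x ^ m"
      using tempered_tf_shift_growth[OF f \<psi>] by blast
    from that[OF this(1), of m] this(2)[of 0] show ?thesis
      by (simp add: e_def japanese_bracket_def)
  qed
  have cont: "continuous_on UNIV (\<lambda>\<eta>. f (e \<eta>))"
    unfolding e_def using continuous_on_compose2[OF tempered_tf_shift_continuous[OF f \<psi>], of UNIV "\<lambda>\<eta>. (0, \<eta>)"]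
    by (simp add: continuous_intros)
  have fe_meas [measurable]: "(\<lambda>\<eta>. f (e \<eta>)) \<in> borel_measurable borel"
    by (rule borel_measurable_continuous_onI[OF cont])
  have intfe: "integrable \<mu> (\<lambda>\<eta>. f (e \<eta>))"
    by (rule Bochner_Integration.integrable_bound[OF poly_int[of C 1 m]])
       (use Cm(2) in \<open>auto intro!: AE_I2 order_trans[OF _ abs_ge_self]\<close>)
  then show "integrable \<mu> (\<lambda>\<eta>. f (\<lambda>t. wave \<eta> t * \<psi> t))" unfolding e .
  obtain s where s: "\<And>i. simple_function \<mu> (s i)" "\<And>\<eta>. (\<lambda>i. s i \<eta>) \<longlonglongrightarrow> \<eta>"
    "\<And>i \<eta>. dist (s i \<eta>) 0 \<le> 2 * dist \<eta> 0"
  proof -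
    have id: "(\<lambda>\<eta>. \<eta>) \<in> borel_measurable \<mu>" by measurable
    from borel_measurable_implies_sequence_metric[OF id, of 0] that show ?thesis
      by (auto simp: space)
  qed
  have s_meas [measurable]: "s i \<in> borel_measurable \<mu>" for i
    by (rule borel_measurable_simple_function[OF s(1)])
  have s_norm: "norm (s i \<eta>) \<le> 2 * norm \<eta>" for i \<eta>
    using s(3)[of i \<eta>] by simp
  define \<phi> where "\<phi> = (\<lambda>t. \<integral>\<eta>. wave \<eta> t \<partial>\<mu>)"
  define w where "w i v = complex_of_real (measure \<mu> (s i -` {v} \<inter> space \<mu>))" for i v
  define h where "h i = (\<lambda>t. \<Sum>v\<in>s i ` space \<mu>. w i v * e v t)" for i
  have fin: "finite (s i ` space \<mu>)" for i
    using simple_functionD(1)[OF s(1)] .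
  have hS: "h i \<in> schwartz_space" for i
    unfolding h_def by (intro schwartz_sum schwartz_cmult fin eS)
  have fh: "f (h i) = (\<integral>\<eta>. f (e (s i \<eta>)) \<partial>\<mu>)" for i
    unfolding h_def w_def
    by (simp add: tempered_sum[OF f fin] schwartz_cmult eS tempered_cmult[OF f eS]
        integral_simple_function_compose(2)[OF \<mu> s(1), of "\<lambda>v. f (e v)"])
  \<comment> \<open>The Leibniz rule for \<open>\<phi> \<psi>\<close> has the same coefficients as that for \<open>e\<^sup>i\<^sup>t\<^sup>\<eta> \<psi>\<close>, integrated over \<open>\<eta>\<close>.\<close>
  have \<phi>\<psi>_pd: "iter_pderiv bs (\<lambda>t. \<phi> t * \<psi> t) t = (\<integral>\<eta>. iter_pderiv bs (e \<eta>) t \<partial>\<mu>)"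
    and \<phi>\<psi>_int: "integrable \<mu> (\<lambda>\<eta>. iter_pderiv bs (e \<eta>) t)"
    if bs: "set bs \<subseteq> Basis" for bs t
  proof -
    have intw: "integrable \<mu> (\<lambda>\<eta>. wave_symbol as \<eta> * wave \<eta> t * z)" if "set as \<subseteq> Basis" for as z
    proof (intro integrable_mult_left)
      show "integrable \<mu> (\<lambda>\<eta>. wave_symbol as \<eta> * wave \<eta> t)"
        by (rule Bochner_Integration.integrable_bound[OF mom[of "length as"]])
           (use norm_wave_symbol_le[OF that] in \<open>auto simp: norm_mult\<close>)
    qed
    have sub: "set (fst i) \<subseteq> Basis" "set (snd i) \<subseteq> Basis" if "i \<in> set (splits bs)" for i
      using set_splits[of "fst i" "snd i" bs] that bs by auto
    have int_list: "integrable \<mu> (\<lambda>\<eta>. \<Sum>i\<leftarrow>xs. F i \<eta>) \<and> (\<integral>\<eta>. (\<Sum>i\<leftarrow>xs. F i \<eta>) \<partial>\<mu>) = (\<Sum>i\<leftarrow>xs. \<integral>\<eta>. F i \<eta> \<partial>\<mu>)"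
      if "\<And>i. i \<in> set xs \<Longrightarrow> integrable \<mu> (F i)" for xs and F :: "'a list \<times> 'a list \<Rightarrow> 'a \<Rightarrow> complex"
      using that by (induction xs) auto
    have e_pd: "iter_pderiv bs (e \<eta>) t = (\<Sum>i\<leftarrow>splits bs. wave_symbol (fst i) \<eta> * wave \<eta> t * iter_pderiv (snd i) \<psi> t)" for \<eta>
      unfolding e_def iter_pderiv_tf_shift[OF schwartz_smooth[OF \<psi>] bs] by (simp add: case_prod_unfold)
    show "integrable \<mu> (\<lambda>\<eta>. iter_pderiv bs (e \<eta>) t)"
      unfolding e_pd by (rule int_list[THEN conjunct1]) (intro intw sub)
    have "iter_pderiv bs (\<lambda>t. \<phi> t * \<psi> t) t = (\<Sum>i\<leftarrow>splits bs. iter_pderiv (fst i) \<phi> t * iter_pderiv (snd i) \<psi> t)"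
      unfolding \<phi>_def
      by (subst iter_pderiv_mult[OF smooth_integral_wave[OF sets mom] schwartz_smooth[OF \<psi>] bs])
         (simp add: case_prod_unfold)
    also have "\<dots> = (\<Sum>i\<leftarrow>splits bs. \<integral>\<eta>. wave_symbol (fst i) \<eta> * wave \<eta> t * iter_pderiv (snd i) \<psi> t \<partial>\<mu>)"
      unfolding \<phi>_def
      by (intro arg_cong[where f = sum_list] map_cong refl)
         (simp add: iter_pderiv_integral_wave[OF sets mom] sub)
    also have "\<dots> = (\<integral>\<eta>. iter_pderiv bs (e \<eta>) t \<partial>\<mu>)"
      unfolding e_pd by (rule int_list[THEN conjunct2, symmetric]) (intro intw sub)
    finally show "iter_pderiv bs (\<lambda>t. \<phi> t * \<psi> t) t = (\<integral>\<eta>. iter_pderiv bs (e \<eta>) t \<partial>\<mu>)" .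
  qed
  have smooth_\<phi>\<psi>: "smooth (\<lambda>t. \<phi> t * \<psi> t)"
    unfolding \<phi>_def by (intro smooth_mult smooth_integral_wave[OF sets mom] schwartz_smooth[OF \<psi>])
  have h_pd: "iter_pderiv bs (h i) t = (\<integral>\<eta>. iter_pderiv bs (e (s i \<eta>)) t \<partial>\<mu>)"
    and h_int: "integrable \<mu> (\<lambda>\<eta>. iter_pderiv bs (e (s i \<eta>)) t)"
    if bs: "set bs \<subseteq> Basis" for bs i t
  proof -
    have "iter_pderiv bs (h i) t = (\<Sum>v\<in>s i ` space \<mu>. w i v * iter_pderiv bs (e v) t)"
      unfolding h_def
      by (subst iter_pderiv_sum[OF fin schwartz_cmult[OF eS] bs])
         (simp add: iter_pderiv_linear[OF schwartz_smooth[OF eS] bounded_linear_mult_right bs])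
    then show "iter_pderiv bs (h i) t = (\<integral>\<eta>. iter_pderiv bs (e (s i \<eta>)) t \<partial>\<mu>)"
      by (simp add: w_def integral_simple_function_compose(2)[OF \<mu> s(1), of "\<lambda>v. iter_pderiv bs (e v) t"])
    show "integrable \<mu> (\<lambda>\<eta>. iter_pderiv bs (e (s i \<eta>)) t)"
      by (rule integral_simple_function_compose(1)[OF \<mu> s(1)])
  qed
  have semi: "integrable \<mu> (\<lambda>\<eta>. schwartz_seminorm k bs (e \<eta> - e (s i \<eta>)))"
    and semi_lim: "(\<lambda>i. \<integral>\<eta>. schwartz_seminorm k bs (e \<eta> - e (s i \<eta>)) \<partial>\<mu>) \<longlonglongrightarrow> 0"
    if bs: "set bs \<subseteq> Basis" for k bs i
  proof -
    let ?N = "\<lambda>\<eta> \<eta>'. schwartz_seminorm k bs (e \<eta> - e \<eta>')"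
    have "continuous_on UNIV (\<lambda>(\<eta>, \<eta>'). ?N \<eta> \<eta>')"
      unfolding e_def
      using continuous_on_compose2[OF schwartz_seminorm_tf_shift_diff_continuous[OF \<psi> bs, of k], of UNIV "\<lambda>z. ((0, fst z), (0, snd z))"]
      by (simp add: continuous_intros case_prod_unfold)
    then have [measurable]: "(\<lambda>(\<eta>, \<eta>'). ?N \<eta> \<eta>') \<in> borel_measurable (borel \<Otimes>\<^sub>M borel)"
      by (subst borel_prod) (rule borel_measurable_continuous_onI)
    have meas: "(\<lambda>\<eta>. ?N \<eta> (s i \<eta>)) \<in> borel_measurable \<mu>" for i
      by measurable
    obtain D where D: "D \<ge> 0" "\<And>\<eta>. schwartz_seminorm k bs (e \<eta>) \<le> D * (1 + norm \<eta>) ^ length bs"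
    proof -
      obtain D where "D \<ge> 0"
        "\<And>x \<xi>. schwartz_seminorm k bs (tf_shift \<psi> x \<xi>) \<le> D * (1 + norm \<xi>) ^ length bs * japanese_bracket x ^ k"
        using schwartz_seminorm_tf_shift_growth[OF \<psi> bs] by metis
      from that[OF this(1)] this(2)[of 0] show ?thesis
        by (simp add: e_def japanese_bracket_def)
    qed
    have N0: "?N \<eta> \<eta>' \<ge> 0" for \<eta> \<eta>'
      by (intro schwartz_seminorm_nonneg schwartz_diff eS bs)
    have dom: "norm (?N \<eta> (s i \<eta>)) \<le> (2 * D) * (1 + 2 * norm \<eta>) ^ length bs" for i \<eta>
    proof -
      have z: "h - (\<lambda>_. 0) = h" for h :: "'a \<Rightarrow> complex" by (simp add: fun_eq_iff)
      have "?N \<eta> (s i \<eta>) \<le> schwartz_seminorm k bs (e \<eta>) + schwartz_seminorm k bs (e (s i \<eta>))"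
        using schwartz_seminorm_triangle[OF eS schwartz_zero eS bs, of k \<eta> "s i \<eta>"]
          schwartz_seminorm_minus_commute[OF eS schwartz_zero bs, of k "s i \<eta>"] by (simp add: z)
      also have "\<dots> \<le> D * (1 + norm \<eta>) ^ length bs + D * (1 + norm (s i \<eta>)) ^ length bs"
        by (intro add_mono D(2))
      also have "\<dots> \<le> D * (1 + 2 * norm \<eta>) ^ length bs + D * (1 + 2 * norm \<eta>) ^ length bs"
        using s_norm[of i \<eta>] D(1) by (intro add_mono mult_left_mono power_mono) auto
      finally show ?thesis using N0 by (simp add: algebra_simps)
    qed
    show "integrable \<mu> (\<lambda>\<eta>. ?N \<eta> (s i \<eta>))"
      by (rule Bochner_Integration.integrable_bound[OF poly_int[of "2 * D" 2 "length bs"] meas])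
         (use dom in \<open>auto intro!: AE_I2 order_trans[OF _ abs_ge_self]\<close>)
    have "(\<lambda>i. \<integral>\<eta>. ?N \<eta> (s i \<eta>) \<partial>\<mu>) \<longlonglongrightarrow> (\<integral>\<eta>. 0 \<partial>\<mu>)"
    proof (rule integral_dominated_convergence[OF _ meas poly_int[of "2 * D" 2 "length bs"]])
      show "AE \<eta> in \<mu>. (\<lambda>i. ?N \<eta> (s i \<eta>)) \<longlonglongrightarrow> 0"
      proof (rule AE_I2)
        fix \<eta>
        have "(\<lambda>i. schwartz_seminorm k bs (e (s i \<eta>) - e \<eta>)) \<longlonglongrightarrow> 0"
          unfolding e_def
          using filterlim_compose[OF schwartz_seminorm_tf_shift_continuous[OF \<psi> bs, of k "(0, \<eta>)"],
              of "\<lambda>i. (0, s i \<eta>)"] s(2)[of \<eta>]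
          by (simp add: tendsto_Pair)
        then show "(\<lambda>i. ?N \<eta> (s i \<eta>)) \<longlonglongrightarrow> 0"
          by (simp add: schwartz_seminorm_minus_commute[OF eS eS bs])
      qed
    qed (use dom in auto)
    then show "(\<lambda>i. \<integral>\<eta>. ?N \<eta> (s i \<eta>) \<partial>\<mu>) \<longlonglongrightarrow> 0" by simp
  qed
  \<comment> \<open>The Schwartz seminorms of \<open>\<phi> \<psi> - h\<^sub>i\<close> are at most integrals of seminorms, which tend to 0.\<close>
  have diff_bound: "japanese_bracket t ^ k * norm (iter_pderiv bs (\<lambda>t. \<phi> t * \<psi> t) t - iter_pderiv bs (h i) t)
      \<le> (\<integral>\<eta>. schwartz_seminorm k bs (e \<eta> - e (s i \<eta>)) \<partial>\<mu>)" if bs: "set bs \<subseteq> Basis" for k bs i t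
  proof -
    let ?d = "\<lambda>\<eta>. iter_pderiv bs (e \<eta>) t - iter_pderiv bs (e (s i \<eta>)) t"
    have "japanese_bracket t ^ k * norm (iter_pderiv bs (\<lambda>t. \<phi> t * \<psi> t) t - iter_pderiv bs (h i) t)
        = norm (\<integral>\<eta>. complex_of_real (japanese_bracket t ^ k) * ?d \<eta> \<partial>\<mu>)"
      unfolding \<phi>\<psi>_pd[OF bs] h_pd[OF bs]
      by (subst integral_mult_right_zero, subst Bochner_Integration.integral_diff[OF \<phi>\<psi>_int[OF bs] h_int[OF bs]])
         (simp add: norm_mult norm_power)
    also have "\<dots> \<le> (\<integral>\<eta>. schwartz_seminorm k bs (e \<eta> - e (s i \<eta>)) \<partial>\<mu>)"
    proof (rule Bochner_Integration.integral_norm_bound_integral)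
      show "integrable \<mu> (\<lambda>\<eta>. complex_of_real (japanese_bracket t ^ k) * ?d \<eta>)"
        by (intro integrable_mult_right Bochner_Integration.integrable_diff \<phi>\<psi>_int[OF bs] h_int[OF bs])
      show "norm (complex_of_real (japanese_bracket t ^ k) * ?d \<eta>) \<le> schwartz_seminorm k bs (e \<eta> - e (s i \<eta>))" for \<eta>
        using schwartz_seminorm_upper[OF schwartz_diff[OF eS eS] bs, of t k \<eta> "s i \<eta>"]
        by (simp add: norm_mult norm_power iter_pderiv_diff[OF schwartz_smooth[OF eS] schwartz_smooth[OF eS] bs])
    qed (rule semi[OF bs])
    finally show ?thesis .
  qed
  have \<phi>\<psi>S: "(\<lambda>t. \<phi> t * \<psi> t) \<in> schwartz_space"
  proof (rule schwartzI[OF smooth_\<phi>\<psi>], intro exI allI)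
    fix k and bs :: "'a list" and t assume bs: "set bs \<subseteq> Basis"
    have "norm (iter_pderiv bs (\<lambda>t. \<phi> t * \<psi> t) t)
       \<le> norm (iter_pderiv bs (\<lambda>t. \<phi> t * \<psi> t) t - iter_pderiv bs (h 0) t) + norm (iter_pderiv bs (h 0) t)"
      using norm_triangle_sub[of "iter_pderiv bs (\<lambda>t. \<phi> t * \<psi> t) t" "iter_pderiv bs (h 0) t"]
      by (simp add: add.commute)
    then have "japanese_bracket t ^ k * norm (iter_pderiv bs (\<lambda>t. \<phi> t * \<psi> t) t)
       \<le> japanese_bracket t ^ k * norm (iter_pderiv bs (\<lambda>t. \<phi> t * \<psi> t) t - iter_pderiv bs (h 0) t)
         + japanese_bracket t ^ k * norm (iter_pderiv bs (h 0) t)"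
      unfolding distrib_left[symmetric] by (intro mult_left_mono) auto
    then show "japanese_bracket t ^ k * norm (iter_pderiv bs (\<lambda>t. \<phi> t * \<psi> t) t)
       \<le> (\<integral>\<eta>. schwartz_seminorm k bs (e \<eta> - e (s 0 \<eta>)) \<partial>\<mu>) + schwartz_seminorm k bs (h 0)"
      using diff_bound[OF bs, of t k 0] schwartz_seminorm_upper[OF hS bs, of t k 0] by linarith
  qed
  have lim1: "(\<lambda>i. f (h i)) \<longlonglongrightarrow> f (\<lambda>t. \<phi> t * \<psi> t)"
  proof -
    obtain A C where A: "finite A" "\<And>k bs. (k, bs) \<in> A \<Longrightarrow> set bs \<subseteq> Basis" and "C \<ge> 0"
      and bd: "\<And>h. h \<in> schwartz_space \<Longrightarrow> norm (f h) \<le> C * (\<Sum>(k, bs)\<in>A. schwartz_seminorm k bs h)"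
      by (rule tempered_bound[OF f]) blast
    let ?I = "\<lambda>i kb. \<integral>\<eta>. schwartz_seminorm (fst kb) (snd kb) (e \<eta> - e (s i \<eta>)) \<partial>\<mu>"
    have "(\<lambda>i. f (\<lambda>t. \<phi> t * \<psi> t) - f (h i)) \<longlonglongrightarrow> 0"
    proof (rule Lim_null_comparison[OF always_eventually], rule allI)
      fix i
      have "norm (f (\<lambda>t. \<phi> t * \<psi> t) - f (h i)) \<le> C * (\<Sum>kb\<in>A. schwartz_seminorm (fst kb) (snd kb) ((\<lambda>t. \<phi> t * \<psi> t) - h i))"
        using bd[OF schwartz_diff[OF \<phi>\<psi>S hS]] by (simp add: tempered_diff[OF f \<phi>\<psi>S hS] case_prod_unfold)
      also have "\<dots> \<le> C * (\<Sum>kb\<in>A. ?I i kb)"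
      proof (intro mult_left_mono sum_mono schwartz_seminorm_leI \<open>C \<ge> 0\<close>)
        fix kb t assume "kb \<in> A"
        then have bs: "set (snd kb) \<subseteq> Basis" using A(2)[of "fst kb" "snd kb"] by simp
        show "japanese_bracket t ^ fst kb * norm (iter_pderiv (snd kb) ((\<lambda>t. \<phi> t * \<psi> t) - h i) t) \<le> ?I i kb"
          using diff_bound[OF bs, of t "fst kb" i]
          by (simp add: iter_pderiv_diff[OF smooth_\<phi>\<psi> schwartz_smooth[OF hS] bs])
      qed
      finally show "norm (f (\<lambda>t. \<phi> t * \<psi> t) - f (h i)) \<le> C * (\<Sum>kb\<in>A. ?I i kb)" .
    next
      have "(\<lambda>i. \<Sum>kb\<in>A. ?I i kb) \<longlonglongrightarrow> (\<Sum>kb\<in>A. 0)"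
      proof (intro tendsto_sum semi_lim)
        fix kb assume "kb \<in> A"
        then show "set (snd kb) \<subseteq> Basis" using A(2)[of "fst kb" "snd kb"] by simp
      qed
      then show "(\<lambda>i. C * (\<Sum>kb\<in>A. ?I i kb)) \<longlonglongrightarrow> 0"
        by (auto intro: tendsto_mult_right_zero)
    qed
    from tendsto_diff[OF tendsto_const[of "f (\<lambda>t. \<phi> t * \<psi> t)"] this] show ?thesis by simp
  qed
  have lim2: "(\<lambda>i. \<integral>\<eta>. f (e (s i \<eta>)) \<partial>\<mu>) \<longlonglongrightarrow> (\<integral>\<eta>. f (e \<eta>) \<partial>\<mu>)"
  proof (rule integral_dominated_convergence[OF _ _ poly_int[of C 2 m]])
    show "AE \<eta> in \<mu>. (\<lambda>i. f (e (s i \<eta>))) \<longlonglongrightarrow> f (e \<eta>)"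
      using continuous_on_tendsto_compose[OF cont s(2)] by (intro AE_I2) auto
    show "AE \<eta> in \<mu>. norm (f (e (s i \<eta>))) \<le> C * (1 + 2 * norm \<eta>) ^ m" for i
    proof (rule AE_I2)
      fix \<eta>
      have "norm (f (e (s i \<eta>))) \<le> C * (1 + norm (s i \<eta>)) ^ m" by (rule Cm)
      also have "\<dots> \<le> C * (1 + 2 * norm \<eta>) ^ m"
        using s_norm[of i \<eta>] Cm(1) by (intro mult_left_mono power_mono) auto
      finally show "norm (f (e (s i \<eta>))) \<le> C * (1 + 2 * norm \<eta>) ^ m" .
    qed
  qed measurable
  have "f (\<lambda>t. \<phi> t * \<psi> t) = (\<integral>\<eta>. f (e \<eta>) \<partial>\<mu>)"
    using LIMSEQ_unique[OF lim1] lim2 by (simp add: fh)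
  then show "f (\<lambda>t. (\<integral>\<eta>. wave \<eta> t \<partial>\<mu>) * \<psi> t) = (\<integral>\<eta>. f (\<lambda>t. wave \<eta> t * \<psi> t) \<partial>\<mu>)"
    unfolding \<phi>_def e .
qed

section \<open>The inequalities of Jensen and Minkowski\<close>

lemma ennreal_powr_ennreal [simp]: "0 \<le> a \<Longrightarrow> ennreal_powr (ennreal a) r = ennreal (a powr r)"
  by (simp add: ennreal_powr_def)

lemma ennreal_powr_0 [simp]: "ennreal_powr 0 r = 0"
  by (simp add: ennreal_powr_def)

lemma ennreal_powr_top [simp]: "ennreal_powr top r = top"
  by (simp add: ennreal_powr_def)

lemma ennreal_powr_one [simp]: "ennreal_powr x 1 = x"
  by (cases x rule: ennreal_cases) auto

lemma ennreal_powr_mono: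
  assumes "x \<le> y" "r > 0"
  shows "ennreal_powr x r \<le> ennreal_powr y r"
proof (cases y rule: ennreal_cases)
  case (real b)
  then obtain a where "x = ennreal a" "a \<ge> 0"
    using assms(1) by (cases x rule: ennreal_cases) (auto simp: top_unique)
  then show ?thesis
    using real assms by (auto intro!: ennreal_leI powr_mono2)
qed simp

lemma ennreal_powr_mult:
  assumes "r > 0"
  shows "ennreal_powr (x * y) r = ennreal_powr x r * ennreal_powr y r"
proof (cases x rule: ennreal_cases; cases y rule: ennreal_cases)
  fix a b :: real assume ab: "0 \<le> a" "x = ennreal a" "0 \<le> b" "y = ennreal b"
  then show ?thesis by (simp add: powr_mult flip: ennreal_mult)
next
  fix a :: real assume "0 \<le> a" "x = ennreal a" "y = top"
  then show ?thesis by (cases "a = 0") (simp_all add: ennreal_mult_top)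
next
  fix b :: real assume "0 \<le> b" "x = top" "y = ennreal b"
  then show ?thesis by (cases "b = 0") (simp_all add: ennreal_top_mult)
qed simp

lemma ennreal_powr_powr: "ennreal_powr (ennreal_powr x r) t = ennreal_powr x (r * t)"
  by (cases x rule: ennreal_cases) (auto simp: powr_powr)

lemma ennreal_powr_measurable [measurable (raw)]:
  assumes [measurable]: "f \<in> borel_measurable M"
  shows "(\<lambda>x. ennreal_powr (f x) r) \<in> borel_measurable M"
  unfolding ennreal_powr_def by measurable

lemma ennreal_powr_add_le:
  assumes "r > 0"
  shows "ennreal_powr (x + y) r \<le> ennreal (2 powr r) * (ennreal_powr x r + ennreal_powr y r)"
proof -
  have "x + y \<le> 2 * max x y"
    unfolding mult_2 by (intro add_mono) auto
  then have "ennreal_powr (x + y) r \<le> ennreal_powr (ennreal 2 * max x y) r"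
    using assms by (intro ennreal_powr_mono) auto
  also have "\<dots> = ennreal (2 powr r) * ennreal_powr (max x y) r"
    by (subst ennreal_powr_mult[OF assms], subst ennreal_powr_ennreal) simp_all
  also have "\<dots> \<le> ennreal (2 powr r) * (ennreal_powr x r + ennreal_powr y r)"
    by (intro mult_left_mono) (auto simp: max_def)
  finally show ?thesis .
qed

lemma ennreal_powr_tendsto_0:
  assumes "(f \<longlongrightarrow> 0) F" "r > 0"
  shows "((\<lambda>x. ennreal_powr (f x) r) \<longlongrightarrow> 0) F"
proof (rule order_tendstoI)
  fix a :: ennreal assume a: "0 < a"
  obtain b where b: "b > 0" "ennreal b < a"
  proof -
    obtain z where z: "0 < z" "z < a" using dense[OF a] by blast
    then show ?thesis
      using that by (cases z rule: ennreal_cases) (auto dest: leD)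
  qed
  have "0 < ennreal (b powr (1 / r))" using b by simp
  then have "\<forall>\<^sub>F x in F. f x < ennreal (b powr (1 / r))"
    by (rule order_tendstoD(2)[OF assms(1)])
  then show "\<forall>\<^sub>F x in F. ennreal_powr (f x) r < a"
  proof eventually_elim
    case (elim x)
    have "ennreal_powr (f x) r \<le> ennreal_powr (ennreal (b powr (1 / r))) r"
      using elim assms(2) by (intro ennreal_powr_mono) auto
    also have "\<dots> = ennreal b" using b assms(2) by (simp add: powr_powr)
    finally show ?case using b by simp
  qed
qed simp

text \<open>
  The graph of \<open>u \<mapsto> u\<^sup>p\<close> lies above its tangent at \<open>c\<close>; rearranged without subtraction, so that
  it carries over to extended nonnegative reals.
\<close>

lemma powr_tangent_le:
  fixes u c p :: real
  assumes "p \<ge> 1" "u \<ge> 0" "c > 0"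
  shows "p * c powr (p - 1) * u \<le> u powr p + (p - 1) * c powr p"
proof (cases "u = 0")
  case False
  have "(u powr p) powr (1/p) * (c powr p) powr (1 - 1/p) \<le> (1/p) * u powr p + (1 - 1/p) * c powr p"
    using assms False by (intro Youngs_inequality_0) auto
  then have "u * c powr (p - 1) \<le> (1/p) * u powr p + (1 - 1/p) * c powr p"
    using assms by (simp add: powr_powr right_diff_distrib)
  then have "p * (u * c powr (p - 1)) \<le> p * ((1/p) * u powr p + (1 - 1/p) * c powr p)"
    using assms by (intro mult_left_mono) auto
  also have "\<dots> = u powr p + (p - 1) * c powr p"
    using assms by (simp add: field_simps)
  finally show ?thesis by (simp add: mult_ac)
next
  case True
  then have "p * c powr (p - 1) * u = 0" "u powr p = 0" by simp_all
  moreover have "0 \<le> (p - 1) * c powr p" using assms by (intro mult_nonneg_nonneg) auto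
  ultimately show ?thesis by linarith
qed

lemma powr_tangent_le_ennreal:
  assumes "p \<ge> 1" "c > 0"
  shows "ennreal (p * c powr (p - 1)) * u \<le> ennreal_powr u p + ennreal ((p - 1) * c powr p)"
proof (cases u rule: ennreal_cases)
  case (real a)
  then show ?thesis
    using powr_tangent_le[OF assms(1) _ assms(2), of a] assms
    by (simp flip: ennreal_mult ennreal_plus)
qed simp

text \<open>
  Integrate the tangent inequality at the mean of \<open>u\<close>. If the mean is infinite, the tangent at 1
  already forces the right-hand side to be infinite.
\<close>

lemma (in prob_space) nn_integral_powr_Jensen:
  assumes [measurable]: "u \<in> borel_measurable M" and p: "p \<ge> 1"
  shows "ennreal_powr (\<integral>\<^sup>+x. u x \<partial>M) p \<le> (\<integral>\<^sup>+x. ennreal_powr (u x) p \<partial>M)"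
proof -
  let ?I = "\<integral>\<^sup>+x. u x \<partial>M" and ?J = "\<integral>\<^sup>+x. ennreal_powr (u x) p \<partial>M"
  have tangent: "ennreal (p * c powr (p - 1)) * ?I \<le> ?J + ennreal ((p - 1) * c powr p)" if c: "c > 0" for c
  proof -
    have "ennreal (p * c powr (p - 1)) * ?I = (\<integral>\<^sup>+x. ennreal (p * c powr (p - 1)) * u x \<partial>M)"
      by (rule nn_integral_cmult[symmetric]) measurable
    also have "\<dots> \<le> (\<integral>\<^sup>+x. ennreal_powr (u x) p + ennreal ((p - 1) * c powr p) \<partial>M)"
      by (intro nn_integral_mono powr_tangent_le_ennreal p c)
    also have "\<dots> = ?J + ennreal ((p - 1) * c powr p)"
      by (subst nn_integral_add) (auto simp: emeasure_space_1)
    finally show ?thesis .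
  qed
  show ?thesis
  proof (cases ?I rule: ennreal_cases)
    case (real a)
    show ?thesis
    proof (cases "a = 0 \<or> ?J = top")
      case False
      then have a: "a > 0" using real by simp
      obtain j where j: "?J = ennreal j" "j \<ge> 0"
        using False by (cases ?J rule: ennreal_cases) auto
      have "ennreal (p * c powr (p - 1)) * ennreal a = ennreal (p * c powr (p - 1) * a)" for c
        using p a by (simp add: ennreal_mult)
      then have "p * a powr (p - 1) * a \<le> j + (p - 1) * a powr p"
        using tangent[OF a] real j p a by (simp flip: ennreal_plus)
      moreover have "a powr (p - 1) * a = a powr p"
        using a by (simp add: powr_diff)
      ultimately have "p * a powr p \<le> j + (p - 1) * a powr p" by (simp only: mult.assoc)
      then have "a powr p \<le> j" by (simp add: left_diff_distrib)
      then show ?thesis using real j by (auto intro!: ennreal_leI)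
    qed (use real in auto)
  next
    case top
    then have "top \<le> ?J + ennreal (p - 1)"
      using tangent[of 1] p by (simp add: ennreal_mult_top)
    then have "?J = top" by (auto simp: top_unique)
    then show ?thesis by simp
  qed
qed

text \<open>
  With \<open>W = \<integral> w d\<mu>\<close>, the inner integral is the mean of \<open>g(x, \<eta>) W / w(\<eta>)\<close> for the probability measure with
  density \<open>w / W\<close>. Jensen's inequality for that measure followed by Tonelli gives the claim. Positivity
  of \<open>w\<close> makes the division legitimate; the sharp choice of \<open>w\<close>, the norm of \<open>g(\<cdot>, \<eta>)\<close>, may vanish.
\<close>

lemma Minkowski_integral_with_majorant:
  assumes \<mu>: "prob_space \<mu>" and M: "sigma_finite_measure M"
    and g [measurable]: "case_prod g \<in> borel_measurable (M \<Otimes>\<^sub>M \<mu>)"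
    and p: "p \<ge> 1" and w [measurable]: "integrable \<mu> w" and w_pos: "\<And>\<eta>. w \<eta> > 0"
    and major: "AE \<eta> in \<mu>. (\<integral>\<^sup>+x. ennreal_powr (g x \<eta>) p \<partial>M) \<le> ennreal (w \<eta> powr p)"
  shows "(\<integral>\<^sup>+x. ennreal_powr (\<integral>\<^sup>+\<eta>. g x \<eta> \<partial>\<mu>) p \<partial>M) \<le> ennreal ((\<integral>\<eta>. w \<eta> \<partial>\<mu>) powr p)"
proof -
  interpret \<mu>: prob_space \<mu> by fact
  interpret M: sigma_finite_measure M by fact
  interpret pair_sigma_finite M \<mu> ..
  have w_meas [measurable]: "w \<in> borel_measurable \<mu>" using w by auto
  define W where "W = (\<integral>\<eta>. w \<eta> \<partial>\<mu>)"
  have W: "W > 0"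
  proof -
    have "W \<ge> 0" unfolding W_def using w_pos by (intro integral_nonneg_AE) (auto intro: less_imp_le)
    moreover have "W \<noteq> 0"
    proof
      assume "W = 0"
      then have "AE \<eta> in \<mu>. w \<eta> = 0"
        unfolding W_def using integral_nonneg_eq_0_iff_AE[OF w] w_pos by (auto intro: less_imp_le)
      then have "AE \<eta> in \<mu>. False" by eventually_elim (use w_pos in \<open>auto simp: less_le\<close>)
      then show False by simp
    qed
    ultimately show ?thesis by simp
  qed
  define \<nu> where "\<nu> = density \<mu> (\<lambda>\<eta>. ennreal (w \<eta> / W))"
  have mass: "(\<integral>\<^sup>+\<eta>. ennreal (w \<eta> / W) \<partial>\<mu>) = 1"
  proof -
    have "(\<integral>\<^sup>+\<eta>. ennreal (w \<eta> / W) \<partial>\<mu>) = ennreal (\<integral>\<eta>. w \<eta> / W \<partial>\<mu>)"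
      using w w_pos W
      by (intro nn_integral_eq_integral) (auto intro!: AE_I2 divide_nonneg_nonneg less_imp_le)
    then show ?thesis using W by (simp flip: W_def)
  qed
  interpret \<nu>: prob_space \<nu>
    by (rule prob_spaceI) (simp add: \<nu>_def emeasure_density space_density mass cong: nn_integral_cong)
  have sets\<nu> [measurable_cong]: "sets \<nu> = sets \<mu>" by (simp add: \<nu>_def)
  have cancel: "ennreal (w \<eta> / W) * (y * ennreal (W / w \<eta>)) = y" for y \<eta>
  proof -
    have "ennreal (w \<eta> / W) * (y * ennreal (W / w \<eta>)) = y * (ennreal (w \<eta> / W) * ennreal (W / w \<eta>))"
      by (simp add: mult_ac)
    also have "ennreal (w \<eta> / W) * ennreal (W / w \<eta>) = 1"
      using w_pos[of \<eta>] W by (simp flip: ennreal_mult)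
    finally show ?thesis by simp
  qed
  have pointwise: "ennreal_powr (\<integral>\<^sup>+\<eta>. g x \<eta> \<partial>\<mu>) p
      \<le> (\<integral>\<^sup>+\<eta>. ennreal (w \<eta> / W) * (ennreal_powr (g x \<eta>) p * ennreal ((W / w \<eta>) powr p)) \<partial>\<mu>)"
    if x [measurable]: "x \<in> space M" for x
  proof -
    have "(\<integral>\<^sup>+\<eta>. g x \<eta> \<partial>\<mu>) = (\<integral>\<^sup>+\<eta>. g x \<eta> * ennreal (W / w \<eta>) \<partial>\<nu>)"
      unfolding \<nu>_def by (subst nn_integral_density) (simp_all add: cancel)
    then have "ennreal_powr (\<integral>\<^sup>+\<eta>. g x \<eta> \<partial>\<mu>) p \<le> (\<integral>\<^sup>+\<eta>. ennreal_powr (g x \<eta> * ennreal (W / w \<eta>)) p \<partial>\<nu>)"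
      using \<nu>.nn_integral_powr_Jensen[of "\<lambda>\<eta>. g x \<eta> * ennreal (W / w \<eta>)", OF _ p] by simp
    also have "\<dots> = (\<integral>\<^sup>+\<eta>. ennreal_powr (g x \<eta>) p * ennreal ((W / w \<eta>) powr p) \<partial>\<nu>)"
      using p w_pos W by (simp add: ennreal_powr_mult less_imp_le)
    also have "\<dots> = (\<integral>\<^sup>+\<eta>. ennreal (w \<eta> / W) * (ennreal_powr (g x \<eta>) p * ennreal ((W / w \<eta>) powr p)) \<partial>\<mu>)"
      unfolding \<nu>_def by (subst nn_integral_density) simp_all
    finally show ?thesis .
  qed
  have "(\<integral>\<^sup>+x. ennreal_powr (\<integral>\<^sup>+\<eta>. g x \<eta> \<partial>\<mu>) p \<partial>M)
      \<le> (\<integral>\<^sup>+x. \<integral>\<^sup>+\<eta>. ennreal (w \<eta> / W) * (ennreal_powr (g x \<eta>) p * ennreal ((W / w \<eta>) powr p)) \<partial>\<mu> \<partial>M)"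
    by (rule nn_integral_mono) (rule pointwise)
  also have "\<dots> = (\<integral>\<^sup>+\<eta>. \<integral>\<^sup>+x. ennreal (w \<eta> / W) * (ennreal_powr (g x \<eta>) p * ennreal ((W / w \<eta>) powr p)) \<partial>M \<partial>\<mu>)"
    by (rule Fubini'[symmetric]) measurable
  also have "\<dots> = (\<integral>\<^sup>+\<eta>. ennreal (w \<eta> / W) * ((\<integral>\<^sup>+x. ennreal_powr (g x \<eta>) p \<partial>M) * ennreal ((W / w \<eta>) powr p)) \<partial>\<mu>)"
    by (intro nn_integral_cong) (simp add: nn_integral_cmult nn_integral_multc)
  also have "\<dots> \<le> (\<integral>\<^sup>+\<eta>. ennreal (W powr p) * ennreal (w \<eta> / W) \<partial>\<mu>)"
  proof (rule nn_integral_mono_AE)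
    show "AE \<eta> in \<mu>. ennreal (w \<eta> / W) * ((\<integral>\<^sup>+x. ennreal_powr (g x \<eta>) p \<partial>M) * ennreal ((W / w \<eta>) powr p))
       \<le> ennreal (W powr p) * ennreal (w \<eta> / W)"
      using major
    proof eventually_elim
      case (elim \<eta>)
      have "ennreal (w \<eta> / W) * ((\<integral>\<^sup>+x. ennreal_powr (g x \<eta>) p \<partial>M) * ennreal ((W / w \<eta>) powr p))
        \<le> ennreal (w \<eta> / W) * (ennreal (w \<eta> powr p) * ennreal ((W / w \<eta>) powr p))"
        by (intro mult_left_mono mult_right_mono elim) auto
      also have "ennreal (w \<eta> powr p) * ennreal ((W / w \<eta>) powr p) = ennreal (W powr p)"
        using w_pos[of \<eta>] W by (simp add: powr_divide flip: ennreal_mult)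
      finally show ?case by (simp add: mult.commute)
    qed
  qed
  also have "\<dots> = ennreal (W powr p)"
    by (simp add: nn_integral_cmult mass)
  finally show ?thesis by (simp add: W_def)
qed

text \<open>
  The majorant lemma for the norm of \<open>g(\<cdot>, \<eta>)\<close> plus \<open>\<delta>\<close>, as \<open>\<delta>\<close> tends to 0.
\<close>

lemma Minkowski_integral:
  assumes \<mu>: "prob_space \<mu>" and M: "sigma_finite_measure M"
    and g [measurable]: "case_prod g \<in> borel_measurable (M \<Otimes>\<^sub>M \<mu>)"
    and p: "p \<ge> 1"
  shows "ennreal_powr (\<integral>\<^sup>+x. ennreal_powr (\<integral>\<^sup>+\<eta>. g x \<eta> \<partial>\<mu>) p \<partial>M) (1 / p)
    \<le> (\<integral>\<^sup>+\<eta>. ennreal_powr (\<integral>\<^sup>+x. ennreal_powr (g x \<eta>) p \<partial>M) (1 / p) \<partial>\<mu>)"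
proof -
  interpret \<mu>: prob_space \<mu> by fact
  interpret M: sigma_finite_measure M by fact
  interpret pair_sigma_finite M \<mu> ..
  define n where "n \<eta> = ennreal_powr (\<integral>\<^sup>+x. ennreal_powr (g x \<eta>) p \<partial>M) (1 / p)" for \<eta>
  have [measurable]: "n \<in> borel_measurable \<mu>"
  proof -
    have "(\<lambda>(\<eta>, x). ennreal_powr (g x \<eta>) p) \<in> borel_measurable (\<mu> \<Otimes>\<^sub>M M)" by measurable
    then have "(\<lambda>\<eta>. \<integral>\<^sup>+x. ennreal_powr (g x \<eta>) p \<partial>M) \<in> borel_measurable \<mu>"
      by (rule M.borel_measurable_nn_integral)
    then show ?thesis unfolding n_def by measurable
  qed
  show ?thesis unfolding n_def[symmetric]
  proof (rule ennreal_le_epsilon)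
    fix \<delta> :: real assume fin: "(\<integral>\<^sup>+\<eta>. n \<eta> \<partial>\<mu>) < top" and \<delta>: "\<delta> > 0"
    have nfin: "AE \<eta> in \<mu>. n \<eta> \<noteq> \<infinity>"
      using fin by (intro nn_integral_PInf_AE) auto
    have eq: "(\<integral>\<^sup>+\<eta>. ennreal (enn2real (n \<eta>)) \<partial>\<mu>) = (\<integral>\<^sup>+\<eta>. n \<eta> \<partial>\<mu>)"
      by (rule nn_integral_cong_AE) (use nfin in eventually_elim, simp add: less_top)
    have int: "integrable \<mu> (\<lambda>\<eta>. enn2real (n \<eta>))"
      using fin eq by (intro integrableI_nonneg) auto
    have int\<delta>: "integrable \<mu> (\<lambda>\<eta>. enn2real (n \<eta>) + \<delta>)"
      using int by auto
    have "(\<integral>\<^sup>+x. ennreal_powr (\<integral>\<^sup>+\<eta>. g x \<eta> \<partial>\<mu>) p \<partial>M) \<le> ennreal ((\<integral>\<eta>. enn2real (n \<eta>) + \<delta> \<partial>\<mu>) powr p)"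
    proof (rule Minkowski_integral_with_majorant[OF \<mu> M g p int\<delta>])
      show "AE \<eta> in \<mu>. (\<integral>\<^sup>+x. ennreal_powr (g x \<eta>) p \<partial>M) \<le> ennreal ((enn2real (n \<eta>) + \<delta>) powr p)"
        using nfin
      proof eventually_elim
        case (elim \<eta>)
        have "(\<integral>\<^sup>+x. ennreal_powr (g x \<eta>) p \<partial>M) = ennreal_powr (n \<eta>) p"
          using p by (simp add: n_def ennreal_powr_powr)
        also have "\<dots> \<le> ennreal_powr (ennreal (enn2real (n \<eta>) + \<delta>)) p"
          using elim \<delta> p by (intro ennreal_powr_mono) (auto simp: less_top)
        finally show ?case using \<delta> by (simp del: ennreal_plus)
      qed
    qed (use \<delta> in \<open>simp add: add_nonneg_pos\<close>)
    also have "(\<integral>\<eta>. enn2real (n \<eta>) + \<delta> \<partial>\<mu>) = (\<integral>\<eta>. enn2real (n \<eta>) \<partial>\<mu>) + \<delta>"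
      using int by (simp add: \<mu>.prob_space)
    finally have "ennreal_powr (\<integral>\<^sup>+x. ennreal_powr (\<integral>\<^sup>+\<eta>. g x \<eta> \<partial>\<mu>) p \<partial>M) (1 / p)
       \<le> ennreal_powr (ennreal (((\<integral>\<eta>. enn2real (n \<eta>) \<partial>\<mu>) + \<delta>) powr p)) (1 / p)"
      using p by (intro ennreal_powr_mono) auto
    also have "\<dots> = ennreal ((\<integral>\<eta>. enn2real (n \<eta>) \<partial>\<mu>) + \<delta>)"
      using p \<delta> by (simp add: powr_powr add_nonneg_nonneg)
    also have "\<dots> = (\<integral>\<^sup>+\<eta>. n \<eta> \<partial>\<mu>) + ennreal \<delta>"
      using \<delta> nn_integral_eq_integral[OF int] by (simp add: eq ennreal_plus)
    finally show "ennreal_powr (\<integral>\<^sup>+x. ennreal_powr (\<integral>\<^sup>+\<eta>. g x \<eta> \<partial>\<mu>) p \<partial>M) (1 / p) \<le> (\<integral>\<^sup>+\<eta>. n \<eta> \<partial>\<mu>) + ennreal \<delta>" .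
  qed
qed

text \<open>
  For \<open>q \<ge> p\<close> Jensen's inequality alone would suffice, but \<open>u \<mapsto> u\<close> to the power \<open>q / p\<close> is concave
  when \<open>q < p\<close>; passing through the norm, that is the power \<open>1 / p\<close>, covers both cases.
\<close>

lemma Minkowski_Jensen_integral:
  assumes \<mu>: "prob_space \<mu>" and M: "sigma_finite_measure M"
    and g [measurable]: "case_prod g \<in> borel_measurable (M \<Otimes>\<^sub>M \<mu>)"
    and p: "p \<ge> 1" and q: "q \<ge> 1"
  shows "ennreal_powr (\<integral>\<^sup>+x. ennreal_powr (\<integral>\<^sup>+\<eta>. g x \<eta> \<partial>\<mu>) p \<partial>M) (q / p)
    \<le> (\<integral>\<^sup>+\<eta>. ennreal_powr (\<integral>\<^sup>+x. ennreal_powr (g x \<eta>) p \<partial>M) (q / p) \<partial>\<mu>)"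
proof -
  interpret \<mu>: prob_space \<mu> by fact
  interpret M: sigma_finite_measure M by fact
  have meas: "(\<lambda>\<eta>. ennreal_powr (\<integral>\<^sup>+x. ennreal_powr (g x \<eta>) p \<partial>M) (1 / p)) \<in> borel_measurable \<mu>"
  proof -
    have "(\<lambda>(\<eta>, x). ennreal_powr (g x \<eta>) p) \<in> borel_measurable (\<mu> \<Otimes>\<^sub>M M)" by measurable
    then have "(\<lambda>\<eta>. \<integral>\<^sup>+x. ennreal_powr (g x \<eta>) p \<partial>M) \<in> borel_measurable \<mu>"
      by (rule M.borel_measurable_nn_integral)
    then show ?thesis by measurable
  qed
  have "ennreal_powr (\<integral>\<^sup>+x. ennreal_powr (\<integral>\<^sup>+\<eta>. g x \<eta> \<partial>\<mu>) p \<partial>M) (q / p)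
     = ennreal_powr (ennreal_powr (\<integral>\<^sup>+x. ennreal_powr (\<integral>\<^sup>+\<eta>. g x \<eta> \<partial>\<mu>) p \<partial>M) (1 / p)) q"
    by (simp add: ennreal_powr_powr)
  also have "\<dots> \<le> ennreal_powr (\<integral>\<^sup>+\<eta>. ennreal_powr (\<integral>\<^sup>+x. ennreal_powr (g x \<eta>) p \<partial>M) (1 / p) \<partial>\<mu>) q"
    using q by (intro ennreal_powr_mono Minkowski_integral[OF \<mu> M g p]) auto
  also have "\<dots> \<le> (\<integral>\<^sup>+\<eta>. ennreal_powr (ennreal_powr (\<integral>\<^sup>+x. ennreal_powr (g x \<eta>) p \<partial>M) (1 / p)) q \<partial>\<mu>)"
    by (rule \<mu>.nn_integral_powr_Jensen[OF meas q])
  finally show ?thesis by (simp add: ennreal_powr_powr)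
qed

section \<open>The weighted mixed norm\<close>

text \<open>
  The \<open>q\<close>-th power of the norm, for functions with values in the extended nonnegative reals. It is kept as a power
  because in this form it is an integral in the frequency variable.
\<close>

definition mixed_norm_powr ::
  "real \<Rightarrow> real \<Rightarrow> real \<Rightarrow> ('a::euclidean_space \<Rightarrow> 'a \<Rightarrow> ennreal) \<Rightarrow> ennreal" where
  "mixed_norm_powr p q s G = (\<integral>\<^sup>+ \<xi>. ennreal (japanese_bracket \<xi> powr (s * q)) *
     ennreal_powr (\<integral>\<^sup>+ x. ennreal_powr (G x \<xi>) p \<partial>lborel) (q / p) \<partial>lborel)"

lemma modulation_norm_eq_mixed_norm:
  "modulation_norm \<phi>0 p q s f
     = ennreal_powr (mixed_norm_powr p q s (\<lambda>x \<xi>. ennreal (norm (stft \<phi>0 f x \<xi>)))) (1 / q)"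
  by (simp add: modulation_norm_def mixed_norm_powr_def)

lemma mixed_inner_measurable:
  fixes G :: "'a::euclidean_space \<Rightarrow> 'a \<Rightarrow> ennreal"
  assumes [measurable]: "case_prod G \<in> borel_measurable (borel \<Otimes>\<^sub>M borel)"
  shows "(\<lambda>\<xi>. \<integral>\<^sup>+ x. ennreal_powr (G x \<xi>) p \<partial>lborel) \<in> borel_measurable borel"
proof -
  have "(\<lambda>(\<xi>, x). ennreal_powr (G x \<xi>) p) \<in> borel_measurable (borel \<Otimes>\<^sub>M lborel)" by measurable
  then show ?thesis by (rule lborel.borel_measurable_nn_integral)
qed

lemma mixed_norm_powr_mono:
  assumes "\<And>x \<xi>. G x \<xi> \<le> H x \<xi>" "p > 0" "q > 0"
  shows "mixed_norm_powr p q s G \<le> mixed_norm_powr p q s H"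
  unfolding mixed_norm_powr_def using assms
  by (intro nn_integral_mono mult_left_mono ennreal_powr_mono) auto

lemma mixed_norm_powr_add_le:
  assumes [measurable]: "case_prod G \<in> borel_measurable (borel \<Otimes>\<^sub>M borel)"
    "case_prod H \<in> borel_measurable (borel \<Otimes>\<^sub>M borel)"
    and p: "p > 0" and q: "q > 0"
  shows "mixed_norm_powr p q s (\<lambda>x \<xi>. G x \<xi> + H x \<xi>)
    \<le> ennreal (2 powr q * 2 powr (q / p)) * (mixed_norm_powr p q s G + mixed_norm_powr p q s H)"
proof -
  let ?w = "\<lambda>\<xi>::'a. ennreal (japanese_bracket \<xi> powr (s * q))"
  let ?I = "\<lambda>G \<xi>. \<integral>\<^sup>+ x. ennreal_powr (G x \<xi>) p \<partial>(lborel :: 'a measure)"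
  let ?K = "ennreal (2 powr q * 2 powr (q / p))"
  note [measurable] = mixed_inner_measurable[OF assms(1)] mixed_inner_measurable[OF assms(2)]
  have "ennreal_powr (?I (\<lambda>x \<xi>. G x \<xi> + H x \<xi>) \<xi>) (q / p)
      \<le> ?K * (ennreal_powr (?I G \<xi>) (q / p) + ennreal_powr (?I H \<xi>) (q / p))" for \<xi>
  proof -
    have "?I (\<lambda>x \<xi>. G x \<xi> + H x \<xi>) \<xi>
        \<le> (\<integral>\<^sup>+ x. ennreal (2 powr p) * (ennreal_powr (G x \<xi>) p + ennreal_powr (H x \<xi>) p) \<partial>lborel)"
      by (intro nn_integral_mono ennreal_powr_add_le p)
    also have "\<dots> = ennreal (2 powr p) * (?I G \<xi> + ?I H \<xi>)"
      by (subst nn_integral_cmult) (auto simp: nn_integral_add)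
    finally have "ennreal_powr (?I (\<lambda>x \<xi>. G x \<xi> + H x \<xi>) \<xi>) (q / p)
        \<le> ennreal_powr (ennreal (2 powr p) * (?I G \<xi> + ?I H \<xi>)) (q / p)"
      using p q by (intro ennreal_powr_mono) auto
    also have "\<dots> = ennreal (2 powr q) * ennreal_powr (?I G \<xi> + ?I H \<xi>) (q / p)"
      using p q by (subst ennreal_powr_mult) (auto simp: powr_powr)
    also have "\<dots> \<le> ennreal (2 powr q) * (ennreal (2 powr (q / p)) *
        (ennreal_powr (?I G \<xi>) (q / p) + ennreal_powr (?I H \<xi>) (q / p)))"
      using p q by (intro mult_left_mono ennreal_powr_add_le) auto
    finally show ?thesis by (simp add: ennreal_mult mult.assoc)
  qed
  then have "mixed_norm_powr p q s (\<lambda>x \<xi>. G x \<xi> + H x \<xi>)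
     \<le> (\<integral>\<^sup>+ \<xi>. ?w \<xi> * (?K * (ennreal_powr (?I G \<xi>) (q / p) + ennreal_powr (?I H \<xi>) (q / p))) \<partial>lborel)"
    unfolding mixed_norm_powr_def by (intro nn_integral_mono mult_left_mono) auto
  also have "\<dots> = (\<integral>\<^sup>+ \<xi>. ?K * (?w \<xi> * ennreal_powr (?I G \<xi>) (q / p) + ?w \<xi> * ennreal_powr (?I H \<xi>) (q / p)) \<partial>lborel)"
    by (simp only: distrib_left mult.left_commute)
  also have "\<dots> = ?K * (mixed_norm_powr p q s G + mixed_norm_powr p q s H)"
    unfolding mixed_norm_powr_def by (subst nn_integral_cmult) (auto simp: nn_integral_add)
  finally show ?thesis .
qed

lemma japanese_bracket_powr_add_le:
  "japanese_bracket (\<xi> + \<eta>) powr r \<le> (sqrt 2 * japanese_bracket \<eta>) powr \<bar>r\<bar> * japanese_bracket \<xi> powr r"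
proof (cases "r \<ge> 0")
  case True
  have "japanese_bracket (\<xi> + \<eta>) powr r \<le> ((sqrt 2 * japanese_bracket \<eta>) * japanese_bracket \<xi>) powr r"
    using True japanese_bracket_add_le[of \<xi> \<eta>] by (intro powr_mono2) (auto simp: mult_ac)
  then show ?thesis using True by (simp add: powr_mult)
next
  case False
  have jb: "japanese_bracket \<xi> > 0" "japanese_bracket (\<xi> + \<eta>) > 0" "sqrt 2 * japanese_bracket \<eta> > 0"
    by (auto simp: japanese_bracket_pos)
  have "japanese_bracket \<xi> \<le> (sqrt 2 * japanese_bracket \<eta>) * japanese_bracket (\<xi> + \<eta>)"
    using japanese_bracket_add_le[of "\<xi> + \<eta>" "- \<eta>"] by (simp add: mult_ac)
  then have "((sqrt 2 * japanese_bracket \<eta>) * japanese_bracket (\<xi> + \<eta>)) powr r \<le> japanese_bracket \<xi> powr r"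
    using False jb by (intro powr_mono2') auto
  then have "(sqrt 2 * japanese_bracket \<eta>) powr r * japanese_bracket (\<xi> + \<eta>) powr r \<le> japanese_bracket \<xi> powr r"
    using jb by (simp only: powr_mult less_imp_le)
  then have "(sqrt 2 * japanese_bracket \<eta>) powr (- r) * ((sqrt 2 * japanese_bracket \<eta>) powr r * japanese_bracket (\<xi> + \<eta>) powr r)
     \<le> (sqrt 2 * japanese_bracket \<eta>) powr (- r) * japanese_bracket \<xi> powr r"
    by (intro mult_left_mono) auto
  moreover have "(sqrt 2 * japanese_bracket \<eta>) powr (- r) * ((sqrt 2 * japanese_bracket \<eta>) powr r * z) = z" for z
    using japanese_bracket_pos[of \<eta>] by (simp only: mult.assoc[symmetric] powr_add[symmetric]) simp
  ultimately show ?thesis using False by simp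
qed

lemma mixed_norm_powr_translate_le:
  fixes G :: "'a::euclidean_space \<Rightarrow> 'a \<Rightarrow> ennreal"
  assumes G [measurable]: "case_prod G \<in> borel_measurable (borel \<Otimes>\<^sub>M borel)"
  shows "mixed_norm_powr p q s (\<lambda>x \<xi>. G x (\<xi> - \<eta>))
    \<le> ennreal ((sqrt 2 * japanese_bracket \<eta>) powr \<bar>s * q\<bar>) * mixed_norm_powr p q s G"
proof -
  let ?w = "\<lambda>\<xi>::'a. ennreal (japanese_bracket \<xi> powr (s * q))"
  let ?c = "ennreal ((sqrt 2 * japanese_bracket \<eta>) powr \<bar>s * q\<bar>)"
  define \<Phi> where "\<Phi> \<xi> = ennreal_powr (\<integral>\<^sup>+ x. ennreal_powr (G x \<xi>) p \<partial>lborel) (q / p)" for \<xi>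
  note [measurable] = mixed_inner_measurable[OF G]
  have \<Phi> [measurable]: "\<Phi> \<in> borel_measurable borel" unfolding \<Phi>_def by measurable
  have "mixed_norm_powr p q s (\<lambda>x \<xi>. G x (\<xi> - \<eta>)) = (\<integral>\<^sup>+ \<xi>. ?w \<xi> * \<Phi> (\<xi> - \<eta>) \<partial>lborel)"
    by (simp add: mixed_norm_powr_def \<Phi>_def)
  also have "\<dots> = (\<integral>\<^sup>+ \<xi>. ?w \<xi> * \<Phi> (\<xi> - \<eta>) \<partial>distr lborel borel ((+) \<eta>))"
    by (simp add: lborel_distr_plus)
  also have "\<dots> = (\<integral>\<^sup>+ \<xi>. ?w (\<xi> + \<eta>) * \<Phi> \<xi> \<partial>lborel)"
    by (subst nn_integral_distr) (simp_all add: add.commute)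
  also have "\<dots> \<le> (\<integral>\<^sup>+ \<xi>. ?c * (?w \<xi> * \<Phi> \<xi>) \<partial>lborel)"
  proof (rule nn_integral_mono)
    fix \<xi>
    have "?w (\<xi> + \<eta>) \<le> ?c * ?w \<xi>"
      using japanese_bracket_powr_add_le[of \<xi> \<eta> "s * q"] by (simp flip: ennreal_mult)
    then show "?w (\<xi> + \<eta>) * \<Phi> \<xi> \<le> ?c * (?w \<xi> * \<Phi> \<xi>)"
      by (simp add: mult.assoc[symmetric] mult_right_mono)
  qed
  also have "\<dots> = ?c * mixed_norm_powr p q s G"
    by (subst nn_integral_cmult) (auto simp: mixed_norm_powr_def \<Phi>_def)
  finally show ?thesis .
qed

lemma mixed_inner_parameter_measurable:
  fixes g :: "'a::euclidean_space \<Rightarrow> 'a \<Rightarrow> 'a \<Rightarrow> ennreal"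
  assumes g: "(\<lambda>(x, \<xi>, \<eta>). g x \<xi> \<eta>) \<in> borel_measurable (borel \<Otimes>\<^sub>M borel \<Otimes>\<^sub>M borel)"
  shows "(\<lambda>(\<xi>, \<eta>). \<integral>\<^sup>+x. ennreal_powr (g x \<xi> \<eta>) p \<partial>lborel) \<in> borel_measurable (borel \<Otimes>\<^sub>M borel)"
proof -
  have "(\<lambda>z. (snd z, fst (fst z), snd (fst z))) \<in> (borel \<Otimes>\<^sub>M borel) \<Otimes>\<^sub>M lborel \<rightarrow>\<^sub>M borel \<Otimes>\<^sub>M borel \<Otimes>\<^sub>M borel"
    by measurable
  from measurable_compose[OF this g]
  have [measurable]: "(\<lambda>z. g (snd z) (fst (fst z)) (snd (fst z))) \<in> borel_measurable ((borel \<Otimes>\<^sub>M borel) \<Otimes>\<^sub>M lborel)"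
    by (simp add: case_prod_unfold)
  have "(\<lambda>z. ennreal_powr (g (snd z) (fst (fst z)) (snd (fst z))) p)
      \<in> borel_measurable ((borel \<Otimes>\<^sub>M borel) \<Otimes>\<^sub>M lborel)"
    by measurable
  from lborel.borel_measurable_nn_integral_fst[OF this] show ?thesis
    by (simp add: case_prod_unfold)
qed

lemma mixed_norm_powr_measurable:
  fixes g :: "'a::euclidean_space \<Rightarrow> 'a \<Rightarrow> 'a \<Rightarrow> ennreal"
  assumes g: "(\<lambda>(x, \<xi>, \<eta>). g x \<xi> \<eta>) \<in> borel_measurable (borel \<Otimes>\<^sub>M borel \<Otimes>\<^sub>M borel)"
  shows "(\<lambda>\<eta>. mixed_norm_powr p q s (\<lambda>x \<xi>. g x \<xi> \<eta>)) \<in> borel_measurable borel"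
proof -
  note [measurable] = mixed_inner_parameter_measurable[OF g]
  have "(\<lambda>(\<eta>, \<xi>). ennreal (japanese_bracket \<xi> powr (s * q))
      * ennreal_powr (\<integral>\<^sup>+x. ennreal_powr (g x \<xi> \<eta>) p \<partial>lborel) (q / p)) \<in> borel_measurable (borel \<Otimes>\<^sub>M lborel)"
    by measurable
  then show ?thesis
    unfolding mixed_norm_powr_def by (rule lborel.borel_measurable_nn_integral)
qed

text \<open>
  Minkowski's inequality in \<open>x\<close> and Jensen's in \<open>\<xi>\<close>: a probability average of functions has a
  mixed norm whose \<open>q\<close>-th power is at most the average of the \<open>q\<close>-th powers.
\<close>

lemma mixed_norm_powr_integral_le:
  fixes g :: "'a::euclidean_space \<Rightarrow> 'a \<Rightarrow> 'a \<Rightarrow> ennreal"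
  assumes \<mu>: "prob_space \<mu>" and sets: "sets \<mu> = sets borel"
    and g [measurable]: "(\<lambda>(x, \<xi>, \<eta>). g x \<xi> \<eta>) \<in> borel_measurable (borel \<Otimes>\<^sub>M borel \<Otimes>\<^sub>M borel)"
    and p: "p \<ge> 1" and q: "q \<ge> 1"
  shows "mixed_norm_powr p q s (\<lambda>x \<xi>. \<integral>\<^sup>+\<eta>. g x \<xi> \<eta> \<partial>\<mu>) \<le> (\<integral>\<^sup>+\<eta>. mixed_norm_powr p q s (\<lambda>x \<xi>. g x \<xi> \<eta>) \<partial>\<mu>)"
proof -
  interpret \<mu>: prob_space \<mu> by fact
  interpret pair_sigma_finite "lborel :: 'a measure" \<mu> ..
  note [measurable_cong] = sets
  let ?w = "\<lambda>\<xi>::'a. ennreal (japanese_bracket \<xi> powr (s * q))"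
  note [measurable] = mixed_inner_parameter_measurable[OF g]
  have [measurable]: "(\<lambda>(x, \<eta>). g x \<xi> \<eta>) \<in> borel_measurable (lborel \<Otimes>\<^sub>M \<mu>)" for \<xi>
  proof -
    have "(\<lambda>z. (fst z, \<xi>, snd z)) \<in> lborel \<Otimes>\<^sub>M \<mu> \<rightarrow>\<^sub>M borel \<Otimes>\<^sub>M borel \<Otimes>\<^sub>M borel" by measurable
    from measurable_compose[OF this g] show ?thesis by (simp add: case_prod_unfold)
  qed
  have "mixed_norm_powr p q s (\<lambda>x \<xi>. \<integral>\<^sup>+\<eta>. g x \<xi> \<eta> \<partial>\<mu>)
     \<le> (\<integral>\<^sup>+\<xi>. ?w \<xi> * (\<integral>\<^sup>+\<eta>. ennreal_powr (\<integral>\<^sup>+x. ennreal_powr (g x \<xi> \<eta>) p \<partial>lborel) (q / p) \<partial>\<mu>) \<partial>lborel)"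
    unfolding mixed_norm_powr_def
    by (intro nn_integral_mono mult_left_mono Minkowski_Jensen_integral \<mu> sigma_finite_lborel p q) auto
  also have "\<dots> = (\<integral>\<^sup>+\<xi>. \<integral>\<^sup>+\<eta>. ?w \<xi> * ennreal_powr (\<integral>\<^sup>+x. ennreal_powr (g x \<xi> \<eta>) p \<partial>lborel) (q / p) \<partial>\<mu> \<partial>lborel)"
    by (simp add: nn_integral_cmult)
  also have "\<dots> = (\<integral>\<^sup>+\<eta>. \<integral>\<^sup>+\<xi>. ?w \<xi> * ennreal_powr (\<integral>\<^sup>+x. ennreal_powr (g x \<xi> \<eta>) p \<partial>lborel) (q / p) \<partial>lborel \<partial>\<mu>)"
    by (rule Fubini'[symmetric]) measurable
  finally show "mixed_norm_powr p q s (\<lambda>x \<xi>. \<integral>\<^sup>+\<eta>. g x \<xi> \<eta> \<partial>\<mu>) \<le> (\<integral>\<^sup>+\<eta>. mixed_norm_powr p q s (\<lambda>x \<xi>. g x \<xi> \<eta>) \<partial>\<mu>)"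
    unfolding mixed_norm_powr_def .
qed

section \<open>Continuity of translation in the frequency variable\<close>

lemma cball_borel [measurable]: "cball (a :: 'a::euclidean_space) r \<in> sets borel"
  by (intro borel_closed closed_cball)

text \<open>
  A ball has finite measure and the weight is bounded on it. The constant is the same for all \<open>\<delta>\<close>, so
  small \<open>\<delta>\<close> makes the norm small for a fixed box.
\<close>

lemma mixed_norm_powr_indicator_box:
  fixes M :: real
  assumes p: "p > 0" and q: "q > 0"
  shows "\<exists>B\<ge>0. \<forall>\<delta>\<ge>0. mixed_norm_powr p q s
     (\<lambda>x \<xi>::'a::euclidean_space. ennreal \<delta> * indicator (cball 0 M) x * indicator (cball 0 M) \<xi>) \<le> ennreal (B * \<delta> powr q)"
proof -
  let ?w = "\<lambda>\<xi>::'a. ennreal (japanese_bracket \<xi> powr (s * q))"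
  define v where "v = measure lborel (cball (0::'a) M)"
  have v: "emeasure lborel (cball (0::'a) M) = ennreal v" "v \<ge> 0"
    unfolding v_def using emeasure_lborel_cball_finite[of "0::'a" M]
    by (auto intro!: emeasure_eq_ennreal_measure)
  have "compact ((\<lambda>\<xi>::'a. japanese_bracket \<xi> powr (s * q)) ` cball 0 M)"
    using japanese_bracket_pos
    by (intro compact_continuous_image continuous_intros compact_cball) (auto simp: less_le)
  then obtain W where W: "\<And>\<xi>::'a. \<xi> \<in> cball 0 M \<Longrightarrow> japanese_bracket \<xi> powr (s * q) \<le> W"
    using compact_imp_bounded[THEN bounded_imp_bdd_above] unfolding bdd_above_def by (metis image_eqI)
  define B where "B = max 0 W * v powr (q / p) * v"
  have "mixed_norm_powr p q s (\<lambda>x \<xi>::'a. ennreal \<delta> * indicator (cball 0 M) x * indicator (cball 0 M) \<xi>) \<le> ennreal (B * \<delta> powr q)"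
    if \<delta>: "\<delta> \<ge> 0" for \<delta>
  proof -
    have inner: "(\<integral>\<^sup>+ x. ennreal_powr (ennreal \<delta> * indicator (cball 0 M) x * indicator (cball 0 M) \<xi>) p \<partial>(lborel :: 'a measure))
       = ennreal (\<delta> powr p * v) * indicator (cball 0 M) \<xi>" for \<xi> :: 'a
    proof -
      have "(\<integral>\<^sup>+ x. ennreal_powr (ennreal \<delta> * indicator (cball 0 M) x * indicator (cball 0 M) \<xi>) p \<partial>(lborel :: 'a measure))
        = (\<integral>\<^sup>+ x. (ennreal (\<delta> powr p) * indicator (cball 0 M) \<xi>) * indicator (cball 0 M) x \<partial>(lborel :: 'a measure))"
        using \<delta> by (intro nn_integral_cong) (auto split: split_indicator)
      also have "\<dots> = (ennreal (\<delta> powr p) * indicator (cball 0 M) \<xi>) * ennreal v"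
        by (subst nn_integral_cmult_indicator) (auto simp: v)
      finally show ?thesis using v(2) by (simp add: ennreal_mult mult_ac)
    qed
    have "mixed_norm_powr p q s (\<lambda>x \<xi>::'a. ennreal \<delta> * indicator (cball 0 M) x * indicator (cball 0 M) \<xi>)
       \<le> (\<integral>\<^sup>+ \<xi>. ennreal (max 0 W * (\<delta> powr p * v) powr (q / p)) * indicator (cball 0 M) \<xi> \<partial>(lborel :: 'a measure))"
      unfolding mixed_norm_powr_def inner
    proof (rule nn_integral_mono)
      fix \<xi> :: 'a
      show "?w \<xi> * ennreal_powr (ennreal (\<delta> powr p * v) * indicator (cball 0 M) \<xi>) (q / p)
        \<le> ennreal (max 0 W * (\<delta> powr p * v) powr (q / p)) * indicator (cball 0 M) \<xi>"
      proof (cases "\<xi> \<in> cball 0 M")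
        case True
        have "japanese_bracket \<xi> powr (s * q) * (\<delta> powr p * v) powr (q / p) \<le> max 0 W * (\<delta> powr p * v) powr (q / p)"
          using W[OF True] by (intro mult_right_mono) auto
        then show ?thesis
          using True v(2) by (auto simp: ennreal_leI simp flip: ennreal_mult)
      qed simp
    qed
    also have "\<dots> = ennreal (max 0 W * (\<delta> powr p * v) powr (q / p)) * ennreal v"
      by (subst nn_integral_cmult_indicator) (auto simp: v)
    also have "\<dots> = ennreal (B * \<delta> powr q)"
      using p v(2) \<delta> by (simp add: B_def powr_mult powr_powr mult_ac flip: ennreal_mult)
    finally show ?thesis .
  qed
  moreover have "B \<ge> 0" using v(2) by (simp add: B_def)
  ultimately show ?thesis by blast
qed

text \<open>
  Dominated convergence in \<open>x\<close> for almost every \<open>\<xi>\<close>, then in \<open>\<xi>\<close>.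
\<close>

lemma mixed_norm_powr_tail_tendsto_0:
  fixes F :: "'a::euclidean_space \<Rightarrow> 'a \<Rightarrow> ennreal"
  assumes F [measurable]: "case_prod F \<in> borel_measurable (borel \<Otimes>\<^sub>M borel)"
    and fin: "mixed_norm_powr p q s F < \<infinity>" and Ffin: "\<And>x \<xi>. F x \<xi> < \<infinity>" and p: "p > 0" and q: "q > 0"
  shows "(\<lambda>M::nat. mixed_norm_powr p q s
      (\<lambda>x \<xi>. F x \<xi> * (1 - indicator (cball 0 M) x * indicator (cball 0 M) \<xi>))) \<longlonglongrightarrow> 0"
proof -
  let ?w = "\<lambda>\<xi>::'a. ennreal (japanese_bracket \<xi> powr (s * q))"
  let ?E = "\<lambda>M::nat. \<lambda>x \<xi>. F x \<xi> * (1 - indicator (cball 0 M) x * indicator (cball 0 M) \<xi>)"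
  let ?I = "\<lambda>G \<xi>. \<integral>\<^sup>+ x. ennreal_powr (G x \<xi>) p \<partial>(lborel :: 'a measure)"
  have E_le: "?E M x \<xi> \<le> F x \<xi>" for M x \<xi>
    using mult_left_mono[of "1 - indicator (cball 0 (real M)) x * indicator (cball 0 (real M)) \<xi>" 1 "F x \<xi>"]
    by (simp add: diff_le_self_ennreal)
  have E_meas [measurable]: "case_prod (?E M) \<in> borel_measurable (borel \<Otimes>\<^sub>M borel)" for M
    by measurable
  note [measurable] = mixed_inner_measurable[OF F] mixed_inner_measurable[OF E_meas]
  have tot: "(\<integral>\<^sup>+ \<xi>. ?w \<xi> * ennreal_powr (?I F \<xi>) (q / p) \<partial>lborel) < \<infinity>"
    using fin by (simp add: mixed_norm_powr_def)
  have "(\<lambda>M. \<integral>\<^sup>+ \<xi>. ?w \<xi> * ennreal_powr (?I (?E M) \<xi>) (q / p) \<partial>lborel) \<longlonglongrightarrow> (\<integral>\<^sup>+ \<xi>. 0 \<partial>(lborel :: 'a measure))"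
  proof (rule nn_integral_dominated_convergence[OF _ _ _ _ tot])
    show "AE \<xi> in lborel. ?w \<xi> * ennreal_powr (?I (?E M) \<xi>) (q / p) \<le> ?w \<xi> * ennreal_powr (?I F \<xi>) (q / p)" for M
      using p q by (intro AE_I2 mult_left_mono ennreal_powr_mono nn_integral_mono E_le) auto
    have "AE \<xi> in lborel. ?w \<xi> * ennreal_powr (?I F \<xi>) (q / p) \<noteq> \<infinity>"
      using tot by (intro nn_integral_PInf_AE) auto
    then show "AE \<xi> in lborel. (\<lambda>M. ?w \<xi> * ennreal_powr (?I (?E M) \<xi>) (q / p)) \<longlonglongrightarrow> 0"
    proof eventually_elim
      case (elim \<xi>)
      have I_fin: "?I F \<xi> < \<infinity>"
      proof (rule ccontr)
        assume "\<not> ?I F \<xi> < \<infinity>"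
        then have "ennreal_powr (?I F \<xi>) (q / p) = top" by (simp add: less_top[symmetric])
        then show False
          using elim japanese_bracket_pos[of \<xi>] by (simp add: ennreal_mult_top)
      qed
      have "(\<lambda>M. ?I (?E M) \<xi>) \<longlonglongrightarrow> (\<integral>\<^sup>+ x. 0 \<partial>(lborel :: 'a measure))"
      proof (rule nn_integral_dominated_convergence[OF _ _ _ _ I_fin])
        show "AE x in lborel. ennreal_powr (?E M x \<xi>) p \<le> ennreal_powr (F x \<xi>) p" for M
          using p by (intro AE_I2 ennreal_powr_mono E_le)
        show "AE x in lborel. (\<lambda>M. ennreal_powr (?E M x \<xi>) p) \<longlonglongrightarrow> 0"
        proof (rule AE_I2)
          fix x :: 'a
          obtain N :: nat where N: "norm x \<le> N" "norm \<xi> \<le> N"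
            using real_arch_simple[of "max (norm x) (norm \<xi>)"] by auto
          have "\<forall>\<^sub>F M in sequentially. ennreal_powr (?E M x \<xi>) p = 0"
            using eventually_ge_at_top[of N]
          proof eventually_elim
            case (elim M)
            then have "x \<in> cball 0 (real M)" "\<xi> \<in> cball 0 (real M)" using N by auto
            then show ?case by simp
          qed
          then show "(\<lambda>M. ennreal_powr (?E M x \<xi>) p) \<longlonglongrightarrow> 0"
            by (rule tendsto_eventually)
        qed
      qed measurable
      then have "(\<lambda>M. ennreal_powr (?I (?E M) \<xi>) (q / p)) \<longlonglongrightarrow> 0"
        using p q by (intro ennreal_powr_tendsto_0) auto
      from ennreal_tendsto_cmult[OF _ this, of "?w \<xi>"] show ?case by simp
    qed
  qed measurable
  then show ?thesis by (simp add: mixed_norm_powr_def)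
qed

context
  fixes F :: "'a::euclidean_space \<Rightarrow> 'a \<Rightarrow> complex" and p q s :: real
  assumes F_cont: "continuous_on UNIV (\<lambda>z. F (fst z) (snd z))"
    and F_fin: "mixed_norm_powr p q s (\<lambda>x \<xi>. ennreal (norm (F x \<xi>))) < \<infinity>"
    and p: "p \<ge> 1" and q: "q \<ge> 1"
begin

lemma F_measurable [measurable (raw)]:
  assumes [measurable]: "a \<in> borel_measurable N" "b \<in> borel_measurable N"
  shows "(\<lambda>z. F (a z) (b z)) \<in> borel_measurable N"
proof -
  have "(\<lambda>z. F (fst z) (snd z)) \<in> borel_measurable (borel \<Otimes>\<^sub>M borel)"
    using F_cont by (subst borel_prod) (rule borel_measurable_continuous_onI)
  from measurable_compose[OF _ this, of "\<lambda>z. (a z, b z)"] show ?thesis by simp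
qed

text \<open>
  It plays the role of a modulus of continuity of \<open>F\<close> in the frequency variable, measured by the
  \<open>q\<close>-th power of the weighted mixed norm.
\<close>

definition freq_modulus :: "'a \<Rightarrow> ennreal" where
  "freq_modulus \<eta> = mixed_norm_powr p q s (\<lambda>x \<xi>. ennreal (norm (F x \<xi> - F x (\<xi> - \<eta>))))"

lemma freq_modulus_le:
  "freq_modulus \<eta> \<le> ennreal (2 powr q * 2 powr (q / p)) *
     ((1 + ennreal ((sqrt 2 * japanese_bracket \<eta>) powr \<bar>s * q\<bar>)) * mixed_norm_powr p q s (\<lambda>x \<xi>. ennreal (norm (F x \<xi>))))"
proof -
  let ?N = "mixed_norm_powr p q s"
  let ?K = "ennreal (2 powr q * 2 powr (q / p))"
  let ?T = "ennreal ((sqrt 2 * japanese_bracket \<eta>) powr \<bar>s * q\<bar>)"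
  have "freq_modulus \<eta> \<le> ?N (\<lambda>x \<xi>. ennreal (norm (F x \<xi>)) + ennreal (norm (F x (\<xi> - \<eta>))))"
    unfolding freq_modulus_def using p q
    by (intro mixed_norm_powr_mono) (auto simp: ennreal_leI norm_triangle_ineq4 simp flip: ennreal_plus)
  also have "\<dots> \<le> ?K * (?N (\<lambda>x \<xi>. ennreal (norm (F x \<xi>))) + ?N (\<lambda>x \<xi>. ennreal (norm (F x (\<xi> - \<eta>)))))"
    using p q by (intro mixed_norm_powr_add_le) auto
  also have "?N (\<lambda>x \<xi>. ennreal (norm (F x (\<xi> - \<eta>)))) \<le> ?T * ?N (\<lambda>x \<xi>. ennreal (norm (F x \<xi>)))"
    using mixed_norm_powr_translate_le[of "\<lambda>x \<xi>. ennreal (norm (F x \<xi>))" p q s \<eta>] by simp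
  finally show ?thesis by (simp add: distrib_right add_left_mono mult_left_mono)
qed

lemma freq_modulus_measurable [measurable]: "freq_modulus \<in> borel_measurable borel"
proof -
  have g: "(\<lambda>(x, \<xi>, \<eta>). ennreal (norm (F x \<xi> - F x (\<xi> - \<eta>)))) \<in> borel_measurable (borel \<Otimes>\<^sub>M borel \<Otimes>\<^sub>M borel)"
    unfolding case_prod_unfold by measurable
  show ?thesis
    unfolding freq_modulus_def[abs_def] by (rule mixed_norm_powr_measurable[OF g])
qed

text \<open>
  Inside a large box the difference \<open>F(x, \<xi>) - F(x, \<xi> - \<eta>)\<close> is uniformly small by uniform continuity.
  Outside it, the difference is bounded by the tail of \<open>F\<close> and by the translate of that tail; the
  box has radius \<open>M + 1\<close> so that a point outside it stays outside the box of radius \<open>M\<close>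
  after a shift by \<open>\<bar>\<eta>\<bar> < 1\<close>.
\<close>

lemma freq_modulus_tendsto_0:
  assumes e: "e > 0"
  shows "\<exists>r>0. \<forall>\<eta>. norm \<eta> < r \<longrightarrow> freq_modulus \<eta> \<le> ennreal e"
proof -
  let ?N = "mixed_norm_powr p q s :: ('a \<Rightarrow> 'a \<Rightarrow> ennreal) \<Rightarrow> ennreal"
  define K where "K = 2 powr q * 2 powr (q / p)"
  define T where "T = (sqrt 2 * 2) powr \<bar>s * q\<bar>"
  have K: "K > 0" and T: "T \<ge> 0" by (simp_all add: K_def T_def)
  \<comment> \<open>The constant that makes the tail terms add up to \<open>e / 2\<close>, with the quasi-triangle inequality used twice.\<close>
  define c where "c = e / (2 * (K * (K * (1 + T))))"
  have c: "c > 0" using K T e by (simp add: c_def)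
  let ?E = "\<lambda>M::nat. \<lambda>x \<xi>. ennreal (norm (F x \<xi>)) * (1 - indicator (cball 0 M) x * indicator (cball 0 M) \<xi>)"
  have E_meas [measurable]: "case_prod (?E M) \<in> borel_measurable (borel \<Otimes>\<^sub>M borel)" for M
    by measurable
  have "(\<lambda>M. ?N (?E M)) \<longlonglongrightarrow> 0"
    by (rule mixed_norm_powr_tail_tendsto_0[OF _ F_fin]) (use p q in auto)
  then have "\<forall>\<^sub>F M in sequentially. ?N (?E M) < ennreal c"
    by (rule order_tendstoD) (use c in auto)
  then obtain M where M: "?N (?E M) < ennreal c"
    using eventually_happens'[OF sequentially_bot] by blast
  let ?M1 = "real M + 1"
  obtain B where B: "B \<ge> 0" "\<And>\<delta>. \<delta> \<ge> 0 \<Longrightarrow> ?N (\<lambda>x \<xi>. ennreal \<delta> * indicator (cball 0 ?M1) x * indicator (cball 0 ?M1) \<xi>) \<le> ennreal (B * \<delta> powr q)"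
    using mixed_norm_powr_indicator_box[of p q s ?M1, where 'a = 'a] p q by auto
  \<comment> \<open>The oscillation on the box for which the inner part contributes at most \<open>e / 2\<close>.\<close>
  define \<delta> where "\<delta> = (e / (2 * K * (B + 1))) powr (1 / q)"
  have \<delta>: "\<delta> > 0" using e K B by (simp add: \<delta>_def)
  have K\<delta>: "K * (B * \<delta> powr q) \<le> e / 2"
  proof -
    have "\<delta> powr q = e / (2 * K * (B + 1))" using e K B q by (simp add: \<delta>_def powr_powr)
    then have "K * (B * \<delta> powr q) = (e / 2) * (B / (B + 1))" using K by simp
    also have "\<dots> \<le> (e / 2) * 1" using e B by (intro mult_left_mono) auto
    finally show ?thesis by simp
  qed
  have "uniformly_continuous_on (cball 0 ?M1 \<times> cball 0 (?M1 + 1)) (\<lambda>z. F (fst z) (snd z))"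
    by (intro compact_uniformly_continuous compact_Times compact_cball continuous_on_subset[OF F_cont]) simp
  then obtain r where r: "r > 0" and uc: "\<And>z z'. z \<in> cball 0 ?M1 \<times> cball 0 (?M1 + 1) \<Longrightarrow>
      z' \<in> cball 0 ?M1 \<times> cball 0 (?M1 + 1) \<Longrightarrow> dist z' z < r \<Longrightarrow> dist (F (fst z') (snd z')) (F (fst z) (snd z)) < \<delta>"
    using \<delta> unfolding uniformly_continuous_on_def by meson
  have "freq_modulus \<eta> \<le> ennreal e" if \<eta>: "norm \<eta> < min r 1" for \<eta>
  proof -
    have \<eta>1: "norm \<eta> < 1" "norm \<eta> < r" using \<eta> by auto
    let ?D = "\<lambda>x \<xi>. ennreal \<delta> * indicator (cball 0 ?M1) x * indicator (cball 0 ?M1) \<xi> :: ennreal"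
    have pt: "ennreal (norm (F x \<xi> - F x (\<xi> - \<eta>))) \<le> ?D x \<xi> + (?E M x \<xi> + ?E M x (\<xi> - \<eta>))" for x \<xi>
    proof (cases "x \<in> cball 0 ?M1 \<and> \<xi> \<in> cball 0 ?M1")
      case True
      have "norm (\<xi> - \<eta>) \<le> ?M1 + 1"
        using True \<eta>1 norm_triangle_ineq4[of \<xi> \<eta>] by simp
      then have "dist (F x (\<xi> - \<eta>)) (F x \<xi>) < \<delta>"
        using uc[of "(x, \<xi>)" "(x, \<xi> - \<eta>)"] True \<eta>1 norm_minus_commute[of \<xi> \<eta>] by (simp add: dist_Pair_Pair dist_norm)
      then have "ennreal (norm (F x \<xi> - F x (\<xi> - \<eta>))) \<le> ennreal \<delta>"
        by (intro ennreal_leI) (simp add: dist_norm norm_minus_commute)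
      then show ?thesis using True by (simp add: add_increasing2)
    next
      case False
      have "norm \<xi> \<le> norm (\<xi> - \<eta>) + norm \<eta>" using norm_triangle_sub[of \<xi> \<eta>] by (simp add: add.commute)
      then have 1: "\<not> (x \<in> cball 0 (real M) \<and> \<xi> \<in> cball 0 (real M))"
        and 2: "\<not> (x \<in> cball 0 (real M) \<and> \<xi> - \<eta> \<in> cball 0 (real M))"
        using False \<eta>1 by auto
      have "indicator (cball 0 (real M)) x * indicator (cball 0 (real M)) \<xi> = (0 :: ennreal)"
        "indicator (cball 0 (real M)) x * indicator (cball 0 (real M)) (\<xi> - \<eta>) = (0 :: ennreal)"
        using 1 2 by (auto split: split_indicator)
      then have "?E M x \<xi> + ?E M x (\<xi> - \<eta>) = ennreal (norm (F x \<xi>) + norm (F x (\<xi> - \<eta>)))"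
        by (simp only: diff_zero mult_1_right) simp
      then have "ennreal (norm (F x \<xi> - F x (\<xi> - \<eta>))) \<le> ?E M x \<xi> + ?E M x (\<xi> - \<eta>)"
        by (simp only:) (intro ennreal_leI norm_triangle_ineq4)
      then show ?thesis by (rule add_increasing[rotated]) simp
    qed
    have jb: "japanese_bracket \<eta> \<le> 2" using japanese_bracket_le[of \<eta>] \<eta>1 by simp
    have tr: "?N (\<lambda>x \<xi>. ?E M x (\<xi> - \<eta>)) \<le> ennreal T * ?N (?E M)"
    proof -
      have "?N (\<lambda>x \<xi>. ?E M x (\<xi> - \<eta>)) \<le> ennreal ((sqrt 2 * japanese_bracket \<eta>) powr \<bar>s * q\<bar>) * ?N (?E M)"
        by (rule mixed_norm_powr_translate_le[OF E_meas])
      also have "\<dots> \<le> ennreal T * ?N (?E M)"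
        unfolding T_def using jb by (intro mult_right_mono ennreal_leI powr_mono2) auto
      finally show ?thesis .
    qed
    have "freq_modulus \<eta> \<le> ?N (\<lambda>x \<xi>. ?D x \<xi> + (?E M x \<xi> + ?E M x (\<xi> - \<eta>)))"
      unfolding freq_modulus_def using p q pt by (intro mixed_norm_powr_mono) auto
    also have "\<dots> \<le> ennreal K * (?N ?D + ?N (\<lambda>x \<xi>. ?E M x \<xi> + ?E M x (\<xi> - \<eta>)))"
      unfolding K_def using p q by (intro mixed_norm_powr_add_le) auto
    also have "\<dots> \<le> ennreal K * (ennreal (B * \<delta> powr q) + ennreal K * (?N (?E M) + ennreal T * ?N (?E M)))"
    proof (intro mult_left_mono add_mono B(2))
      have "?N (\<lambda>x \<xi>. ?E M x \<xi> + ?E M x (\<xi> - \<eta>)) \<le> ennreal K * (?N (?E M) + ?N (\<lambda>x \<xi>. ?E M x (\<xi> - \<eta>)))"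
        unfolding K_def using p q by (intro mixed_norm_powr_add_le) auto
      also have "\<dots> \<le> ennreal K * (?N (?E M) + ennreal T * ?N (?E M))"
        by (intro mult_left_mono add_mono tr) auto
      finally show "?N (\<lambda>x \<xi>. ?E M x \<xi> + ?E M x (\<xi> - \<eta>)) \<le> ennreal K * (?N (?E M) + ennreal T * ?N (?E M))" .
    qed (use \<delta> in auto)
    also have "\<dots> \<le> ennreal K * (ennreal (B * \<delta> powr q) + ennreal K * (ennreal c
         + ennreal T * ennreal c))"
      using M by (intro mult_left_mono add_mono) auto
    also have "\<dots> = ennreal (K * (B * \<delta> powr q + K * (c + T * c)))"
      using K T B c by (simp add: ennreal_mult)
    also have "\<dots> \<le> ennreal e"
    proof (rule ennreal_leI)
      have "K * (K * (c + T * c)) = (K * (K * (1 + T))) * c"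
        by (simp add: algebra_simps)
      also have "\<dots> = e / 2"
      proof -
        have "X * (e / (2 * X)) = e / 2" if "X \<noteq> 0" for X :: real using that by simp
        moreover have "K * (K * (1 + T)) \<noteq> 0" using K T by (simp add: add_nonneg_eq_0_iff)
        ultimately show ?thesis unfolding c_def by blast
      qed
      finally show "K * (B * \<delta> powr q + K * (c + T * c)) \<le> e"
        using K\<delta> by (simp only: distrib_left[of K])
    qed
    finally show ?thesis .
  qed
  then show ?thesis using r by (intro exI[of _ "min r 1"]) auto
qed

lemma freq_modulus_average_small:
  fixes \<mu> :: "'a measure"
  assumes \<mu>: "prob_space \<mu>" and sets: "sets \<mu> = sets borel"
    and mom: "\<And>k. integrable \<mu> (\<lambda>\<eta>. norm \<eta> ^ k)" and e: "e > 0"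
  shows "\<exists>n::nat. n \<ge> 1 \<and> (\<integral>\<^sup>+\<eta>. freq_modulus (\<eta> /\<^sub>R real n) \<partial>\<mu>) < ennreal e"
proof -
  interpret \<mu>: prob_space \<mu> by fact
  note [measurable_cong] = sets
  define N where "N = mixed_norm_powr p q s (\<lambda>x \<xi>. ennreal (norm (F x \<xi>)))"
  define K where "K = ennreal (2 powr q * 2 powr (q / p))"
  define m where "m = nat \<lceil>\<bar>s * q\<bar>\<rceil>"
  have m: "\<bar>s * q\<bar> \<le> real m" by (simp add: m_def)
  \<comment> \<open>A dominating function for all contractions \<open>\<eta> / n\<close> at once, as \<open>\<langle>\<eta> / n\<rangle> \<le> 1 + \<bar>\<eta>\<bar>\<close>.\<close>
  define D where "D \<eta> = K * ((1 + ennreal ((2 * (1 + norm \<eta>)) ^ m)) * N)" for \<eta> :: 'a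
  have dom: "freq_modulus (\<eta> /\<^sub>R real (Suc n)) \<le> D \<eta>" for \<eta> n
  proof -
    have "norm (\<eta> /\<^sub>R real (Suc n)) \<le> norm \<eta>"
      using mult_right_mono[of "inverse (real (Suc n))" 1 "norm \<eta>"] by (simp add: inverse_le_1_iff)
    then have "japanese_bracket (\<eta> /\<^sub>R real (Suc n)) \<le> 1 + norm \<eta>"
      using japanese_bracket_le[of "\<eta> /\<^sub>R real (Suc n)"] by linarith
    moreover have "sqrt 2 \<le> 2" by (rule real_le_lsqrt) auto
    ultimately have "sqrt 2 * japanese_bracket (\<eta> /\<^sub>R real (Suc n)) \<le> 2 * (1 + norm \<eta>)"
      by (intro mult_mono) auto
    then have "(sqrt 2 * japanese_bracket (\<eta> /\<^sub>R real (Suc n))) powr \<bar>s * q\<bar> \<le> (2 * (1 + norm \<eta>)) powr \<bar>s * q\<bar>"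
      by (intro powr_mono2) auto
    also have "\<dots> \<le> (2 * (1 + norm \<eta>)) powr real m"
    proof (rule powr_mono[OF m])
      show "1 \<le> 2 * (1 + norm \<eta>)" using mult_mono[of 1 2 1 "1 + norm \<eta>"] by simp
    qed
    also have "\<dots> = (2 * (1 + norm \<eta>)) ^ m"
      using norm_ge_zero[of \<eta>] by (intro powr_realpow) (simp add: add_pos_nonneg)
    finally have "(sqrt 2 * japanese_bracket (\<eta> /\<^sub>R real (Suc n))) powr \<bar>s * q\<bar> \<le> (2 * (1 + norm \<eta>)) ^ m" .
    then have "K * ((1 + ennreal ((sqrt 2 * japanese_bracket (\<eta> /\<^sub>R real (Suc n))) powr \<bar>s * q\<bar>)) * N) \<le> D \<eta>"
      unfolding D_def by (intro mult_left_mono mult_right_mono add_left_mono ennreal_leI) auto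
    then show ?thesis
      using freq_modulus_le[of "\<eta> /\<^sub>R real (Suc n)"] unfolding K_def N_def by (rule order_trans[rotated])
  qed
  have Nfin: "N < \<infinity>" unfolding N_def by (rule F_fin)
  have Dmeas [measurable]: "D \<in> borel_measurable borel" unfolding D_def by measurable
  have Dfin: "(\<integral>\<^sup>+\<eta>. D \<eta> \<partial>\<mu>) < \<infinity>"
  proof -
    have int: "integrable \<mu> (\<lambda>\<eta>. (2 * (1 + norm \<eta>)) ^ m)"
      unfolding binomial_ring power_mult_distrib power_one
      by (intro integrable_mult_right Bochner_Integration.integrable_sum) (use mom in simp)
    have "(\<integral>\<^sup>+\<eta>. D \<eta> \<partial>\<mu>) = K * ((1 + (\<integral>\<^sup>+\<eta>. ennreal ((2 * (1 + norm \<eta>)) ^ m) \<partial>\<mu>)) * N)"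
      unfolding D_def by (simp add: nn_integral_cmult nn_integral_multc nn_integral_add \<mu>.emeasure_space_1)
    also have "(\<integral>\<^sup>+\<eta>. ennreal ((2 * (1 + norm \<eta>)) ^ m) \<partial>\<mu>) = ennreal (\<integral>\<eta>. (2 * (1 + norm \<eta>)) ^ m \<partial>\<mu>)"
      by (rule nn_integral_eq_integral[OF int]) auto
    also have "K * ((1 + ennreal (\<integral>\<eta>. (2 * (1 + norm \<eta>)) ^ m \<partial>\<mu>)) * N) < \<infinity>"
      using Nfin by (simp add: K_def ennreal_mult_less_top)
    finally show ?thesis .
  qed
  have "(\<lambda>n. \<integral>\<^sup>+\<eta>. freq_modulus (\<eta> /\<^sub>R real (Suc n)) \<partial>\<mu>) \<longlonglongrightarrow> (\<integral>\<^sup>+\<eta>. 0 \<partial>\<mu>)"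
  proof (rule nn_integral_dominated_convergence[OF _ _ _ _ Dfin])
    show "AE \<eta> in \<mu>. freq_modulus (\<eta> /\<^sub>R real (Suc n)) \<le> D \<eta>" for n
      using dom by (intro AE_I2)
    show "AE \<eta> in \<mu>. (\<lambda>n. freq_modulus (\<eta> /\<^sub>R real (Suc n))) \<longlonglongrightarrow> 0"
    proof (intro AE_I2 order_tendstoI)
      fix \<eta> :: 'a and a :: ennreal assume "0 < a"
      then obtain b where b: "b > 0" "ennreal b < a"
        using dense[of 0 a] by (metis ennreal_cases ennreal_less_zero_iff not_less_iff_gr_or_eq top_greatest leD)
      obtain r where r: "r > 0" "\<And>\<eta>. norm \<eta> < r \<Longrightarrow> freq_modulus \<eta> \<le> ennreal b"
        using freq_modulus_tendsto_0[OF b(1)] by blast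
      have "(\<lambda>n. norm (\<eta> /\<^sub>R real (Suc n))) \<longlonglongrightarrow> 0"
        using tendsto_mult_left_zero[OF LIMSEQ_inverse_real_of_nat, of "norm \<eta>"] by simp
      then have "\<forall>\<^sub>F n in sequentially. norm (\<eta> /\<^sub>R real (Suc n)) < r"
        using r(1) by (rule order_tendstoD)
      then show "\<forall>\<^sub>F n in sequentially. freq_modulus (\<eta> /\<^sub>R real (Suc n)) < a"
      proof eventually_elim
        case (elim n)
        show ?case by (rule order_le_less_trans[OF r(2)[OF elim] b(2)])
      qed
    qed simp
  qed measurable
  then have "\<forall>\<^sub>F n in sequentially. (\<integral>\<^sup>+\<eta>. freq_modulus (\<eta> /\<^sub>R real (Suc n)) \<partial>\<mu>) < ennreal e"
    using e by (intro order_tendstoD(2)) auto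
  then obtain n where "(\<integral>\<^sup>+\<eta>. freq_modulus (\<eta> /\<^sub>R real (Suc n)) \<partial>\<mu>) < ennreal e"
    using eventually_happens'[OF sequentially_bot] by blast
  then show ?thesis by (intro exI[of _ "Suc n"]) simp
qed

end

section \<open>Cut-offs of a distribution in a modulation space\<close>

lemma schwartz_cnj:
  assumes "h \<in> schwartz_space"
  shows "(\<lambda>t. cnj (h t)) \<in> schwartz_space"
proof (rule schwartzI)
  show "smooth (\<lambda>t. cnj (h t))"
    by (rule smooth_linear[OF schwartz_smooth[OF assms] bounded_linear_cnj])
  fix k and bs :: "'a list" assume bs: "set bs \<subseteq> Basis"
  show "\<exists>C. \<forall>t. japanese_bracket t ^ k * norm (iter_pderiv bs (\<lambda>t. cnj (h t)) t) \<le> C"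
    using schwartz_seminorm_upper[OF assms bs]
    by (auto simp: iter_pderiv_linear[OF schwartz_smooth[OF assms] bounded_linear_cnj bs])
qed

lemma cnj_modulation_translation:
  "(\<lambda>t. cnj (modulation \<xi> (translation x h) t)) = tf_shift (\<lambda>t. cnj (h t)) x (- \<xi>)"
  by (simp add: fun_eq_iff modulation_def translation_def tf_shift_def wave_def exp_cnj)

lemma stft_eq_tf_shift: "stft \<phi>0 f x \<xi> = f (tf_shift (\<lambda>t. cnj (\<phi>0 t)) x (- \<xi>))"
  unfolding stft_def cnj_modulation_translation ..

text \<open>
  The cut-off is the characteristic function of the measure \<open>\<nu>\<close> that arises from the
  band-limited measure \<open>\<mu>\<close> by the contraction \<open>\<eta> \<mapsto> \<eta> / n\<close>.
\<close>

lemma exists_cutoff_near_identity: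
  fixes \<phi>0 :: "'a::euclidean_space \<Rightarrow> complex"
  assumes p: "p \<ge> 1" and q: "q \<ge> 1" and \<phi>0: "\<phi>0 \<in> schwartz_space"
    and f: "f \<in> modulation_space \<phi>0 p q s" and \<epsilon>: "\<epsilon> > 0"
  shows "\<exists>\<phi> \<in> Cc_infinity. modulation_norm \<phi>0 p q s (f - distr_mult \<phi> f) < ennreal \<epsilon>"
proof -
  define g where "g = (\<lambda>t. cnj (\<phi>0 t))"
  have g: "g \<in> schwartz_space" unfolding g_def by (rule schwartz_cnj[OF \<phi>0])
  have ft: "f \<in> tempered_distributions" and ffin: "modulation_norm \<phi>0 p q s f < \<infinity>"
    using f by (simp_all add: modulation_space_def)
  define F where "F = stft \<phi>0 f"
  have F_eq: "F x \<xi> = f (tf_shift g x (- \<xi>))" for x \<xi>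
    unfolding F_def g_def by (rule stft_eq_tf_shift)
  have F_cont: "continuous_on UNIV (\<lambda>z. F (fst z) (snd z))"
    unfolding F_eq
    using continuous_on_compose2[OF tempered_tf_shift_continuous[OF ft g], of UNIV "\<lambda>z. (fst z, - snd z)"]
    by (simp add: continuous_intros)
  have F_fin: "mixed_norm_powr p q s (\<lambda>x \<xi>. ennreal (norm (F x \<xi>))) < \<infinity>"
  proof (rule ccontr)
    assume "\<not> mixed_norm_powr p q s (\<lambda>x \<xi>. ennreal (norm (F x \<xi>))) < \<infinity>"
    then show False
      using ffin by (simp add: modulation_norm_eq_mixed_norm F_def less_top[symmetric])
  qed
  note mod = F_cont F_fin p q
  obtain \<mu> :: "'a measure" where \<mu>: "prob_space \<mu>" "sets \<mu> = sets borel"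
    "\<And>k. integrable \<mu> (\<lambda>\<eta>. norm \<eta> ^ k)" "bounded {t. (\<integral>\<eta>. wave \<eta> t \<partial>\<mu>) \<noteq> 0}"
    using exists_band_limited_probability by blast
  obtain n :: nat where n: "n \<ge> 1"
    and small: "(\<integral>\<^sup>+\<eta>. freq_modulus F p q s (\<eta> /\<^sub>R real n) \<partial>\<mu>) < ennreal (\<epsilon> powr q)"
    using freq_modulus_average_small[OF mod \<mu>(1-3), of "\<epsilon> powr q"] \<epsilon> by auto
  note [measurable_cong] = \<mu>(2)
  interpret \<mu>: prob_space \<mu> by fact
  define \<nu> where "\<nu> = distr \<mu> borel (\<lambda>\<eta>. \<eta> /\<^sub>R real n)"
  have sets\<nu> [measurable_cong]: "sets \<nu> = sets borel" by (simp add: \<nu>_def)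
  interpret \<nu>: prob_space \<nu>
    unfolding \<nu>_def by (rule \<mu>.prob_space_distr) measurable
  have mom: "integrable \<nu> (\<lambda>\<eta>. norm \<eta> ^ k)" for k
    unfolding \<nu>_def using \<mu>(3)[of k]
    by (subst integrable_distr_eq) (auto simp: power_mult_distrib)
  define \<phi> where "\<phi> t = (\<integral>\<eta>. wave \<eta> t \<partial>\<nu>)" for t
  have \<phi>_scale: "\<phi> t = (\<integral>\<eta>. wave \<eta> (t /\<^sub>R real n) \<partial>\<mu>)" for t
    unfolding \<phi>_def \<nu>_def by (subst integral_distr) (auto simp: wave_def)
  have "\<phi> \<in> Cc_infinity"
  proof -
    have "smooth \<phi>" unfolding \<phi>_def[abs_def] by (rule smooth_integral_wave[OF sets\<nu> mom])
    moreover have "bounded {t. \<phi> t \<noteq> 0}"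
    proof -
      have "{t. \<phi> t \<noteq> 0} \<subseteq> (\<lambda>t. real n *\<^sub>R t) ` {t. (\<integral>\<eta>. wave \<eta> t \<partial>\<mu>) \<noteq> 0}"
      proof
        fix t assume "t \<in> {t. \<phi> t \<noteq> 0}"
        then show "t \<in> (\<lambda>t. real n *\<^sub>R t) ` {t. (\<integral>\<eta>. wave \<eta> t \<partial>\<mu>) \<noteq> 0}"
          using n by (intro image_eqI[of _ _ "t /\<^sub>R real n"]) (auto simp: \<phi>_scale)
      qed
      then show ?thesis using bounded_scaling[OF \<mu>(4)] bounded_subset by blast
    qed
    ultimately show ?thesis by (simp add: Cc_infinity_def compact_closure)
  qed
  moreover have "modulation_norm \<phi>0 p q s (f - distr_mult \<phi> f) < ennreal \<epsilon>"
  proof -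
    have convolution: "stft \<phi>0 (f - distr_mult \<phi> f) x \<xi> = (\<integral>\<eta>. F x \<xi> - F x (\<xi> - \<eta>) \<partial>\<nu>)"
      and int: "integrable \<nu> (\<lambda>\<eta>. F x \<xi> - F x (\<xi> - \<eta>))" for x \<xi>
    proof -
      let ?\<psi> = "tf_shift g x (- \<xi>)"
      have shift: "(\<lambda>t. wave \<eta> t * ?\<psi> t) = tf_shift g x (- (\<xi> - \<eta>))" for \<eta>
        by (simp add: fun_eq_iff tf_shift_def wave_def inner_diff_right algebra_simps flip: exp_add)
      note ex = tempered_integral_wave[OF ft schwartz_tf_shift[OF g] \<nu>.finite_measure_axioms sets\<nu> mom, of x "- \<xi>"]
      have i: "integrable \<nu> (\<lambda>\<eta>. F x (\<xi> - \<eta>))" using ex(1) unfolding shift F_eq .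
      then show "integrable \<nu> (\<lambda>\<eta>. F x \<xi> - F x (\<xi> - \<eta>))" by simp
      have "distr_mult \<phi> f ?\<psi> = (\<integral>\<eta>. F x (\<xi> - \<eta>) \<partial>\<nu>)"
        using ex(2) unfolding shift F_eq distr_mult_def \<phi>_def .
      then show "stft \<phi>0 (f - distr_mult \<phi> f) x \<xi> = (\<integral>\<eta>. F x \<xi> - F x (\<xi> - \<eta>) \<partial>\<nu>)"
        using i by (simp add: stft_eq_tf_shift F_eq g_def[symmetric] \<nu>.prob_space)
    qed
    have [measurable]: "(\<lambda>(x, \<xi>, \<eta>). ennreal (norm (F x \<xi> - F x (\<xi> - \<eta>)))) \<in> borel_measurable (borel \<Otimes>\<^sub>M borel \<Otimes>\<^sub>M borel)"
      unfolding case_prod_unfold using F_measurable[OF mod] by measurable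
    have "mixed_norm_powr p q s (\<lambda>x \<xi>. ennreal (norm (stft \<phi>0 (f - distr_mult \<phi> f) x \<xi>)))
       \<le> mixed_norm_powr p q s (\<lambda>x \<xi>. \<integral>\<^sup>+\<eta>. ennreal (norm (F x \<xi> - F x (\<xi> - \<eta>))) \<partial>\<nu>)"
      unfolding convolution using p q
      by (intro mixed_norm_powr_mono integral_norm_bound_ennreal int) auto
    also have "\<dots> \<le> (\<integral>\<^sup>+\<eta>. freq_modulus F p q s \<eta> \<partial>\<nu>)"
      unfolding freq_modulus_def[OF mod]
      by (rule mixed_norm_powr_integral_le[OF \<nu>.prob_space_axioms sets\<nu> _ p q]) measurable
    also have "\<dots> = (\<integral>\<^sup>+\<eta>. freq_modulus F p q s (\<eta> /\<^sub>R real n) \<partial>\<mu>)"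
      unfolding \<nu>_def using freq_modulus_measurable[OF mod] by (subst nn_integral_distr) auto
    also note small
    finally have less: "mixed_norm_powr p q s (\<lambda>x \<xi>. ennreal (norm (stft \<phi>0 (f - distr_mult \<phi> f) x \<xi>))) < ennreal (\<epsilon> powr q)" .
    obtain a where a: "a \<ge> 0" "a < \<epsilon> powr q"
      "mixed_norm_powr p q s (\<lambda>x \<xi>. ennreal (norm (stft \<phi>0 (f - distr_mult \<phi> f) x \<xi>))) = ennreal a"
      using less by (cases "mixed_norm_powr p q s (\<lambda>x \<xi>. ennreal (norm (stft \<phi>0 (f - distr_mult \<phi> f) x \<xi>)))"
          rule: ennreal_cases) (auto simp: ennreal_less_iff)
    then have "a powr (1 / q) < (\<epsilon> powr q) powr (1 / q)"
      using q by (intro powr_less_mono2) auto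
    then have "a powr (1 / q) < \<epsilon>" using q \<epsilon> by (simp add: powr_powr)
    then show ?thesis
      unfolding modulation_norm_eq_mixed_norm a(3) using a(1) \<epsilon> by (simp add: ennreal_less_iff)
  qed
  ultimately show ?thesis by blast
qed

theorem lemma3p1:
  fixes p q s :: real
    and q' :: ereal
    and \<phi>0 :: "real ^ 'n \<Rightarrow> complex"
    and f :: "(real ^ 'n \<Rightarrow> complex) \<Rightarrow> complex"
    and \<epsilon> :: real
  assumes "1 \<le> p" and "1 \<le> q"
    and "1 \<le> q'" and "1 / ereal q + 1 / q' = 1"
    and "ereal s > ereal (real CARD('n)) / q' \<or> (q = 1 \<and> s \<ge> 0)"
    and "\<phi>0 \<in> schwartz_space" and "\<phi>0 \<noteq> (\<lambda>_. 0)"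
    and "f \<in> modulation_space \<phi>0 p q s"
    and "\<epsilon> > 0"
  shows "\<exists>\<phi> \<in> Cc_infinity. modulation_norm \<phi>0 p q s (f - distr_mult \<phi> f) < ennreal \<epsilon>"
  using exists_cutoff_near_identity assms by blast

end
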